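(* Let $L\ge 1$. If $\mathcal T\in\mathbb R^{n\times\cdots\times n}$ is an $(L+2)$-tensor generated, as a tensor train of length $L$, by carriages $\mathcal X_j=\sum_{i_j=1}^{r_{\mathcal X_j}}\lambda^j_{i_j}(\mathbf x^j_{i_j})^{\otimes 3}$, where for all $j\in\{1,\dots,L\}$ the $\lambda^j_{i_j}\in\mathbb R$ are generic coefficients and $\{\mathbf x^j_{i_j}\}_{i_j=1}^{r_{\mathcal X_j}}\subset\mathbb R^n$ is a generic orthonormal set of rank (cardinality) $r_{\mathcal X_j}$, and $\mathcal T$ satisfies the Decreasing Ranks Condition, namely there exists $j\in\{1,\dots,L\}$ such that $r_{\mathcal X_1}\ge r_{\mathcal X_2}\ge\cdots\ge r_{\mathcal X_j}$ and $r_{\mathcal X_j}\le r_{\mathcal X_{j+1}}\le\cdots\le r_{\mathcal X_L}$, then the Kernel Completion Algorithm described in the context recovers all of the ranks $r_{\mathcal X_j}$, and all of the vectors $\mathbf x^j_{i_j}$ and coefficients $\lambda^j_{i_j}$ up to permutation and sign (the coefficient vectors $\boldsymbol\lambda_j=(\lambda^j_{i_j})_{i_j}$ being moreover determined only up to non-zero rescalings $\boldsymbol\lambda_j\mapsto c_j\boldsymbol\lambda_j$ with $c_1c_2\cdots c_L=1$).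
   Context: Tensor train: the tensor generated by the carriages $\mathcal X_1,\dots,\mathcal X_L$ is obtained by contracting consecutive carriages along one mode, i.e. for $L\ge2$ $$\mathcal T=\sum_{i_1=1}^{r_{\mathcal X_1}}\cdots\sum_{i_L=1}^{r_{\mathcal X_L}}\lambda^1_{i_1}\cdots\lambda^L_{i_L}\,\Big(\prod_{k=1}^{L-1}\langle\mathbf x^k_{i_k},\mathbf x^{k+1}_{i_{k+1}}\rangle\Big)(\mathbf x^1_{i_1})^{\otimes2}\otimes\mathbf x^2_{i_2}\otimes\cdots\otimes\mathbf x^{L-1}_{i_{L-1}}\otimes(\mathbf x^L_{i_L})^{\otimes2},$$ and $\mathcal T=\mathcal X_1$ for $L=1$. Generic: an object that lies in a Zariski-closed subset of some $\mathbb R^N$ is generic if it lies in some Zariski-open subset of this closed set; so an object drawn at random from the closed set is generic with probability 1. Expressions such as $\mathcal T(\cdot,\cdot,\mathbf v,\dots,\mathbf v)$ denote contraction of the indicated modes with $\mathbf v$, leaving the modes marked by dots free. Kernel Completion Algorithm, input $\mathcal T$ (for $L\le 2$ the loops below are empty): (1) Left-to-right pass. For a generic $\mathbf v\in\mathbb R^n$, let $\{\mathbf x^1_{i}\}_{i=1}^{r_{\mathcal X_1}}$ be the unit eigenvectors of $\mathcal T(\cdot,\cdot,\mathbf v,\dots,\mathbf v)$ with nonzero eigenvalue, and set $\mathbf x^{1,\mathrm{LR}}_i=\mathbf x^1_i$, $r_{\mathcal X_1,\mathrm{LR}}=r_{\mathcal X_1}$. For $j=2,\dots,L-1$: (a)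 Let $r=r_{\mathcal X_{j-1},\mathrm{LR}}$ and let $\mathbf A$ be an $n\times n$ orthogonal matrix whose first $r$ columns are the $\mathbf x^{j-1,\mathrm{LR}}_i$. For a generic $\mathbf v\in\mathbb R^n$ let $\mathbf T$ be the matrix obtained from $\mathcal T$ by contracting with $\mathbf v$ all modes except $j$ and $j+1$ (a free mode of carriage $j-1$ and the free mode of carriage $j$), and put $\mathbf S=\mathbf A^\top\mathbf T\mathbf A$. (b) Let $\overline{\mathbf T}$ be the top-left $r\times r$ block of $\mathbf S$. If $r>1$, take a non-zero vector $(\ell_1,\dots,\ell_r)$ in the nullspace of the $\binom r2\times r$ matrix having, for each pair $p\neq q$ in $\{1,\dots,r\}$, a row with entry $\overline{\mathbf T}_{pq}$ in column $p$, entry $-\overline{\mathbf T}_{qp}$ in column $q$ and zeros elsewhere, and replace $\mathbf S$ by $\mathrm{diag}(\ell_1,\dots,\ell_r,1,\dots,1)\,\mathbf S$. (c) Replace the first $r$ columns of $\mathbf S$ by the transpose of its first $r$ rows. (d) For $k=r+1,\dots,n$: let $\mathbf R$ be $\mathbf S$ with the entries $\mathbf S_{k,m}$, $k\le m\le n$, replaced by variables $x_m$; perform Gaussian elimination on $\mathbf R$; set all resulting entries containing the $x_m$ to $0$ and solve for each $x_m$; replace the entries $\mathbf S_{k,m}$ and $\mathbf S_{m,k}$ of $\mathbf S$ by the values $x_m$. (e) Let $\{\mathbf x^{j,\mathrm{LR}}_i\}$ be the unit eigenvectors of $\mathbf A\mathbf S\mathbf A^\top$ with nonzero eigenvalue and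 $r_{\mathcal X_j,\mathrm{LR}}$ their number. If $r_{\mathcal X_j,\mathrm{LR}}>r_{\mathcal X_{j-1},\mathrm{LR}}$, set the left-to-right sets for $j,j+1,\dots,L-1$ to be empty and stop the pass. (2) Right-to-left pass. The same procedure with the order of the carriages reversed: start from the unit eigenvectors $\{\mathbf x^L_i\}$ of $\mathcal T(\mathbf v,\dots,\mathbf v,\cdot,\cdot)$ with nonzero eigenvalue, run $j=L-1,\dots,2$ with $j+1$ in place of $j-1$ (the free modes being the free mode of carriage $j$ and a free mode of carriage $j+1$) and with $\mathbf S=\mathbf A^\top\mathbf T^\top\mathbf A$, producing sets $\{\mathbf x^{j,\mathrm{RL}}_i\}$ of sizes $r_{\mathcal X_j,\mathrm{RL}}$. (3) For $2\le j\le L-1$, output as $\{\mathbf x^j_i\}_{i=1}^{r_{\mathcal X_j}}$ whichever of $\{\mathbf x^{j,\mathrm{LR}}_i\}$ and $\{\mathbf x^{j,\mathrm{RL}}_i\}$ has more elements (an arbitrary choice if the sizes are equal). (4) Form $\mathcal R\in\mathbb R^{r_{\mathcal X_1}\times\cdots\times r_{\mathcal X_L}}$ with entries $$\mathcal R_{i_1\dots i_L}=\frac{\mathcal T(\mathbf x^1_{i_1},\mathbf x^1_{i_1},\mathbf x^2_{i_2},\dots,\mathbf x^{L-1}_{i_{L-1}},\mathbf x^L_{i_L},\mathbf x^L_{i_L})}{\prod_{k=1}^{L-1}\langle\mathbf x^k_{i_k},\mathbf x^{k+1}_{i_{k+1}}\rangle}$$ (for $L=1$: $\mathcal R_i=\mathcal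 T(\mathbf x^1_i,\mathbf x^1_i,\mathbf x^1_i)$), and output the factors $\boldsymbol\lambda_1,\dots,\boldsymbol\lambda_L$ of $\mathcal R=\boldsymbol\lambda_1\otimes\cdots\otimes\boldsymbol\lambda_L$ found by the rank-1 alternating least squares algorithm applied to $\mathcal R$. *)

theory Defs
  imports
    "Jordan_Normal_Form.Matrix_Kernel"
    "Jordan_Normal_Form.Char_Poly"
    "HOL-Library.FuncSet"
begin

section \<open>Zariski-generic points\<close>

text \<open>The space \<open>\<real>\<^sup>I\<close>, with coordinates indexed by a set \<open>I\<close>, is \<open>I \<rightarrow>\<^sub>E UNIV\<close>.\<close>

inductive poly_fun :: "'i set \<Rightarrow> (('i \<Rightarrow> real) \<Rightarrow> real) \<Rightarrow> bool" for I where
  poly_fun_const: "poly_fun I (\<lambda>_. c)"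
| poly_fun_coord: "i \<in> I \<Longrightarrow> poly_fun I (\<lambda>z. z i)"
| poly_fun_add: "poly_fun I f \<Longrightarrow> poly_fun I g \<Longrightarrow> poly_fun I (\<lambda>z. f z + g z)"
| poly_fun_mult: "poly_fun I f \<Longrightarrow> poly_fun I g \<Longrightarrow> poly_fun I (\<lambda>z. f z * g z)"

definition zariski_closed :: "'i set \<Rightarrow> ('i \<Rightarrow> real) set \<Rightarrow> bool" where
  "zariski_closed I C \<longleftrightarrow>
     (\<exists>F. (\<forall>f\<in>F. poly_fun I f) \<and> C = {z \<in> I \<rightarrow>\<^sub>E UNIV. \<forall>f\<in>F. f z = 0})"

text \<open>
  A set of generic points of \<open>V\<close> is a Zariski-open subset of \<open>V\<close> that is Zariski-dense in \<open>V\<close>.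
  Density is needed, and nonemptiness is not enough, because \<open>V\<close> may be reducible: for instance
  the orthogonal group has two components, and a random point may lie in either of them.
\<close>

definition generic_set :: "'i set \<Rightarrow> ('i \<Rightarrow> real) set \<Rightarrow> ('i \<Rightarrow> real) set \<Rightarrow> bool" where
  "generic_set I V U \<longleftrightarrow>
     (\<exists>C. zariski_closed I C \<and> U = V - C) \<and>
     (\<forall>C. zariski_closed I C \<longrightarrow> U \<subseteq> C \<longrightarrow> V \<subseteq> C)"


section \<open>Tensors and tensor trains\<close>

text \<open>
  A tensor of order \<open>d\<close> is a real function of multi-indices \<open>i \<in> midx d N\<close>; the modes are
  numbered \<open>1, \<dots>, d\<close>, and mode \<open>m\<close> has the index range \<open>{..<N m}\<close>.
\<close>

type_synonym tensor = "(nat \<Rightarrow> nat) \<Rightarrow> real"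

definition midx :: "nat \<Rightarrow> (nat \<Rightarrow> nat) \<Rightarrow> (nat \<Rightarrow> nat) set" where
  "midx d N = PiE {1..d} (\<lambda>m. {..<N m})"

definition tensor_eval :: "nat \<Rightarrow> nat \<Rightarrow> tensor \<Rightarrow> (nat \<Rightarrow> real vec) \<Rightarrow> real" where
  "tensor_eval n d T u = (\<Sum>i\<in>midx d (\<lambda>_. n). T i * (\<Prod>m=1..d. u m $ i m))"

text \<open>Contraction of all modes except \<open>p\<close> (rows) and \<open>q\<close> (columns) with \<open>v\<close>:\<close>

definition contract :: "nat \<Rightarrow> nat \<Rightarrow> tensor \<Rightarrow> nat \<Rightarrow> nat \<Rightarrow> real vec \<Rightarrow> real mat" where
  "contract n d T p q v = mat n n (\<lambda>(a, b).
     \<Sum>i\<in>{i \<in> midx d (\<lambda>_. n). i p = a \<and> i q = b}. T i * (\<Prod>m\<in>{1..d} - {p, q}. v $ i m))"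

text \<open>
  Carriage \<open>j \<in> {1..L}\<close> is \<open>\<Sum>a<r j. lam j a \<cdot> (x j a)\<^sup>\<otimes>\<^sup>3\<close>.  In the train, mode \<open>j + 1\<close> belongs to
  carriage \<open>j\<close>, and in addition mode \<open>1\<close> belongs to carriage \<open>1\<close> and mode \<open>L + 2\<close> to carriage \<open>L\<close>.
  For \<open>L = 1\<close> this is the carriage itself.
\<close>

definition tensor_train ::
    "nat \<Rightarrow> (nat \<Rightarrow> nat) \<Rightarrow> (nat \<Rightarrow> nat \<Rightarrow> real) \<Rightarrow> (nat \<Rightarrow> nat \<Rightarrow> real vec) \<Rightarrow> tensor" where
  "tensor_train L r lam x = (\<lambda>i. \<Sum>a\<in>midx L r.
     (\<Prod>j=1..L. lam j (a j)) *
     (\<Prod>k=1..<L. x k (a k) \<bullet> x (k + 1) (a (k + 1))) *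
     (x 1 (a 1) $ i 1 * (\<Prod>j=1..L. x j (a j) $ i (j + 1)) * x L (a L) $ i (L + 2)))"

definition decreasing_ranks :: "nat \<Rightarrow> (nat \<Rightarrow> nat) \<Rightarrow> bool" where
  "decreasing_ranks L r \<longleftrightarrow> (\<exists>j\<in>{1..L}. antimono_on {1..j} r \<and> mono_on {j..L} r)"

text \<open>
  The parameters of a train, as a point of the product of the spaces \<open>\<real>\<^bsup>r j\<^esup>\<close> and the Stiefel
  varieties of \<open>r j\<close> orthonormal vectors in \<open>\<real>\<^sup>n\<close>.
\<close>

datatype coord = Coef nat nat | Comp nat nat nat

definition train_coords :: "nat \<Rightarrow> nat \<Rightarrow> (nat \<Rightarrow> nat) \<Rightarrow> coord set" where
  "train_coords n L r =
     {Coef j i | j i. j \<in> {1..L} \<and> i < r j} \<union> {Comp j i k | j i k. j \<in> {1..L} \<and> i < r j \<and> k < n}"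

definition train_coef :: "(coord \<Rightarrow> real) \<Rightarrow> nat \<Rightarrow> nat \<Rightarrow> real" where
  "train_coef z j i = z (Coef j i)"

definition train_vec :: "nat \<Rightarrow> (coord \<Rightarrow> real) \<Rightarrow> nat \<Rightarrow> nat \<Rightarrow> real vec" where
  "train_vec n z j i = vec n (\<lambda>k. z (Comp j i k))"

definition train_params :: "nat \<Rightarrow> nat \<Rightarrow> (nat \<Rightarrow> nat) \<Rightarrow> (coord \<Rightarrow> real) set" where
  "train_params n L r = {z \<in> train_coords n L r \<rightarrow>\<^sub>E UNIV.
     \<forall>j\<in>{1..L}. \<forall>p<r j. \<forall>q<r j.
       train_vec n z j p \<bullet> train_vec n z j q = (if p = q then 1 else 0)}"


section \<open>One step of the kernel completion\<close>

definition orthonormal_list :: "nat \<Rightarrow> real vec list \<Rightarrow> bool" where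
  "orthonormal_list n ys \<longleftrightarrow> set ys \<subseteq> carrier_vec n \<and>
     (\<forall>p<length ys. \<forall>q<length ys. ys ! p \<bullet> ys ! q = (if p = q then 1 else 0))"

text \<open>
  The unit eigenvectors of a symmetric matrix with nonzero eigenvalue, one for each sign and in an
  arbitrary order; in case of a multiple eigenvalue, an orthonormal basis of the eigenspace.
\<close>

definition unit_eigenvectors :: "nat \<Rightarrow> real mat \<Rightarrow> real vec list \<Rightarrow> bool" where
  "unit_eigenvectors n M ys \<longleftrightarrow> orthonormal_list n ys \<and>
     (\<forall>y\<in>set ys. \<exists>e. e \<noteq> 0 \<and> eigenvector M y e) \<and>
     (\<forall>y e. e \<noteq> 0 \<and> eigenvector M y e \<longrightarrow> (\<exists>y'\<in>set ys. y' \<bullet> y \<noteq> 0))"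

definition scaling_matrix :: "nat \<Rightarrow> real mat \<Rightarrow> real mat" where
  "scaling_matrix r B = mat_of_rows r
     [vec r (\<lambda>m. if m = p then B $$ (p, q) else if m = q then - B $$ (q, p) else 0).
        p \<leftarrow> [0..<r], q \<leftarrow> [0..<p]]"

definition rescaled :: "nat \<Rightarrow> nat \<Rightarrow> real mat \<Rightarrow> real mat \<Rightarrow> bool" where
  "rescaled n r S S' \<longleftrightarrow>
     (if r > 1
      then \<exists>l \<in> mat_kernel (scaling_matrix r (mat r r (\<lambda>(p, q). S $$ (p, q)))).
             l \<noteq> 0\<^sub>v r \<and> S' = mat_diag n (\<lambda>p. if p < r then l $ p else 1) * S
      else S' = S)"

definition copy_rows :: "nat \<Rightarrow> nat \<Rightarrow> real mat \<Rightarrow> real mat" where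
  "copy_rows n r S = mat n n (\<lambda>(p, q). if q < r then S $$ (q, p) else S $$ (p, q))"

text \<open>
  Matrices with entries that are affine in the variables: the entry \<open>f\<close> stands for
  \<open>f None + (\<Sum>m. f (Some m) * x m)\<close>.
\<close>

type_synonym affine = "nat option \<Rightarrow> real"

definition has_variable :: "affine \<Rightarrow> bool" where
  "has_variable f \<longleftrightarrow> (\<exists>m. f (Some m) \<noteq> 0)"

definition affine_value :: "nat \<Rightarrow> affine \<Rightarrow> (nat \<Rightarrow> real) \<Rightarrow> real" where
  "affine_value n f x = f None + (\<Sum>m<n. f (Some m) * x m)"

definition with_variables :: "nat \<Rightarrow> nat \<Rightarrow> real mat \<Rightarrow> affine mat" where
  "with_variables n k S = mat n n (\<lambda>(p, q).
     if p = k \<and> k \<le> q then (\<lambda>t. if t = Some q then 1 else 0)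
     else (\<lambda>t. if t = None then S $$ (p, q) else 0))"

text \<open>
  Use of row \<open>p\<close>, whose entries are constants, as a pivot row: its leading entry is eliminated from
  all rows below it, including the row that contains the variables.
\<close>

definition eliminate :: "nat \<Rightarrow> nat \<Rightarrow> affine mat \<Rightarrow> affine mat" where
  "eliminate n p R =
     (if \<forall>q<n. (R $$ (p, q)) None = 0 then R
      else let c = (LEAST q. (R $$ (p, q)) None \<noteq> 0) in
        mat n n (\<lambda>(p', q). if p' \<le> p then R $$ (p', q)
          else (\<lambda>t. (R $$ (p', q)) t - (R $$ (p', c)) t / (R $$ (p, c)) None * (R $$ (p, q)) None)))"

text \<open>
  Only the rows above row \<open>k\<close> serve as pivot rows: row \<open>k\<close> contains the variables, and the rows below
  it still contain placeholders in place of the entries that have not been completed yet.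
\<close>

definition gauss_elim :: "nat \<Rightarrow> nat \<Rightarrow> affine mat \<Rightarrow> affine mat" where
  "gauss_elim n k R = fold (eliminate n) [0..<k] R"

definition complete_row :: "nat \<Rightarrow> nat \<Rightarrow> real mat \<Rightarrow> real mat \<Rightarrow> bool" where
  "complete_row n k S S' \<longleftrightarrow>
     (let R = gauss_elim n k (with_variables n k S) in
      \<exists>x. (\<forall>p<n. \<forall>q<n. has_variable (R $$ (p, q)) \<longrightarrow> affine_value n (R $$ (p, q)) x = 0) \<and>
          S' = mat n n (\<lambda>(p, q). if p = k \<and> k \<le> q then x q
                                 else if q = k \<and> k \<le> p then x p
                                 else S $$ (p, q)))"

definition completed :: "nat \<Rightarrow> nat \<Rightarrow> real mat \<Rightarrow> real mat \<Rightarrow> bool" where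
  "completed n r S S' \<longleftrightarrow>
     (\<exists>Q. Q r = S \<and> Q n = S' \<and> (\<forall>k\<in>{r..<n}. complete_row n k (Q k) (Q (Suc k))))"

definition kc_step :: "nat \<Rightarrow> real mat \<Rightarrow> real vec list \<Rightarrow> real vec list \<Rightarrow> bool" where
  "kc_step n T prev new \<longleftrightarrow>
     (let r = length prev in
      \<exists>A S S'. A \<in> carrier_mat n n \<and> transpose_mat A * A = 1\<^sub>m n \<and> (\<forall>p<r. col A p = prev ! p) \<and>
        rescaled n r (transpose_mat A * T * A) S \<and>
        completed n r (copy_rows n r S) S' \<and>
        unit_eigenvectors n (A * S' * transpose_mat A) new)"

text \<open>
  A pass that has been stopped continues with empty lists.  Away from the region where a pass is
  successful, the null space used for the rescaling may be trivial; a pass is also stopped when its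
  next step cannot be carried out.
\<close>

definition kc_next :: "nat \<Rightarrow> real mat \<Rightarrow> real vec list \<Rightarrow> real vec list \<Rightarrow> bool" where
  "kc_next n T prev new \<longleftrightarrow>
     (if prev = [] \<or> (\<nexists>ys. kc_step n T prev ys) then new = []
      else \<exists>ys. kc_step n T prev ys \<and> new = (if length ys > length prev then [] else ys))"


section \<open>The Kernel Completion Algorithm\<close>

text \<open>The vectors \<open>v j\<close> are the ones drawn by the algorithm when it deals with carriage \<open>j\<close>.\<close>

definition left_right_pass ::
    "nat \<Rightarrow> nat \<Rightarrow> tensor \<Rightarrow> (nat \<Rightarrow> real vec) \<Rightarrow> (nat \<Rightarrow> real vec list) \<Rightarrow> bool" where
  "left_right_pass n L T v X \<longleftrightarrow>
     unit_eigenvectors n (contract n (L + 2) T 1 2 (v 1)) (X 1) \<and>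
     (\<forall>j\<in>{2..<L}. kc_next n (contract n (L + 2) T j (j + 1) (v j)) (X (j - 1)) (X j))"

definition right_left_pass ::
    "nat \<Rightarrow> nat \<Rightarrow> tensor \<Rightarrow> (nat \<Rightarrow> real vec) \<Rightarrow> (nat \<Rightarrow> real vec list) \<Rightarrow> bool" where
  "right_left_pass n L T v X \<longleftrightarrow>
     unit_eigenvectors n (contract n (L + 2) T (L + 1) (L + 2) (v L)) (X L) \<and>
     (\<forall>j\<in>{2..<L}. kc_next n (transpose_mat (contract n (L + 2) T (j + 1) (j + 2) (v j)))
                     (X (j + 1)) (X j))"

text \<open>For \<open>L = 1\<close>, the two passes both compute the vectors of the only carriage.\<close>

definition kc_vectors ::
    "nat \<Rightarrow> nat \<Rightarrow> tensor \<Rightarrow> (nat \<Rightarrow> real vec) \<Rightarrow> (nat \<Rightarrow> real vec) \<Rightarrow> (nat \<Rightarrow> real vec list) \<Rightarrow> bool"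
  where
  "kc_vectors n L T v w y \<longleftrightarrow>
     (\<exists>X Z. left_right_pass n L T v X \<and> right_left_pass n L T w Z \<and>
        y 1 = X 1 \<and> (L \<ge> 2 \<longrightarrow> y L = Z L) \<and>
        (\<forall>j\<in>{2..<L}. y j = X j \<and> length (Z j) \<le> length (X j) \<or>
                      y j = Z j \<and> length (X j) \<le> length (Z j)))"

definition kc_coef_tensor :: "nat \<Rightarrow> nat \<Rightarrow> tensor \<Rightarrow> (nat \<Rightarrow> real vec list) \<Rightarrow> tensor" where
  "kc_coef_tensor n L T y = (\<lambda>i.
     tensor_eval n (L + 2) T
       (\<lambda>m. if m = 1 then y 1 ! i 1 else if m = L + 2 then y L ! i L else y (m - 1) ! i (m - 1)) /
     (\<Prod>k=1..<L. y k ! i k \<bullet> y (k + 1) ! i (k + 1)))"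

text \<open>Rank-1 alternating least squares for a tensor \<open>R\<close> of order \<open>L\<close> with mode sizes \<open>N\<close>:\<close>

definition rank1_error :: "nat \<Rightarrow> (nat \<Rightarrow> nat) \<Rightarrow> tensor \<Rightarrow> (nat \<Rightarrow> real vec) \<Rightarrow> real" where
  "rank1_error L N R u = (\<Sum>i\<in>midx L N. (R i - (\<Prod>j=1..L. u j $ i j))\<^sup>2)"

definition als_update ::
    "nat \<Rightarrow> (nat \<Rightarrow> nat) \<Rightarrow> tensor \<Rightarrow> nat \<Rightarrow> (nat \<Rightarrow> real vec) \<Rightarrow> (nat \<Rightarrow> real vec) \<Rightarrow> bool" where
  "als_update L N R j u u' \<longleftrightarrow>
     (\<exists>w\<in>carrier_vec (N j). u' = u(j := w) \<and>
        (\<forall>w'\<in>carrier_vec (N j). rank1_error L N R (u(j := w)) \<le> rank1_error L N R (u(j := w'))))"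

definition als_sweep ::
    "nat \<Rightarrow> (nat \<Rightarrow> nat) \<Rightarrow> tensor \<Rightarrow> (nat \<Rightarrow> real vec) \<Rightarrow> (nat \<Rightarrow> real vec) \<Rightarrow> bool" where
  "als_sweep L N R u u' \<longleftrightarrow>
     (\<exists>U. U 0 = u \<and> U L = u' \<and> (\<forall>j\<in>{1..L}. als_update L N R j (U (j - 1)) (U j)))"

text \<open>Any positive number of sweeps is allowed, which covers every stopping criterion.\<close>

definition als_result ::
    "nat \<Rightarrow> (nat \<Rightarrow> nat) \<Rightarrow> tensor \<Rightarrow> (nat \<Rightarrow> real vec) \<Rightarrow> (nat \<Rightarrow> real vec) \<Rightarrow> bool" where
  "als_result L N R = tranclp (als_sweep L N R)"

definition als_coords :: "nat \<Rightarrow> (nat \<Rightarrow> nat) \<Rightarrow> (nat \<times> nat) set" where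
  "als_coords L N = Sigma {1..L} (\<lambda>j. {..<N j})"

definition als_start :: "(nat \<Rightarrow> nat) \<Rightarrow> (nat \<times> nat \<Rightarrow> real) \<Rightarrow> nat \<Rightarrow> real vec" where
  "als_start N z j = vec (N j) (\<lambda>i. z (j, i))"


section \<open>Recovery\<close>

text \<open>
  The permutations and the signs are the same for vectors and coefficients:
  \<open>\<lambda> \<cdot> x\<^sup>\<otimes>\<^sup>3 = (- \<lambda>) \<cdot> (- x)\<^sup>\<otimes>\<^sup>3\<close>.
\<close>

definition recovers ::
    "nat \<Rightarrow> (nat \<Rightarrow> nat) \<Rightarrow> (nat \<Rightarrow> nat \<Rightarrow> real) \<Rightarrow> (nat \<Rightarrow> nat \<Rightarrow> real vec) \<Rightarrow>
     (nat \<Rightarrow> real vec list) \<Rightarrow> (nat \<Rightarrow> real vec) \<Rightarrow> bool" where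
  "recovers L r lam x y u \<longleftrightarrow>
     (\<forall>j\<in>{1..L}. length (y j) = r j \<and> dim_vec (u j) = r j) \<and>
     (\<exists>(\<pi> :: nat \<Rightarrow> nat \<Rightarrow> nat) (s :: nat \<Rightarrow> nat \<Rightarrow> real) (c :: nat \<Rightarrow> real).
        (\<Prod>j=1..L. c j) = 1 \<and>
        (\<forall>j\<in>{1..L}. c j \<noteq> 0 \<and> \<pi> j permutes {..<r j} \<and>
           (\<forall>i<r j. s j i \<in> {1, - 1} \<and>
              y j ! i = s j i \<cdot>\<^sub>v x j (\<pi> j i) \<and>
              u j $ i = c j * (s j i * lam j (\<pi> j i)))))"

end

theory Submission
  imports Defs
begin

text \<open>
  Contracting all modes but two neighbouring ones turns the train into \<open>P Q\<close>, where
  \<open>P = \<Sum>\<^sub>p \<alpha>\<^sub>p x\<^sub>p x\<^sub>p\<^sup>T\<close> and \<open>Q = \<Sum>\<^sub>k \<beta>\<^sub>k y\<^sub>k y\<^sub>k\<^sup>T\<close> are built from the vectors of the two carriages.  In a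
  basis that starts with the \<open>x\<^sub>p\<close>, the top rows of \<open>P Q\<close> are rows of the symmetric matrix \<open>Q\<close> scaled
  by \<open>\<alpha>\<^sub>p\<close>.  Symmetry determines the scaling up to a common factor, and if the Gram matrix of
  the \<open>x\<^sub>p\<close> and the \<open>y\<^sub>k\<close> has a left inverse, then these rows span the row space of \<open>Q\<close>, so the
  elimination restores all of \<open>Q\<close>, whose eigenvectors are the \<open>y\<^sub>k\<close>.  Hence a pass is correct as long as
  the ranks do not increase; beyond the minimum its lists are too short and the other pass wins.

  The needed genericity is a finite list of polynomial conditions.  Any point of the parameter space
  can be moved along rational curves (rotations of a carriage in a plane, translations of the
  coefficients), and along such curves nonvanishing conditions can be satisfied simultaneously as
  soon as each of them can be satisfied separately.  Coefficients that single out one index per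
  carriage serve as separate witnesses.
\<close>

section \<open>Generic points of varieties that are connected by rational curves\<close>

text \<open>Density is to be shown on a variety that may be reducible, so a single point where a
  polynomial does not vanish says nothing about the other components: a witness is needed within
  reach of every point. The curves have to be rational because orthonormal sets move on compact
  spheres, where polynomial curves are constant, whereas the circle has a rational parametrization
  without real poles. Density itself is then an instance of the argument for several conditions: a
  polynomial that vanishes on the good set but not at some point of the variety would be one more
  condition to be kept nonzero on the way to a good point. Directions enter the conditions on the
  train existentially. For a good train each condition is therefore a nonzero polynomial in the
  direction, and the same argument, now with translations only, yields generic directions; it also
  yields generic starting points for the alternating least squares.\<close>

definition rational_fun :: "(real \<Rightarrow> real) \<Rightarrow> bool" where
  "rational_fun f \<longleftrightarrow> (\<exists>p q. \<forall>t. poly q t \<noteq> 0 \<and> f t = poly p t / poly q t)"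

lemma rational_fun_poly: "rational_fun (\<lambda>t. poly p t)"
  unfolding rational_fun_def by (intro exI[of _ p] exI[of _ 1]) auto

lemma rational_fun_const: "rational_fun (\<lambda>_. c)"
  using rational_fun_poly[of "[:c:]"] by simp

lemma rational_fun_add:
  assumes "rational_fun f" "rational_fun g"
  shows "rational_fun (\<lambda>t. f t + g t)"
proof -
  obtain p q p' q' where "\<forall>t. poly q t \<noteq> 0 \<and> f t = poly p t / poly q t"
    "\<forall>t. poly q' t \<noteq> 0 \<and> g t = poly p' t / poly q' t"
    using assms unfolding rational_fun_def by blast
  then show ?thesis unfolding rational_fun_def
    by (intro exI[of _ "p * q' + p' * q"] exI[of _ "q * q'"]) (simp add: field_simps)
qed

lemma rational_fun_mult:
  assumes "rational_fun f" "rational_fun g"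
  shows "rational_fun (\<lambda>t. f t * g t)"
proof -
  obtain p q p' q' where "\<forall>t. poly q t \<noteq> 0 \<and> f t = poly p t / poly q t"
    "\<forall>t. poly q' t \<noteq> 0 \<and> g t = poly p' t / poly q' t"
    using assms unfolding rational_fun_def by blast
  then show ?thesis unfolding rational_fun_def
    by (intro exI[of _ "p * p'"] exI[of _ "q * q'"]) simp
qed

text \<open>Both numerators are nonzero polynomials, so their product has finitely many roots. This
  property of the line stands in for irreducibility of the variety.\<close>

lemma rational_fun_common_nonzero:
  assumes "rational_fun f" "rational_fun g" "f s \<noteq> 0" "g t \<noteq> 0"
  shows "\<exists>u. f u \<noteq> 0 \<and> g u \<noteq> 0"
proof -
  obtain p q p' q' where *: "\<forall>t. poly q t \<noteq> 0 \<and> f t = poly p t / poly q t"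
    "\<forall>t. poly q' t \<noteq> 0 \<and> g t = poly p' t / poly q' t"
    using assms unfolding rational_fun_def by blast
  have "p * p' \<noteq> 0" using * assms by auto
  then have "finite {u. poly (p * p') u = 0}" by (rule poly_roots_finite)
  then obtain u where "poly (p * p') u \<noteq> 0"
    using ex_new_if_finite[OF infinite_UNIV_char_0[where 'a=real]] by blast
  then show ?thesis using * by (intro exI[of _ u]) auto
qed

section \<open>Closure properties of polynomial functions\<close>

lemma poly_fun_sum:
  assumes "\<And>i. i \<in> A \<Longrightarrow> poly_fun I (f i)"
  shows "poly_fun I (\<lambda>z. \<Sum>i\<in>A. f i z)"
  using assms
  by (induction A rule: infinite_finite_induct) (auto intro: poly_fun.intros)

lemma poly_fun_prod:
  assumes "\<And>i. i \<in> A \<Longrightarrow> poly_fun I (f i)"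
  shows "poly_fun I (\<lambda>z. \<Prod>i\<in>A. f i z)"
  using assms
  by (induction A rule: infinite_finite_induct) (auto intro: poly_fun.intros)

lemma poly_fun_diff:
  assumes "poly_fun I f" "poly_fun I g"
  shows "poly_fun I (\<lambda>z. f z - g z)"
  using poly_fun_add[OF assms(1) poly_fun_mult[OF poly_fun_const[of I "-1"] assms(2)]] by simp

lemma poly_fun_comp:
  assumes "poly_fun I f" "\<And>i. i \<in> I \<Longrightarrow> poly_fun I (\<lambda>z. h z i)"
  shows "poly_fun I (\<lambda>z. f (h z))"
  using assms by (induction rule: poly_fun.induct) (auto intro: poly_fun.intros)

lemma rational_fun_poly_fun:
  assumes "poly_fun I f" "\<And>i. i \<in> I \<Longrightarrow> rational_fun (\<lambda>t. h t i)"
  shows "rational_fun (\<lambda>t. f (h t))"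
  using assms
  by (induction rule: poly_fun.induct)
    (auto intro: rational_fun_const rational_fun_add rational_fun_mult)

text \<open>Two kinds of regularity are demanded because a move is used in two ways: polynomial in
  the point for a fixed parameter, so that conditions can be pulled back through later moves, and
  rational in the parameter for a fixed point of \<open>V\<close>, so that a condition excludes only
  finitely many points of the curve. Parameter 0 puts the starting point on the curve.\<close>

definition is_move ::
    "'i set \<Rightarrow> ('i \<Rightarrow> real) set \<Rightarrow> (real \<Rightarrow> ('i \<Rightarrow> real) \<Rightarrow> 'i \<Rightarrow> real) \<Rightarrow> bool" where
  "is_move I V m \<longleftrightarrow> (\<forall>z\<in>V. m 0 z = z) \<and> (\<forall>t. \<forall>z\<in>V. m t z \<in> V) \<and>
     (\<forall>i\<in>I. (\<forall>t. poly_fun I (\<lambda>z. m t z i)) \<and> (\<forall>z\<in>V. rational_fun (\<lambda>t. m t z i)))"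

definition follow ::
    "((real \<Rightarrow> ('i \<Rightarrow> real) \<Rightarrow> 'i \<Rightarrow> real) \<times> real) list \<Rightarrow> ('i \<Rightarrow> real) \<Rightarrow> ('i \<Rightarrow> real)" where
  "follow ws = fold (\<lambda>(m, t). m t) ws"

definition reach :: "'i set \<Rightarrow> ('i \<Rightarrow> real) set \<Rightarrow> ('i \<Rightarrow> real) \<Rightarrow> ('i \<Rightarrow> real) \<Rightarrow> bool" where
  "reach I V z z' \<longleftrightarrow> (\<exists>ws. (\<forall>w\<in>set ws. is_move I V (fst w)) \<and> z' = follow ws z)"

lemma reach_refl: "reach I V z z"
  unfolding reach_def follow_def by (intro exI[of _ "[]"]) auto

lemma reach_trans: "reach I V z z' \<Longrightarrow> reach I V z' z'' \<Longrightarrow> reach I V z z''"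
proof -
  assume "reach I V z z'" "reach I V z' z''"
  then obtain ws ws' where "\<forall>w\<in>set ws. is_move I V (fst w)" "z' = follow ws z"
    "\<forall>w\<in>set ws'. is_move I V (fst w)" "z'' = follow ws' z'"
    unfolding reach_def by blast
  then show ?thesis unfolding reach_def follow_def by (intro exI[of _ "ws @ ws'"]) auto
qed

lemma reach_move: "is_move I V m \<Longrightarrow> reach I V z (m t z)"
  unfolding reach_def follow_def by (intro exI[of _ "[(m, t)]"]) auto

lemma follow_in:
  "z \<in> V \<Longrightarrow> \<forall>w\<in>set ws. is_move I V (fst w) \<Longrightarrow> follow ws z \<in> V"
  unfolding follow_def
  by (induction ws arbitrary: z) (auto simp: is_move_def)

lemma reach_in: "z \<in> V \<Longrightarrow> reach I V z z' \<Longrightarrow> z' \<in> V"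
  unfolding reach_def using follow_in by blast

lemma poly_fun_follow:
  assumes "poly_fun I f" "\<forall>w\<in>set ws. is_move I V (fst w)"
  shows "poly_fun I (\<lambda>z. f (follow ws z))"
  using assms
proof (induction ws)
  case (Cons w ws)
  then have "poly_fun I (\<lambda>z. f (follow ws z))" by auto
  from poly_fun_comp[OF this, of "\<lambda>z. fst w (snd w) z"] Cons show ?case
    by (auto simp: is_move_def follow_def split_beta)
qed (simp add: follow_def)

text \<open>
  The two nonvanishing conditions are brought together one move at a time: on the rational curve
  traced out by the first move, both of them exclude only finitely many parameters.
\<close>

lemma follow_common_nonzero:
  assumes "z \<in> V" "\<forall>w\<in>set ws. is_move I V (fst w)" "poly_fun I f" "poly_fun I g"
    "f z \<noteq> 0" "g (follow ws z) \<noteq> 0"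
  shows "\<exists>z'. reach I V z z' \<and> f z' \<noteq> 0 \<and> g z' \<noteq> 0"
  using assms
proof (induction ws arbitrary: z)
  case Nil
  then show ?case using reach_refl by (auto simp: follow_def)
next
  case (Cons w ws)
  obtain m t where w: "w = (m, t)" by (cases w)
  have m: "is_move I V m" using Cons.prems w by auto
  have h: "poly_fun I (\<lambda>z. g (follow ws z))" using Cons.prems poly_fun_follow by auto
  have r: "rational_fun (\<lambda>t. m t z i)" if "i \<in> I" for i
    using m that Cons.prems(1) by (auto simp: is_move_def)
  have "f (m 0 z) \<noteq> 0" using m Cons.prems by (auto simp: is_move_def)
  moreover have "g (follow ws (m t z)) \<noteq> 0"
    using Cons.prems w by (simp add: follow_def)
  ultimately obtain u where u: "f (m u z) \<noteq> 0" "g (follow ws (m u z)) \<noteq> 0"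
    using rational_fun_common_nonzero[OF rational_fun_poly_fun[OF Cons.prems(3), of "\<lambda>t. m t z"]
      rational_fun_poly_fun[OF h, of "\<lambda>t. m t z"]] r by blast
  have "m u z \<in> V" using m Cons.prems by (auto simp: is_move_def)
  from Cons.IH[OF this _ Cons.prems(3,4) u] Cons.prems(2)
  obtain z' where "reach I V (m u z) z'" "f z' \<noteq> 0" "g z' \<noteq> 0" by auto
  with reach_trans[OF reach_move[OF m]] show ?case by blast
qed

text \<open>Induction over the conditions. Each condition that already holds is pinned to one
  witness in \<open>B\<close>, and all of these are multiplied with \<open>g\<close> into a single
  polynomial, so that \<open>follow_common_nonzero\<close> has one polynomial to keep while it gains
  the next.\<close>

lemma reach_common_nonzero:
  fixes f :: "'a \<Rightarrow> 'b \<Rightarrow> ('i \<Rightarrow> real) \<Rightarrow> real"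
  assumes "finite A" "\<And>a b. a \<in> A \<Longrightarrow> b \<in> B \<Longrightarrow> poly_fun I (f a b)"
    "\<And>a z. a \<in> A \<Longrightarrow> z \<in> V \<Longrightarrow> \<exists>z'. reach I V z z' \<and> (\<exists>b\<in>B. f a b z' \<noteq> 0)"
    "z \<in> V" "poly_fun I g" "g z \<noteq> 0"
  shows "\<exists>z'. reach I V z z' \<and> g z' \<noteq> 0 \<and> (\<forall>a\<in>A. \<exists>b\<in>B. f a b z' \<noteq> 0)"
  using assms(1-3)
proof (induction A)
  case empty
  then show ?case using reach_refl assms(6) by blast
next
  case (insert a A)
  have "\<exists>z'. reach I V z z' \<and> g z' \<noteq> 0 \<and> (\<forall>a\<in>A. \<exists>b\<in>B. f a b z' \<noteq> 0)"
    by (rule insert.IH) (blast intro: insert.prems)+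
  then obtain z1 where z1: "reach I V z z1" "g z1 \<noteq> 0" "\<forall>a\<in>A. \<exists>b\<in>B. f a b z1 \<noteq> 0"
    by blast
  then have "\<forall>a\<in>A. \<exists>b. b \<in> B \<and> f a b z1 \<noteq> 0" by blast
  from bchoice[OF this] obtain c where c: "\<forall>a\<in>A. c a \<in> B \<and> f a (c a) z1 \<noteq> 0" by blast
  have V1: "z1 \<in> V" using z1 assms(4) reach_in by blast
  then obtain ws b where ws: "\<forall>w\<in>set ws. is_move I V (fst w)" "b \<in> B" "f a b (follow ws z1) \<noteq> 0"
    using insert.prems(2)[of a z1] unfolding reach_def by blast
  define G where "G = (\<lambda>z. g z * (\<Prod>a\<in>A. f a (c a) z))"
  have G: "G z \<noteq> 0 \<longleftrightarrow> g z \<noteq> 0 \<and> (\<forall>a\<in>A. f a (c a) z \<noteq> 0)" for z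
    using insert.hyps(1) by (simp add: G_def)
  have g: "poly_fun I G" unfolding G_def
    using insert.prems(1) c by (intro poly_fun_mult poly_fun_prod assms(5)) blast
  have fa: "poly_fun I (f a b)" using insert.prems(1) ws(2) by blast
  have "G z1 \<noteq> 0" using z1(2) c G by blast
  then have "\<exists>z2. reach I V z1 z2 \<and> G z2 \<noteq> 0 \<and> f a b z2 \<noteq> 0"
    by (rule follow_common_nonzero[OF V1 ws(1) g fa _ ws(3)])
  then obtain z2 where z2: "reach I V z1 z2" "G z2 \<noteq> 0" "f a b z2 \<noteq> 0" by blast
  have "\<exists>b\<in>B. f a' b z2 \<noteq> 0" if "a' \<in> insert a A" for a'
    using that z2(2,3) ws(2) c G by (cases "a' = a") blast+
  moreover have "g z2 \<noteq> 0" using z2(2) G by blast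
  ultimately show ?case using reach_trans[OF z1(1) z2(1)] by blast
qed

text \<open>Openness: a choice function for the witnesses turns all conditions into one product, and
  the points that violate some condition are the common zeros of these products, however large
  \<open>B\<close> is. Density: a polynomial vanishing on the set but not at a point of
  \<open>V\<close> could be kept nonzero until all conditions hold.\<close>

lemma generic_set_nonvanishing:
  fixes f :: "'a \<Rightarrow> 'b \<Rightarrow> ('i \<Rightarrow> real) \<Rightarrow> real"
  assumes "finite A" "V \<subseteq> I \<rightarrow>\<^sub>E UNIV" "\<And>a b. a \<in> A \<Longrightarrow> b \<in> B \<Longrightarrow> poly_fun I (f a b)"
    "\<And>a z. a \<in> A \<Longrightarrow> z \<in> V \<Longrightarrow> \<exists>z'. reach I V z z' \<and> (\<exists>b\<in>B. f a b z' \<noteq> 0)"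
  shows "generic_set I V {z \<in> V. \<forall>a\<in>A. \<exists>b\<in>B. f a b z \<noteq> 0}"
proof -
  let ?U = "{z \<in> V. \<forall>a\<in>A. \<exists>b\<in>B. f a b z \<noteq> 0}"
  define P where "P = (\<lambda>c z. \<Prod>a\<in>A. f a (c a) z)"
  define Cs where "Cs = {c. \<forall>a\<in>A. c a \<in> B}"
  let ?C = "{z \<in> I \<rightarrow>\<^sub>E UNIV. \<forall>g\<in>P ` Cs. g z = 0}"
  have P: "P c z \<noteq> 0 \<longleftrightarrow> (\<forall>a\<in>A. f a (c a) z \<noteq> 0)" for c z
    using assms(1) by (simp add: P_def)
  have "\<forall>g\<in>P ` Cs. poly_fun I g"
  proof safe
    fix c assume "c \<in> Cs"
    then have "\<And>a. a \<in> A \<Longrightarrow> poly_fun I (f a (c a))" using assms(3) unfolding Cs_def by blast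
    then show "poly_fun I (P c)" unfolding P_def by (rule poly_fun_prod)
  qed
  then have "zariski_closed I ?C" unfolding zariski_closed_def by blast
  moreover have "?U = V - ?C"
  proof -
    have "(\<forall>a\<in>A. \<exists>b\<in>B. f a b z \<noteq> 0) \<longleftrightarrow> (\<exists>c\<in>Cs. P c z \<noteq> 0)" for z
    proof
      assume "\<forall>a\<in>A. \<exists>b\<in>B. f a b z \<noteq> 0"
      then have "\<forall>a\<in>A. \<exists>b. b \<in> B \<and> f a b z \<noteq> 0" by blast
      from bchoice[OF this] obtain c where "\<forall>a\<in>A. c a \<in> B \<and> f a (c a) z \<noteq> 0" by blast
      then have "c \<in> Cs" "P c z \<noteq> 0" by (simp_all add: P Cs_def)
      then show "\<exists>c\<in>Cs. P c z \<noteq> 0" by blast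
    next
      assume "\<exists>c\<in>Cs. P c z \<noteq> 0"
      then obtain c where "\<forall>a\<in>A. c a \<in> B" "\<forall>a\<in>A. f a (c a) z \<noteq> 0"
        by (auto simp: P Cs_def)
      then show "\<forall>a\<in>A. \<exists>b\<in>B. f a b z \<noteq> 0" by blast
    qed
    then have "?U = {z \<in> V. \<exists>c\<in>Cs. P c z \<noteq> 0}" by simp
    also have "\<dots> = V - ?C" using assms(2) by blast
    finally show ?thesis .
  qed
  moreover have "V \<subseteq> C" if C: "zariski_closed I C" "?U \<subseteq> C" for C
  proof
    fix z assume z: "z \<in> V"
    obtain G where G: "\<forall>g\<in>G. poly_fun I g" "C = {z \<in> I \<rightarrow>\<^sub>E UNIV. \<forall>g\<in>G. g z = 0}"
      using C(1) unfolding zariski_closed_def by blast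
    have "g z = 0" if g: "g \<in> G" for g
    proof (rule ccontr)
      assume "g z \<noteq> 0"
      moreover have "poly_fun I g" using g G(1) by blast
      ultimately have "\<exists>z'. reach I V z z' \<and> g z' \<noteq> 0 \<and> (\<forall>a\<in>A. \<exists>b\<in>B. f a b z' \<noteq> 0)"
        by (intro reach_common_nonzero assms z)
      then obtain z' where z': "reach I V z z'" "g z' \<noteq> 0" "\<forall>a\<in>A. \<exists>b\<in>B. f a b z' \<noteq> 0"
        by blast
      have "z' \<in> ?U" using reach_in[OF z z'(1)] z'(3) by blast
      then show False using z'(2) g G(2) C(2) by blast
    qed
    then show "z \<in> C" using G(2) assms(2) z by blast
  qed
  ultimately show ?thesis unfolding generic_set_def by blast
qed

lemma translation_is_move:
  "is_move I (I \<rightarrow>\<^sub>E UNIV) (\<lambda>t z i. if i \<in> I then z i + t * d i else undefined)"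
proof -
  have "rational_fun (\<lambda>t. a + t * b)" for a b :: real
    using rational_fun_poly[of "[:a, b:]"] by simp
  moreover have "poly_fun I (\<lambda>z. z i + c)" if "i \<in> I" for i c
    by (rule poly_fun_add[OF poly_fun_coord[OF that] poly_fun_const])
  ultimately show ?thesis unfolding is_move_def
    by (simp add: fun_eq_iff PiE_def extensional_def)
qed

text \<open>Any two points of the full space are joined by one translation, so one nonzero value per
  polynomial suffices.\<close>

lemma generic_set_affine_space:
  assumes "finite A" "\<And>a. a \<in> A \<Longrightarrow> poly_fun I (f a)"
    "\<And>a. a \<in> A \<Longrightarrow> \<exists>z\<in>I \<rightarrow>\<^sub>E UNIV. f a z \<noteq> 0"
  shows "generic_set I (I \<rightarrow>\<^sub>E UNIV) {z \<in> I \<rightarrow>\<^sub>E UNIV. \<forall>a\<in>A. f a z \<noteq> 0}"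
proof -
  have reach: "reach I (I \<rightarrow>\<^sub>E UNIV) z z'" if "z \<in> I \<rightarrow>\<^sub>E UNIV" "z' \<in> I \<rightarrow>\<^sub>E UNIV" for z z'
  proof -
    have "z' = (\<lambda>i. if i \<in> I then z i + 1 * (z' i - z i) else undefined)"
      using that by (auto simp: fun_eq_iff PiE_def extensional_def)
    then show ?thesis using reach_move[OF translation_is_move, of I z 1 "\<lambda>i. z' i - z i"] by simp
  qed
  have "generic_set I (I \<rightarrow>\<^sub>E UNIV) {z \<in> I \<rightarrow>\<^sub>E UNIV. \<forall>a\<in>A. \<exists>b\<in>{()}. f a z \<noteq> 0}"
  proof (rule generic_set_nonvanishing[OF assms(1) order.refl, where B = "{()}" and f = "\<lambda>a _. f a"])
    fix a z assume "a \<in> A" "z \<in> I \<rightarrow>\<^sub>E (UNIV :: real set)"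
    with assms(3) reach show "\<exists>z'. reach I (I \<rightarrow>\<^sub>E UNIV) z z' \<and> (\<exists>b\<in>{()}. f a z' \<noteq> 0)"
      by (metis insertI1)
  qed (use assms(2) in simp)
  then show ?thesis by simp
qed

section \<open>Recovering a carriage from its spectral decomposition\<close>

definition orthonormal :: "nat \<Rightarrow> nat \<Rightarrow> (nat \<Rightarrow> real vec) \<Rightarrow> bool" where
  "orthonormal n s y \<longleftrightarrow> (\<forall>p<s. y p \<in> carrier_vec n) \<and>
     (\<forall>p<s. \<forall>q<s. y p \<bullet> y q = (if p = q then 1 else 0))"

text \<open>The invariant carried through a pass: an orthonormal list of eigenvectors is determined
  only up to order and signs.\<close>

definition signed_perm :: "nat \<Rightarrow> (nat \<Rightarrow> real vec) \<Rightarrow> real vec list \<Rightarrow> bool" where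
  "signed_perm s y ys \<longleftrightarrow> length ys = s \<and>
     (\<exists>\<pi> \<sigma>. \<pi> permutes {..<s} \<and> (\<forall>i<s. \<sigma> i \<in> {1, - 1} \<and> ys ! i = \<sigma> i \<cdot>\<^sub>v y (\<pi> i)))"

text \<open>The matrix \<open>Y diag(e) Y^T\<close> with the \<open>y k\<close> as columns of
  \<open>Y\<close>; for orthonormal \<open>y\<close> it is a spectral decomposition.\<close>

definition outer_sum :: "nat \<Rightarrow> nat \<Rightarrow> (nat \<Rightarrow> real) \<Rightarrow> (nat \<Rightarrow> real vec) \<Rightarrow> real mat" where
  "outer_sum n s e y = mat n n (\<lambda>(a, b). \<Sum>k<s. e k * y k $ a * y k $ b)"

lemma scalar_prod_lincomb:
  fixes y :: "real vec"
  assumes "\<And>l. l \<in> A \<Longrightarrow> dim_vec (w l) = n"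
  shows "y \<bullet> vec n (\<lambda>a. \<Sum>l\<in>A. c l * w l $ a) = (\<Sum>l\<in>A. c l * (y \<bullet> w l))"
proof -
  have "y \<bullet> vec n (\<lambda>a. \<Sum>l\<in>A. c l * w l $ a) = (\<Sum>a<n. \<Sum>l\<in>A. y $ a * (c l * w l $ a))"
    by (simp add: scalar_prod_def sum_distrib_left atLeast0LessThan)
  also have "\<dots> = (\<Sum>l\<in>A. \<Sum>a<n. y $ a * (c l * w l $ a))" by (rule sum.swap)
  also have "\<dots> = (\<Sum>l\<in>A. c l * (y \<bullet> w l))"
    by (intro sum.cong refl)
      (simp add: assms scalar_prod_def sum_distrib_left atLeast0LessThan mult.left_commute)
  finally show ?thesis .
qed

lemma outer_sum_mult_vec:
  assumes "v \<in> carrier_vec n" "\<And>k. k < s \<Longrightarrow> y k \<in> carrier_vec n"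
  shows "outer_sum n s e y *\<^sub>v v = vec n (\<lambda>a. \<Sum>k<s. (e k * (y k \<bullet> v)) * y k $ a)"
proof (rule eq_vecI)
  fix a assume "a < dim_vec (vec n (\<lambda>a. \<Sum>k<s. (e k * (y k \<bullet> v)) * y k $ a))"
  then have a: "a < n" by simp
  have "(outer_sum n s e y *\<^sub>v v) $ a = (\<Sum>b<n. (\<Sum>k<s. e k * y k $ a * y k $ b) * v $ b)"
    using a assms(1) by (simp add: outer_sum_def scalar_prod_def atLeast0LessThan)
  also have "\<dots> = (\<Sum>b<n. \<Sum>k<s. e k * y k $ a * y k $ b * v $ b)"
    by (simp add: sum_distrib_right)
  also have "\<dots> = (\<Sum>k<s. \<Sum>b<n. e k * y k $ a * y k $ b * v $ b)" by (rule sum.swap)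
  also have "\<dots> = (\<Sum>k<s. e k * (y k \<bullet> v) * y k $ a)"
    using assms by (intro sum.cong refl)
      (simp add: scalar_prod_def sum_distrib_left sum_distrib_right atLeast0LessThan mult_ac)
  finally show "(outer_sum n s e y *\<^sub>v v) $ a = vec n (\<lambda>a. \<Sum>k<s. (e k * (y k \<bullet> v)) * y k $ a) $ a"
    using a by simp
qed (simp add: outer_sum_def)

lemma orthonormal_delta_sum:
  assumes "orthonormal n s y" "k < s"
  shows "(\<Sum>l<s. c l * (y k \<bullet> y l)) = c k"
proof -
  have "(\<Sum>l<s. c l * (y k \<bullet> y l)) = (\<Sum>l<s. if l = k then c k else 0)"
    using assms by (intro sum.cong refl) (auto simp: orthonormal_def)
  then show ?thesis using assms by simp
qed

text \<open>Pairing the eigenvalue equation with \<open>y k\<close> gives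
  \<open>(e0 - e k) * (y k \<bullet> v) = 0\<close>. As the \<open>e k\<close> are distinct, at most
  one component of \<open>v\<close> survives, and as \<open>e0\<close> is nonzero, \<open>v\<close>
  lies in the span of the \<open>y k\<close>.\<close>

lemma eigenvector_outer_sum:
  assumes y: "orthonormal n s y" and inj: "inj_on e {..<s}" and e0: "e0 \<noteq> 0"
    and ev: "eigenvector (outer_sum n s e y) v e0"
  shows "\<exists>k<s. v = (y k \<bullet> v) \<cdot>\<^sub>v y k"
proof -
  let ?M = "outer_sum n s e y"
  have yc: "y k \<in> carrier_vec n" if "k < s" for k using y that by (simp add: orthonormal_def)
  have v: "v \<in> carrier_vec n" "v \<noteq> 0\<^sub>v n" "?M *\<^sub>v v = e0 \<cdot>\<^sub>v v"
    using ev by (auto simp: eigenvector_def outer_sum_def)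
  have Mv: "?M *\<^sub>v v = vec n (\<lambda>a. \<Sum>k<s. (e k * (y k \<bullet> v)) * y k $ a)"
    by (rule outer_sum_mult_vec[OF v(1) yc])
  have comp: "e0 * (y k \<bullet> v) = e k * (y k \<bullet> v)" if k: "k < s" for k
  proof -
    have "e0 * (y k \<bullet> v) = y k \<bullet> (?M *\<^sub>v v)" using v yc[OF k] by simp
    also have "\<dots> = (\<Sum>l<s. (e l * (y l \<bullet> v)) * (y k \<bullet> y l))"
      unfolding Mv using yc by (intro scalar_prod_lincomb) auto
    also have "\<dots> = e k * (y k \<bullet> v)" by (rule orthonormal_delta_sum[OF y k])
    finally show ?thesis .
  qed
  have va: "e0 * v $ a = (\<Sum>k<s. (e k * (y k \<bullet> v)) * y k $ a)" if "a < n" for a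
  proof -
    have "e0 * v $ a = (?M *\<^sub>v v) $ a" using v(1,3) that by simp
    then show ?thesis unfolding Mv using that by simp
  qed
  have "\<exists>k<s. y k \<bullet> v \<noteq> 0"
  proof (rule ccontr)
    assume "\<not> (\<exists>k<s. y k \<bullet> v \<noteq> 0)"
    then have "v $ a = 0" if "a < n" for a using va[OF that] e0 by simp
    then have "v = 0\<^sub>v n" using v(1) by (intro eq_vecI) auto
    with v(2) show False ..
  qed
  then obtain k where k: "k < s" "y k \<bullet> v \<noteq> 0" by blast
  have ek: "e0 = e k" using comp[OF k(1)] k(2) by simp
  have zero: "y l \<bullet> v = 0" if "l < s" "l \<noteq> k" for l
  proof -
    have "e l \<noteq> e k" using inj that k(1) by (auto dest: inj_onD)
    then show ?thesis using comp[OF that(1)] ek by auto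
  qed
  have "v $ a = (y k \<bullet> v) * y k $ a" if "a < n" for a
  proof -
    have "e0 * v $ a = (\<Sum>l<s. if l = k then e k * (y k \<bullet> v) * y k $ a else 0)"
      unfolding va[OF that] by (intro sum.cong refl) (auto simp: zero)
    then show ?thesis using k ek e0 by simp
  qed
  then have "v = (y k \<bullet> v) \<cdot>\<^sub>v y k" using v(1) yc[OF k(1)] by (intro eq_vecI) auto
  then show ?thesis using k by blast
qed

lemma eigenvector_outer_sum_basis:
  assumes y: "orthonormal n s y" and k: "k < s"
  shows "eigenvector (outer_sum n s e y) (y k) (e k)"
proof -
  have yc: "y k \<in> carrier_vec n" if "k < s" for k using y that by (simp add: orthonormal_def)
  have d: "(e l * (y l \<bullet> y k)) * y l $ a = (if l = k then e k * y k $ a else 0)" if "l < s" for l a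
    using y k that by (simp add: orthonormal_def)
  have "outer_sum n s e y *\<^sub>v y k = vec n (\<lambda>a. \<Sum>l<s. (e l * (y l \<bullet> y k)) * y l $ a)"
    by (rule outer_sum_mult_vec[OF yc[OF k] yc])
  also have "\<dots> = vec n (\<lambda>a. e k * y k $ a)"
    using k by (simp add: d)
  also have "\<dots> = e k \<cdot>\<^sub>v y k" using yc[OF k] by (intro eq_vecI) auto
  finally have "outer_sum n s e y *\<^sub>v y k = e k \<cdot>\<^sub>v y k" .
  moreover have "y k \<noteq> 0\<^sub>v n"
  proof
    assume "y k = 0\<^sub>v n"
    then have "y k \<bullet> y k = 0" by simp
    then show False using y k by (simp add: orthonormal_def)
  qed
  ultimately show ?thesis using yc[OF k] by (simp add: eigenvector_def outer_sum_def)
qed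

text \<open>The existence half: the algorithm is also shown to have a run.\<close>

lemma unit_eigenvectors_outer_sum_basis:
  assumes y: "orthonormal n s y" and inj: "inj_on e {..<s}" and nz: "\<And>k. k < s \<Longrightarrow> e k \<noteq> 0"
  shows "unit_eigenvectors n (outer_sum n s e y) (map y [0..<s])"
  unfolding unit_eigenvectors_def
proof (intro conjI allI ballI impI)
  show "orthonormal_list n (map y [0..<s])"
    using y by (auto simp: orthonormal_list_def orthonormal_def)
  show "\<exists>e'. e' \<noteq> 0 \<and> eigenvector (outer_sum n s e y) v e'" if "v \<in> set (map y [0..<s])" for v
  proof -
    obtain k where "k < s" "v = y k" using \<open>v \<in> set (map y [0..<s])\<close> by auto
    then show ?thesis using eigenvector_outer_sum_basis[OF y] nz by blast
  qed
  show "\<exists>y'\<in>set (map y [0..<s]). y' \<bullet> v \<noteq> 0"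
    if v: "e' \<noteq> 0 \<and> eigenvector (outer_sum n s e y) v e'" for v e'
  proof -
    obtain k where k: "k < s" "v = (y k \<bullet> v) \<cdot>\<^sub>v y k"
      using eigenvector_outer_sum[OF y inj] v by blast
    have "v \<noteq> 0\<^sub>v n" using v by (auto simp: eigenvector_def outer_sum_def)
    moreover have "y k \<in> carrier_vec n" using y k(1) by (simp add: orthonormal_def)
    ultimately have "y k \<bullet> v \<noteq> 0" using k(2) by auto
    then show ?thesis using k(1) by (intro bexI[of _ "y k"]) auto
  qed
qed

text \<open>Each listed vector is a unit multiple of one \<open>y k\<close>, which defines an index
  map \<open>\<kappa>\<close>. Orthogonality of the list makes it injective; the completeness clause
  of \<open>unit_eigenvectors\<close>, applied to \<open>y k\<close>, makes it surjective.\<close>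

lemma unit_eigenvectors_outer_sum:
  assumes y: "orthonormal n s y" and inj: "inj_on e {..<s}" and nz: "\<And>k. k < s \<Longrightarrow> e k \<noteq> 0"
    and ys: "unit_eigenvectors n (outer_sum n s e y) ys"
  shows "signed_perm s y ys"
proof -
  have yc: "y k \<in> carrier_vec n" if "k < s" for k using y that by (simp add: orthonormal_def)
  have on: "orthonormal_list n ys" using ys by (simp add: unit_eigenvectors_def)
  have "\<exists>k \<sigma>. k < s \<and> \<sigma> \<in> {1, -1} \<and> ys ! i = \<sigma> \<cdot>\<^sub>v y k" if i: "i < length ys" for i
  proof -
    obtain e' where "e' \<noteq> 0" "eigenvector (outer_sum n s e y) (ys ! i) e'"
      using ys nth_mem[OF i] unfolding unit_eigenvectors_def by blast
    from eigenvector_outer_sum[OF y inj this] obtain k where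
      k: "k < s" "ys ! i = (y k \<bullet> ys ! i) \<cdot>\<^sub>v y k" by blast
    let ?c = "y k \<bullet> ys ! i"
    have "1 = ys ! i \<bullet> ys ! i" using on i by (simp add: orthonormal_list_def)
    also have "\<dots> = (?c \<cdot>\<^sub>v y k) \<bullet> (?c \<cdot>\<^sub>v y k)" using k(2) by simp
    also have "\<dots> = ?c * (?c * (y k \<bullet> y k))" using yc[OF k(1)] by simp
    also have "\<dots> = ?c\<^sup>2" using y k(1) by (simp add: orthonormal_def power2_eq_square)
    finally have "?c \<in> {1, -1}" by (metis insertCI power2_eq_1_iff)
    then show ?thesis using k by blast
  qed
  then obtain \<kappa> \<sigma> where \<kappa>: "\<And>i. i < length ys \<Longrightarrow> \<kappa> i < s"
    "\<And>i. i < length ys \<Longrightarrow> \<sigma> i \<in> {1, -1 :: real}"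
    "\<And>i. i < length ys \<Longrightarrow> ys ! i = \<sigma> i \<cdot>\<^sub>v y (\<kappa> i)" by metis
  have inner: "ys ! i \<bullet> y k = \<sigma> i * (if \<kappa> i = k then 1 else 0)" if "i < length ys" "k < s" for i k
  proof -
    have "ys ! i \<bullet> y k = \<sigma> i * (y (\<kappa> i) \<bullet> y k)"
      using \<kappa>(3)[OF that(1)] yc[OF \<kappa>(1)[OF that(1)]] yc[OF that(2)] by simp
    then show ?thesis using y \<kappa>(1)[OF that(1)] that(2) by (simp add: orthonormal_def)
  qed
  have "inj_on \<kappa> {..<length ys}"
  proof (rule inj_onI)
    fix i j assume ij: "i \<in> {..<length ys}" "j \<in> {..<length ys}" "\<kappa> i = \<kappa> j"
    have yj: "ys ! j = \<sigma> j \<cdot>\<^sub>v y (\<kappa> i)" using \<kappa>(3)[of j] ij by simp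
    have yi: "ys ! i \<in> carrier_vec n"
      using on ij nth_mem[of i ys] unfolding orthonormal_list_def by blast
    have "ys ! i \<bullet> ys ! j = \<sigma> j * (ys ! i \<bullet> y (\<kappa> i))"
      unfolding yj using yc[OF \<kappa>(1)[of i]] yi ij by simp
    also have "\<dots> = \<sigma> j * \<sigma> i" using inner[of i "\<kappa> i"] \<kappa>(1)[of i] ij by simp
    also have "\<dots> \<noteq> 0" using \<kappa>(2)[of i] \<kappa>(2)[of j] ij by auto
    finally show "i = j" using on ij by (auto simp: orthonormal_list_def split: if_splits)
  qed
  moreover have "\<kappa> ` {..<length ys} = {..<s}"
  proof (intro equalityI subsetI)
    fix k assume "k \<in> {..<s}"
    then have k: "k < s" by simp
    obtain v where v: "v \<in> set ys" "v \<bullet> y k \<noteq> 0"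
      using ys eigenvector_outer_sum_basis[OF y k] nz[OF k] unfolding unit_eigenvectors_def by blast
    then obtain i where i: "i < length ys" "v = ys ! i" by (metis in_set_conv_nth)
    then have "\<kappa> i = k" using inner[OF i(1) k] v by (auto split: if_splits)
    then show "k \<in> \<kappa> ` {..<length ys}" using i by blast
  qed (use \<kappa> in auto)
  ultimately have bij: "bij_betw \<kappa> {..<length ys} {..<s}" by (simp add: bij_betw_def)
  then have len: "length ys = s" using bij_betw_same_card by fastforce
  \<comment> \<open>\<open>permutes\<close> requires the identity outside the index set, where
    nothing is known about \<open>\<kappa>\<close>.\<close>
  define \<pi> where "\<pi> i = (if i < s then \<kappa> i else i)" for i
  have "bij_betw \<kappa> {..<s} {..<s}" using bij len by simp
  then have "bij_betw \<pi> {..<s} {..<s}" by (rule bij_betw_cong[THEN iffD1, rotated]) (simp add: \<pi>_def)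
  then have "\<pi> permutes {..<s}" by (rule bij_imp_permutes) (simp add: \<pi>_def)
  moreover have "\<forall>i<s. \<sigma> i \<in> {1, -1} \<and> ys ! i = \<sigma> i \<cdot>\<^sub>v y (\<pi> i)"
    using \<kappa> len by (simp add: \<pi>_def)
  ultimately show ?thesis unfolding signed_perm_def using len by blast
qed

section \<open>One step of the kernel completion\<close>

text \<open>Supplies a matrix \<open>A\<close> with which a step can be carried out. Induction on
  the number of missing columns, each time adding a unit vector orthogonal to those at hand.\<close>

lemma orthogonal_completion:
  assumes "orthonormal_list n xs" "length xs \<le> n"
  shows "\<exists>A\<in>carrier_mat n n. transpose_mat A * A = 1\<^sub>m n \<and> (\<forall>p<length xs. col A p = xs ! p)"
  using assms
proof (induction "n - length xs" arbitrary: xs)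
  case 0
  then have len: "length xs = n" by simp
  have c: "xs ! p \<in> carrier_vec n" if "p < n" for p
    using 0 len that nth_mem[of p xs] unfolding orthonormal_list_def by blast
  have "transpose_mat (mat_of_cols n xs) * mat_of_cols n xs = 1\<^sub>m n"
    using 0 len c by (intro eq_matI) (auto simp: orthonormal_list_def)
  then show ?case using len c by (intro bexI[of _ "mat_of_cols n xs"]) auto
next
  case (Suc d)
  then have len: "length xs < n" by simp
  have c: "xs ! p \<in> carrier_vec n" if "p < length xs" for p
    using Suc.prems that nth_mem[of p xs] unfolding orthonormal_list_def by blast
  \<comment> \<open>Zero rows make the matrix square and singular; a vector of its kernel is
    orthogonal to all given vectors.\<close>
  define M where "M = mat n n (\<lambda>(i, j). if i < length xs then xs ! i $ j else 0)"
  have M: "M \<in> carrier_mat n n" by (simp add: M_def)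
  have "transpose_mat M *\<^sub>v unit_vec n (length xs) = 0\<^sub>v n"
    by (rule eq_vecI) (use len in \<open>auto simp: M_def\<close>)
  moreover have "unit_vec n (length xs) \<noteq> (0\<^sub>v n :: real vec)"
    using len by (metis index_unit_vec(1) index_zero_vec(1) zero_neq_one)
  ultimately have "det (transpose_mat M) = 0"
    using det_0_iff_vec_prod_zero[of "transpose_mat M" n] M
    by (meson transpose_carrier_mat unit_vec_carrier)
  then have "det M = 0" using det_transpose[OF M] by simp
  then obtain v where v: "v \<in> carrier_vec n" "v \<noteq> 0\<^sub>v n" "M *\<^sub>v v = 0\<^sub>v n"
    using det_0_iff_vec_prod_zero[OF M] by blast
  have orth: "xs ! p \<bullet> v = 0" if p: "p < length xs" for p
  proof -
    have "row M p = xs ! p" using p len c[OF p] by (intro eq_vecI) (auto simp: M_def)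
    then have "(M *\<^sub>v v) $ p = xs ! p \<bullet> v" using p len M by simp
    then show ?thesis using v(3) p len by simp
  qed
  have pos: "v \<bullet> v > 0"
    using v(1,2) conjugate_square_greater_0_vec[OF v(1)] by (simp add: conjugate_vec_def vec_eq_iff)
  define w where "w = (1 / sqrt (v \<bullet> v)) \<cdot>\<^sub>v v"
  have w: "w \<in> carrier_vec n" using v by (simp add: w_def)
  have ww: "w \<bullet> w = 1" using v(1) pos by (simp add: w_def)
  have xw: "xs ! p \<bullet> w = 0" "w \<bullet> xs ! p = 0" if "p < length xs" for p
    using orth[OF that] c[OF that] v(1) comm_scalar_prod[OF c[OF that] v(1)] by (simp_all add: w_def)
  have "orthonormal_list n (xs @ [w])"
    using Suc.prems w ww xw by (auto simp: orthonormal_list_def nth_append less_Suc_eq)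
  moreover have "d = n - length (xs @ [w])" "length (xs @ [w]) \<le> n" using Suc.hyps(2) len by auto
  ultimately obtain A where A: "A \<in> carrier_mat n n" "transpose_mat A * A = 1\<^sub>m n"
    "\<forall>p<length (xs @ [w]). col A p = (xs @ [w]) ! p"
    using Suc.hyps(1) by blast
  have "col A p = xs ! p" if "p < length xs" for p
    using A(3) that by (simp add: nth_append less_SucI)
  then show ?case using A by blast
qed

lemma mult_outer_sum_mult:
  assumes "A \<in> carrier_mat n n" "\<And>k. k < s \<Longrightarrow> y k \<in> carrier_vec n"
  shows "transpose_mat A * outer_sum n s e y * A =
    mat n n (\<lambda>(p, q). \<Sum>k<s. e k * (col A p \<bullet> y k) * (col A q \<bullet> y k))"
proof (rule eq_matI)
  fix p q assume "p < dim_row (mat n n (\<lambda>(p, q). \<Sum>k<s. e k * (col A p \<bullet> y k) * (col A q \<bullet> y k)))"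
    "q < dim_col (mat n n (\<lambda>(p, q). \<Sum>k<s. e k * (col A p \<bullet> y k) * (col A q \<bullet> y k)))"
  then have pq: "p < n" "q < n" by simp_all
  have Q: "outer_sum n s e y \<in> carrier_mat n n" by (simp add: outer_sum_def)
  have cA: "col A p \<in> carrier_vec n" for p using assms(1) by auto
  have "(transpose_mat A * outer_sum n s e y * A) $$ (p, q) =
      (transpose_mat A * (outer_sum n s e y * A)) $$ (p, q)"
    using assms(1) Q by (subst assoc_mult_mat[of _ n n _ n _ n]) auto
  also have "\<dots> = row (transpose_mat A) p \<bullet> col (outer_sum n s e y * A) q"
    using assms(1) Q pq by (intro index_mult_mat(1)) auto
  also have "\<dots> = col A p \<bullet> (outer_sum n s e y *\<^sub>v col A q)"
    unfolding col_mult2[OF Q assms(1) pq(2)] using assms(1) pq by simp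
  also have "\<dots> = col A p \<bullet> vec n (\<lambda>a. \<Sum>k<s. (e k * (y k \<bullet> col A q)) * y k $ a)"
    by (subst outer_sum_mult_vec[OF cA assms(2)]) auto
  also have "\<dots> = (\<Sum>k<s. (e k * (y k \<bullet> col A q)) * (col A p \<bullet> y k))"
    using assms(2) by (intro scalar_prod_lincomb) auto
  also have "\<dots> = (\<Sum>k<s. e k * (col A p \<bullet> y k) * (col A q \<bullet> y k))"
    using assms(2) cA by (intro sum.cong refl) (simp add: comm_scalar_prod[of _ n "col A q"])
  finally show "(transpose_mat A * outer_sum n s e y * A) $$ (p, q) =
      mat n n (\<lambda>(p, q). \<Sum>k<s. e k * (col A p \<bullet> y k) * (col A q \<bullet> y k)) $$ (p, q)"
    using pq by simp
qed (use assms in auto)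

section \<open>Gaussian elimination with one row of variables\<close>

text \<open>
  In the state before row \<open>m\<close> is used as a pivot row, \<open>\<rho>\<close> is the result of the elimination applied to
  \<open>W\<close> itself, and \<open>Z\<close> is the set of pivot columns found so far: a combination of the first \<open>m\<close> rows
  that vanishes on \<open>Z\<close> vanishes altogether, and the remaining rows have been made to vanish on \<open>Z\<close>.
\<close>

definition elim_invariant ::
    "nat \<Rightarrow> nat \<Rightarrow> (nat \<Rightarrow> nat \<Rightarrow> real) \<Rightarrow> nat \<Rightarrow> affine mat \<Rightarrow> (nat \<Rightarrow> nat \<Rightarrow> real) \<Rightarrow> nat set \<Rightarrow> bool" where
  "elim_invariant n k W m R \<rho> Z \<longleftrightarrow>
    (\<forall>p<k. \<forall>q<n. R $$ (p, q) = (\<lambda>t. if t = None then \<rho> p q else 0)) \<and>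
    (\<forall>q<n. R $$ (k, q) = (\<lambda>t. if t = None then \<rho> k q - (if k \<le> q then W k q else 0)
                                else if t = Some q \<and> k \<le> q then 1 else 0)) \<and>
    (\<forall>p q t. k < p \<and> p < n \<and> q < n \<longrightarrow> (R $$ (p, q)) (Some t) = 0) \<and>
    (\<forall>p. m \<le> p \<and> p \<le> k \<longrightarrow> (\<exists>u. \<forall>q<n. \<rho> p q = W p q - (\<Sum>i<m. u i * W i q))) \<and>
    (\<forall>u. (\<forall>q\<in>Z. (\<Sum>i<m. u i * W i q) = 0) \<longrightarrow> (\<forall>q<n. (\<Sum>i<m. u i * W i q) = 0)) \<and>
    (\<forall>p q. m \<le> p \<and> p \<le> k \<and> q \<in> Z \<longrightarrow> \<rho> p q = 0) \<and> Z \<subseteq> {..<n}"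

lemma elim_invariantD:
  assumes "elim_invariant n k W m R \<rho> Z"
  shows "p < k \<Longrightarrow> q < n \<Longrightarrow> R $$ (p, q) = (\<lambda>t. if t = None then \<rho> p q else 0)"
    and "q < n \<Longrightarrow> R $$ (k, q) = (\<lambda>t. if t = None then \<rho> k q - (if k \<le> q then W k q else 0)
                                else if t = Some q \<and> k \<le> q then 1 else 0)"
    and "k < p \<Longrightarrow> p < n \<Longrightarrow> q < n \<Longrightarrow> (R $$ (p, q)) (Some t) = 0"
    and "m \<le> p \<Longrightarrow> p \<le> k \<Longrightarrow> \<exists>u. \<forall>q<n. \<rho> p q = W p q - (\<Sum>i<m. u i * W i q)"
    and "(\<forall>q\<in>Z. (\<Sum>i<m. u i * W i q) = 0) \<Longrightarrow> q < n \<Longrightarrow> (\<Sum>i<m. u i * W i q) = 0"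
    and "m \<le> p \<Longrightarrow> p \<le> k \<Longrightarrow> q \<in> Z \<Longrightarrow> \<rho> p q = 0"
    and "Z \<subseteq> {..<n}"
  using assms unfolding elim_invariant_def by simp_all

lemma elim_invariantI:
  assumes "\<And>p q. p < k \<Longrightarrow> q < n \<Longrightarrow> R $$ (p, q) = (\<lambda>t. if t = None then \<rho> p q else 0)"
    and "\<And>q. q < n \<Longrightarrow> R $$ (k, q) = (\<lambda>t. if t = None then \<rho> k q - (if k \<le> q then W k q else 0)
                                else if t = Some q \<and> k \<le> q then 1 else 0)"
    and "\<And>p q t. k < p \<Longrightarrow> p < n \<Longrightarrow> q < n \<Longrightarrow> (R $$ (p, q)) (Some t) = 0"
    and "\<And>p. m \<le> p \<Longrightarrow> p \<le> k \<Longrightarrow> \<exists>u. \<forall>q<n. \<rho> p q = W p q - (\<Sum>i<m. u i * W i q)"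
    and "\<And>u q. (\<forall>q\<in>Z. (\<Sum>i<m. u i * W i q) = 0) \<Longrightarrow> q < n \<Longrightarrow> (\<Sum>i<m. u i * W i q) = 0"
    and "\<And>p q. m \<le> p \<Longrightarrow> p \<le> k \<Longrightarrow> q \<in> Z \<Longrightarrow> \<rho> p q = 0"
    and "Z \<subseteq> {..<n}"
  shows "elim_invariant n k W m R \<rho> Z"
  unfolding elim_invariant_def
proof (intro conjI allI impI)
  show "\<exists>u. \<forall>q<n. \<rho> p q = W p q - (\<Sum>i<m. u i * W i q)" if "m \<le> p \<and> p \<le> k" for p
    using assms(4) that by blast
  show "(\<Sum>i<m. u i * W i q) = 0" if "\<forall>q\<in>Z. (\<Sum>i<m. u i * W i q) = 0" "q < n" for u q
    using assms(5) that by blast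
qed (use assms(1,2,3,6,7) in simp_all)

text \<open>By \<open>H\<close>, a combination of the rows of \<open>W\<close> that vanishes in the
  first \<open>r\<close> columns vanishes altogether. So every pivot lies in these columns, to the
  left of the variables, and the factors used in the elimination are constants. Row \<open>k\<close>
  therefore keeps its variables with coefficient 1 and changes by constants only.\<close>

lemma gauss_elim_invariant:
  fixes S :: "real mat" and W :: "nat \<Rightarrow> nat \<Rightarrow> real"
  assumes rk: "r \<le> k" "k < n"
    and S: "\<And>p q. p < k \<Longrightarrow> q < n \<Longrightarrow> S $$ (p, q) = W p q"
      "\<And>q. q < k \<Longrightarrow> S $$ (k, q) = W k q"
    and H: "\<And>u q. (\<And>q. q < r \<Longrightarrow> (\<Sum>i\<le>k. u i * W i q) = 0) \<Longrightarrow> q < n \<Longrightarrow>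
      (\<Sum>i\<le>k. u i * W i q) = 0"
    and m: "m \<le> k"
  shows "\<exists>\<rho> Z. elim_invariant n k W m (fold (eliminate n) [0..<m] (with_variables n k S)) \<rho> Z"
  using m
proof (induction m)
  case 0
  have "elim_invariant n k W 0 (with_variables n k S) W {}"
  proof (rule elim_invariantI)
    show "with_variables n k S $$ (p, q) = (\<lambda>t. if t = None then W p q else 0)"
      if "p < k" "q < n" for p q
      using that rk S by (auto simp: with_variables_def fun_eq_iff)
    show "with_variables n k S $$ (k, q) =
      (\<lambda>t. if t = None then W k q - (if k \<le> q then W k q else 0)
           else if t = Some q \<and> k \<le> q then 1 else 0)" if "q < n" for q
      using that rk S by (auto simp: with_variables_def fun_eq_iff)
  qed (simp_all add: with_variables_def)
  then show ?case by auto
next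
  case (Suc m)
  then have mk: "m < k" by simp
  define R where "R = fold (eliminate n) [0..<m] (with_variables n k S)"
  have fold_Suc: "fold (eliminate n) [0..<Suc m] (with_variables n k S) = eliminate n m R"
    by (simp add: R_def)
  from Suc obtain \<rho> Z where inv: "elim_invariant n k W m R \<rho> Z" unfolding R_def by auto
  note Rp = elim_invariantD(1)[OF inv] and Rk = elim_invariantD(2)[OF inv]
    and Rl = elim_invariantD(3)[OF inv] and span = elim_invariantD(4)[OF inv]
    and det = elim_invariantD(5)[OF inv] and van = elim_invariantD(6)[OF inv]
    and Z = elim_invariantD(7)[OF inv]
  obtain w where w: "\<And>q. q < n \<Longrightarrow> \<rho> m q = W m q - (\<Sum>i<m. w i * W i q)"
    using span[of m] mk by auto
  show ?case
  proof (cases "\<forall>q<n. \<rho> m q = 0")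
    \<comment> \<open>Row \<open>m\<close> depends on the rows above it: it provides no pivot, and
      the set of pivot columns stays the same.\<close>
    case True
    have "eliminate n m R = R" using True Rp[OF mk] by (simp add: eliminate_def)
    moreover have e4: "\<exists>u. \<forall>q<n. \<rho> p q = W p q - (\<Sum>i<Suc m. u i * W i q)"
      if p: "Suc m \<le> p" "p \<le> k" for p
    proof -
      obtain u where "\<forall>q<n. \<rho> p q = W p q - (\<Sum>i<m. u i * W i q)" using span[of p] p by auto
      then show ?thesis by (intro exI[of _ "u(m := 0)"]) simp
    qed
    moreover have e5: "(\<Sum>i<Suc m. u i * W i q) = 0"
      if "\<forall>q\<in>Z. (\<Sum>i<Suc m. u i * W i q) = 0" "q < n" for u q
    proof -
      have eq: "(\<Sum>i<Suc m. u i * W i q) = (\<Sum>i<m. (u i + u m * w i) * W i q)" if "q < n" for q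
      proof -
        have "W m q = (\<Sum>i<m. w i * W i q)" using True w that by simp
        then show ?thesis by (simp add: algebra_simps sum.distrib sum_distrib_left)
      qed
      then have "\<forall>q\<in>Z. (\<Sum>i<m. (u i + u m * w i) * W i q) = 0" using that(1) Z
        by (auto simp del: sum.lessThan_Suc simp flip: eq)
      from det[OF this that(2)] show ?thesis using eq[OF that(2)] by simp
    qed
    moreover have "elim_invariant n k W (Suc m) R \<rho> Z"
      by (rule elim_invariantI[OF Rp Rk Rl e4 e5 _ Z]) (use van in auto)
    ultimately show ?thesis unfolding fold_Suc by auto
  next
    case False
    define c where "c = (LEAST q. (R $$ (m, q)) None \<noteq> 0)"
    have "\<exists>q<r. \<rho> m q \<noteq> 0"
    proof (rule ccontr)
      assume "\<not> (\<exists>q<r. \<rho> m q \<noteq> 0)"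
      then have z: "\<rho> m q = 0" if "q < r" for q using that by blast
      \<comment> \<open>The reduced row \<open>m\<close> written as a combination of original rows.
        If it vanished in the first \<open>r\<close> columns, \<open>H\<close> would make it zero
        everywhere, against the case assumption.\<close>
      define u where "u i = (if i < m then - w i else if i = m then 1 else 0)" for i
      have "(\<Sum>i\<le>k. u i * W i q) = (\<Sum>i<Suc m. u i * W i q)" for q
        using mk by (intro sum.mono_neutral_right) (auto simp: u_def)
      also have "(\<Sum>i<Suc m. u i * W i q) = W m q - (\<Sum>i<m. w i * W i q)" for q
        by (simp add: u_def sum_negf)
      finally have comb: "(\<Sum>i\<le>k. u i * W i q) = \<rho> m q" if "q < n" for q using w[OF that] by simp
      have "(\<Sum>i\<le>k. u i * W i q) = 0" if "q < n" for q
        using H[of u q] comb z that rk by simp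
      then show False using False comb by simp
    qed
    then obtain q where q: "q < r" "\<rho> m q \<noteq> 0" by blast
    then have q': "(R $$ (m, q)) None \<noteq> 0" using Rp[OF mk, of q] rk by simp
    \<comment> \<open>The pivot column is the leftmost nonzero one, hence below \<open>r\<close> and
      left of column \<open>k\<close>, where the variables begin.\<close>
    then have "c \<le> q" unfolding c_def by (rule Least_le)
    then have cr: "c < r" "c < k" "c < n" using q rk by auto
    have "(R $$ (m, c)) None \<noteq> 0" unfolding c_def using q' by (rule LeastI)
    then have c: "\<rho> m c \<noteq> 0" using Rp[OF mk cr(3)] by simp
    define \<rho>' where "\<rho>' p q = (if p \<le> m then \<rho> p q else \<rho> p q - \<rho> p c / \<rho> m c * \<rho> m q)" for p q
    have "q < n" using q rk by simp
    then have nz: "\<not> (\<forall>q<n. (R $$ (m, q)) None = 0)" using q' by blast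
    have el: "eliminate n m R = mat n n (\<lambda>(p', q). if p' \<le> m then R $$ (p', q)
        else (\<lambda>t. (R $$ (p', q)) t - (R $$ (p', c)) t / \<rho> m c * \<rho> m q))"
      unfolding eliminate_def if_not_P[OF nz] c_def[symmetric] Let_def
      using Rp[OF mk] cr by (intro cong_mat) auto
    have e1: "eliminate n m R $$ (p, q) = (\<lambda>t. if t = None then \<rho>' p q else 0)"
      if "p < k" "q < n" for p q
      unfolding el using that rk Rp[OF that] Rp[OF that(1) cr(3)] by (auto simp: \<rho>'_def fun_eq_iff)
    have e2: "eliminate n m R $$ (k, q) =
        (\<lambda>t. if t = None then \<rho>' k q - (if k \<le> q then W k q else 0)
             else if t = Some q \<and> k \<le> q then 1 else 0)" if "q < n" for q
      unfolding el using that rk mk cr Rk[OF that] Rk[OF cr(3)] by (auto simp: \<rho>'_def fun_eq_iff)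
    have e3: "(eliminate n m R $$ (p, q)) (Some t) = 0" if "k < p" "p < n" "q < n" for p q t
      unfolding el using that mk Rl[OF that] Rl[OF that(1,2) cr(3)] by simp
    have e4: "\<exists>u. \<forall>q<n. \<rho>' p q = W p q - (\<Sum>i<Suc m. u i * W i q)"
      if p: "Suc m \<le> p" "p \<le> k" for p
    proof -
      obtain u where u: "\<forall>q<n. \<rho> p q = W p q - (\<Sum>i<m. u i * W i q)" using span[of p] p by auto
      define g where "g = \<rho> p c / \<rho> m c"
      have "\<rho>' p q = W p q - (\<Sum>i<Suc m. (if i < m then u i - g * w i else g) * W i q)" if "q < n" for q
      proof -
        have "\<rho>' p q = \<rho> p q - g * \<rho> m q" using \<open>Suc m \<le> p\<close> by (simp add: \<rho>'_def g_def)
        then show ?thesis using u w that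
          by (simp add: algebra_simps sum_subtractf sum_distrib_left)
      qed
      then show ?thesis by (intro exI[of _ "\<lambda>i. if i < m then u i - g * w i else g"]) blast
    qed
    have e5: "(\<Sum>i<Suc m. u i * W i q) = 0"
      if u: "\<forall>q\<in>insert c Z. (\<Sum>i<Suc m. u i * W i q) = 0" and "q < n" for u q
    proof -
      have eq: "(\<Sum>i<Suc m. u i * W i q) = (\<Sum>i<m. (u i + u m * w i) * W i q) + u m * \<rho> m q"
        if "q < n" for q
      proof -
        have "W m q = \<rho> m q + (\<Sum>i<m. w i * W i q)" using w[OF that] by simp
        then show ?thesis by (simp add: algebra_simps sum.distrib sum_distrib_left)
      qed
      \<comment> \<open>On the old pivot columns the reduced row \<open>m\<close> is zero, so the
        part along the earlier rows vanishes there and hence everywhere; the new pivot column then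
        forces \<open>u m = 0\<close>.\<close>
      have "\<forall>q\<in>Z. (\<Sum>i<m. (u i + u m * w i) * W i q) = 0"
      proof
        fix q assume q: "q \<in> Z"
        then have "q < n" using Z by auto
        from eq[OF this] show "(\<Sum>i<m. (u i + u m * w i) * W i q) = 0"
          using u van[of m q] mk q by (simp del: sum.lessThan_Suc)
      qed
      from det[OF this] have z: "(\<Sum>i<m. (u i + u m * w i) * W i q) = 0" if "q < n" for q
        using that .
      have "u m * \<rho> m c = 0" using eq[OF cr(3)] u z[OF cr(3)] by (simp del: sum.lessThan_Suc)
      then show ?thesis using z[OF \<open>q < n\<close>] eq[OF \<open>q < n\<close>] c by (simp del: sum.lessThan_Suc)
    qed
    have e6: "\<rho>' p q = 0" if "Suc m \<le> p" "p \<le> k" "q \<in> insert c Z" for p q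
      using that c van[of p q] van[of m q] mk by (auto simp: \<rho>'_def)
    have "elim_invariant n k W (Suc m) (eliminate n m R) \<rho>' (insert c Z)"
      by (rule elim_invariantI[OF e1 e2 e3 e4 e5 e6]) (use Z cr in auto)
    then show ?thesis unfolding fold_Suc by blast
  qed
qed

text \<open>By \<open>dep\<close>, the constants accompanying row \<open>k\<close> after the
  elimination, with the true entries put in for the variables, form a combination of the rows above.
  It vanishes on the pivot columns, hence it is zero, and the entry left in column \<open>q\<close>
  is \<open>x q - W k q\<close>. So the equations have exactly the intended solution.\<close>

lemma complete_row_unique:
  fixes S :: "real mat" and W :: "nat \<Rightarrow> nat \<Rightarrow> real"
  assumes rk: "r \<le> k" "k < n"
    and S: "\<And>p q. p < k \<Longrightarrow> q < n \<Longrightarrow> S $$ (p, q) = W p q"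
      "\<And>q. q < k \<Longrightarrow> S $$ (k, q) = W k q"
    and H: "\<And>u q. (\<And>q. q < r \<Longrightarrow> (\<Sum>i\<le>k. u i * W i q) = 0) \<Longrightarrow> q < n \<Longrightarrow>
      (\<Sum>i\<le>k. u i * W i q) = 0"
    and dep: "\<And>q. q < n \<Longrightarrow> W k q = (\<Sum>i<k. v i * W i q)"
  shows "complete_row n k S S' \<longleftrightarrow> S' = mat n n (\<lambda>(p, q). if p = k \<and> k \<le> q then W k q
      else if q = k \<and> k \<le> p then W k p else S $$ (p, q))"
proof -
  define R where "R = gauss_elim n k (with_variables n k S)"
  from gauss_elim_invariant[OF rk S H order.refl] obtain \<rho> Z where
    inv: "elim_invariant n k W k R \<rho> Z"
    unfolding R_def gauss_elim_def by blast
  note Rp = elim_invariantD(1)[OF inv] and Rk = elim_invariantD(2)[OF inv]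
    and Rl = elim_invariantD(3)[OF inv] and span = elim_invariantD(4)[OF inv]
    and det = elim_invariantD(5)[OF inv] and van = elim_invariantD(6)[OF inv]
    and Z = elim_invariantD(7)[OF inv]
  obtain u where u: "\<And>q. q < n \<Longrightarrow> \<rho> k q = W k q - (\<Sum>i<k. u i * W i q)" using span[of k] by auto
  have \<rho>: "\<rho> k q = (\<Sum>i<k. (v i - u i) * W i q)" if "q < n" for q
    using u[OF that] dep[OF that] by (simp add: algebra_simps sum_subtractf)
  have "\<forall>q\<in>Z. (\<Sum>i<k. (v i - u i) * W i q) = 0"
    using van[of k] Z by (auto simp flip: \<rho>)
  from det[OF this] have zero: "\<rho> k q = 0" if "q < n" for q using \<rho>[OF that] that by simp
  have var: "has_variable (R $$ (p, q)) \<longleftrightarrow> p = k \<and> k \<le> q" if "p < n" "q < n" for p q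
    using Rp[of p q] Rk[of q] Rl[of p q] that
    by (cases p k rule: linorder_cases) (auto simp: has_variable_def)
  have val: "affine_value n (R $$ (k, q)) x = x q - W k q" if "k \<le> q" "q < n" for q x
  proof -
    have "(\<Sum>m<n. (R $$ (k, q)) (Some m) * x m) = (\<Sum>m<n. if m = q then x q else 0)"
      using that by (intro sum.cong refl) (simp add: Rk)
    then show ?thesis using that zero by (simp add: affine_value_def Rk)
  qed
  have "(\<forall>p<n. \<forall>q<n. has_variable (R $$ (p, q)) \<longrightarrow> affine_value n (R $$ (p, q)) x = 0) \<longleftrightarrow>
      (\<forall>q. k \<le> q \<and> q < n \<longrightarrow> x q = W k q)" for x
  proof (intro iffI allI impI)
    fix q assume *: "\<forall>p<n. \<forall>q<n. has_variable (R $$ (p, q)) \<longrightarrow> affine_value n (R $$ (p, q)) x = 0"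
      and q: "k \<le> q \<and> q < n"
    have "has_variable (R $$ (k, q))" using var[of k q] rk q by simp
    then have "affine_value n (R $$ (k, q)) x = 0" using * rk q by blast
    then show "x q = W k q" using val[of q x] q by simp
  next
    fix p q assume *: "\<forall>q. k \<le> q \<and> q < n \<longrightarrow> x q = W k q" and "p < n" "q < n"
      and "has_variable (R $$ (p, q))"
    then have "p = k" "k \<le> q" using var by blast+
    then show "affine_value n (R $$ (p, q)) x = 0" using val[of q x] * \<open>q < n\<close> by simp
  qed
  then have *: "complete_row n k S S' \<longleftrightarrow> (\<exists>x. (\<forall>q. k \<le> q \<and> q < n \<longrightarrow> x q = W k q) \<and>
      S' = mat n n (\<lambda>(p, q). if p = k \<and> k \<le> q then x q else if q = k \<and> k \<le> p then x p else S $$ (p, q)))"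
    unfolding complete_row_def R_def Let_def by presburger
  have "mat n n (\<lambda>(p, q). if p = k \<and> k \<le> q then x q else if q = k \<and> k \<le> p then x p else S $$ (p, q)) =
      mat n n (\<lambda>(p, q). if p = k \<and> k \<le> q then W k q else if q = k \<and> k \<le> p then W k p else S $$ (p, q))"
    if "\<forall>q. k \<le> q \<and> q < n \<longrightarrow> x q = W k q" for x
    using that by (intro cong_mat) auto
  note eq = this
  show ?thesis unfolding *
  proof
    assume "S' = mat n n (\<lambda>(p, q). if p = k \<and> k \<le> q then W k q
      else if q = k \<and> k \<le> p then W k p else S $$ (p, q))"
    then show "\<exists>x. (\<forall>q. k \<le> q \<and> q < n \<longrightarrow> x q = W k q) \<and>
      S' = mat n n (\<lambda>(p, q). if p = k \<and> k \<le> q then x q else if q = k \<and> k \<le> p then x p else S $$ (p, q))"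
      by (intro exI[of _ "W k"]) simp
  qed (use eq in blast)
qed

section \<open>Completing all rows in turn\<close>

definition partially_completed :: "nat \<Rightarrow> (nat \<Rightarrow> nat \<Rightarrow> real) \<Rightarrow> real mat \<Rightarrow> nat \<Rightarrow> real mat" where
  "partially_completed n W S k =
     mat n n (\<lambda>(p, q). if p < k \<or> q < k then W p q else S $$ (p, q))"

text \<open>Filling row \<open>k\<close> also fills column \<open>k\<close>, by symmetry of
  \<open>W\<close>, so the next row is known up to its diagonal entry when its turn comes. The
  equivalence gives existence and uniqueness of the completion at once.\<close>

lemma completed_unique:
  fixes S :: "real mat" and W :: "nat \<Rightarrow> nat \<Rightarrow> real"
  assumes rn: "r \<le> n"
    and sym: "\<And>p q. W p q = W q p"
    and H: "\<And>k u q. k < n \<Longrightarrow> (\<And>q. q < r \<Longrightarrow> (\<Sum>i\<le>k. u i * W i q) = 0) \<Longrightarrow> q < n \<Longrightarrow>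
      (\<Sum>i\<le>k. u i * W i q) = 0"
    and dep: "\<And>k. r \<le> k \<Longrightarrow> k < n \<Longrightarrow> \<exists>v. \<forall>q<n. W k q = (\<Sum>i<k. v i * W i q)"
  shows "completed n r (partially_completed n W S r) S' \<longleftrightarrow> S' = mat n n (\<lambda>(p, q). W p q)"
proof -
  let ?P = "partially_completed n W S"
  have row: "complete_row n k (?P k) Q \<longleftrightarrow> Q = ?P (Suc k)" if k: "r \<le> k" "k < n" for k Q
  proof -
    obtain v where v: "\<And>q. q < n \<Longrightarrow> W k q = (\<Sum>i<k. v i * W i q)" using dep[OF k] by blast
    have "complete_row n k (?P k) Q \<longleftrightarrow> Q = mat n n (\<lambda>(p, q). if p = k \<and> k \<le> q then W k q
      else if q = k \<and> k \<le> p then W k p else ?P k $$ (p, q))"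
      by (rule complete_row_unique[OF k _ _ H v]) (use k in \<open>auto simp: partially_completed_def\<close>)
    also have "mat n n (\<lambda>(p, q). if p = k \<and> k \<le> q then W k q
      else if q = k \<and> k \<le> p then W k p else ?P k $$ (p, q)) = ?P (Suc k)"
      unfolding partially_completed_def
    proof (intro cong_mat refl, clarify)
      fix p q assume "p < n" "q < n"
      then show "(if p = k \<and> k \<le> q then W k q else if q = k \<and> k \<le> p then W k p
          else mat n n (\<lambda>(p, q). if p < k \<or> q < k then W p q else S $$ (p, q)) $$ (p, q)) =
        (if p < Suc k \<or> q < Suc k then W p q else S $$ (p, q))"
        using sym[of k p] by (cases "p = k"; cases "q = k") (simp_all add: less_Suc_eq)
    qed
    finally show ?thesis .
  qed
  have last: "?P n = mat n n (\<lambda>(p, q). W p q)"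
    unfolding partially_completed_def by (intro cong_mat) auto
  show ?thesis
  proof
    assume "completed n r (?P r) S'"
    then obtain Q where Q: "Q r = ?P r" "Q n = S'"
      "\<And>k. k \<in> {r..<n} \<Longrightarrow> complete_row n k (Q k) (Q (Suc k))"
      unfolding completed_def by blast
    have "r \<le> k \<Longrightarrow> k \<le> n \<Longrightarrow> Q k = ?P k" for k
    proof (induction k rule: dec_induct)
      case (step k)
      then have "complete_row n k (?P k) (Q (Suc k))" using Q(3)[of k] by simp
      then show ?case using row step by simp
    qed (use Q in simp)
    then show "S' = mat n n (\<lambda>(p, q). W p q)" using Q(2) rn last by simp
  next
    assume "S' = mat n n (\<lambda>(p, q). W p q)"
    then show "completed n r (?P r) S'"
      unfolding completed_def using row last by (intro exI[of _ ?P]) simp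
  qed
qed

section \<open>Symmetry determines the scaling of the rows\<close>

lemma scaling_matrix_kernel:
  assumes "l \<in> carrier_vec r"
  shows "l \<in> mat_kernel (scaling_matrix r B) \<longleftrightarrow>
    (\<forall>p<r. \<forall>q<p. B $$ (p, q) * l $ p = B $$ (q, p) * l $ q)"
proof -
  define f where
    "f = (\<lambda>p q. vec r (\<lambda>m. if m = p then B $$ (p, q) else if m = q then - B $$ (q, p) else 0))"
  let ?rows = "concat (map (\<lambda>p. map (f p) [0..<p]) [0..<r])"
  have M: "scaling_matrix r B = mat_of_rows r ?rows" by (simp add: scaling_matrix_def f_def)
  have rows: "v \<in> set ?rows \<longleftrightarrow> (\<exists>p<r. \<exists>q<p. v = f p q)" for v
    by (simp add: image_iff atLeast0LessThan Bex_def) blast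
  have fl: "f p q \<bullet> l = B $$ (p, q) * l $ p - B $$ (q, p) * l $ q" if "p < r" "q < p" for p q
  proof -
    have "f p q \<bullet> l = (\<Sum>m<r. (if m = p then B $$ (p, q) * l $ p else 0) -
        (if m = q then B $$ (q, p) * l $ q else 0))"
      using assms that unfolding scalar_prod_def atLeast0LessThan f_def
      by (intro sum.cong) auto
    then show ?thesis using that by (simp add: sum_subtractf)
  qed
  have dims: "dim_row (mat_of_rows r ?rows) = length ?rows" "dim_col (mat_of_rows r ?rows) = r"
    by simp_all
  have "l \<in> mat_kernel (scaling_matrix r B) \<longleftrightarrow> mat_of_rows r ?rows *\<^sub>v l = 0\<^sub>v (length ?rows)"
    using assms dims unfolding M mat_kernel_def by simp
  also have "\<dots> \<longleftrightarrow> (\<forall>i<length ?rows. row (mat_of_rows r ?rows) i \<bullet> l = 0)"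
    unfolding vec_eq_iff using dims(1) by (simp del: length_concat)
  also have "\<dots> \<longleftrightarrow> (\<forall>i<length ?rows. ?rows ! i \<bullet> l = 0)"
  proof -
    have "row (mat_of_rows r ?rows) i = ?rows ! i" if "i < length ?rows" for i
    proof (rule mat_of_rows_row[OF that])
      have "?rows ! i \<in> set ?rows" using that by (rule nth_mem)
      then show "?rows ! i \<in> carrier_vec r" unfolding rows by (auto simp: f_def)
    qed
    then show ?thesis by (simp del: length_concat)
  qed
  also have "\<dots> \<longleftrightarrow> (\<forall>v\<in>set ?rows. v \<bullet> l = 0)" by (rule all_set_conv_all_nth[symmetric])
  also have "\<dots> \<longleftrightarrow> (\<forall>p<r. \<forall>q<p. f p q \<bullet> l = 0)" unfolding Ball_def rows by blast
  also have "\<dots> \<longleftrightarrow> (\<forall>p<r. \<forall>q<p. B $$ (p, q) * l $ p = B $$ (q, p) * l $ q)"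
    using fl by simp
  finally show ?thesis .
qed

text \<open>Since \<open>W\<close> is symmetric, the kernel equation for the pair \<open>p\<close>,
  \<open>q\<close> is \<open>W p q * (\<alpha> p * l p - \<alpha> q * l q) = 0\<close>. With nonzero
  off-diagonal entries this says that \<open>\<alpha> p * l p\<close> does not depend on
  \<open>p\<close>; its value is the common factor \<open>c\<close>.\<close>

lemma rescaled_rows:
  assumes r: "1 \<le> r" "r \<le> n" and S: "S \<in> carrier_mat n n"
    and Sv: "\<And>p q. p < r \<Longrightarrow> q < n \<Longrightarrow> S $$ (p, q) = \<alpha> p * W p q"
    and sym: "\<And>p q. W p q = W q p"
    and nz: "\<And>p q. p < r \<Longrightarrow> q < r \<Longrightarrow> p \<noteq> q \<Longrightarrow> W p q \<noteq> 0"
    and \<alpha>: "\<And>p. p < r \<Longrightarrow> \<alpha> p \<noteq> 0"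
  shows "\<exists>S'. rescaled n r S S'"
    and "rescaled n r S S' \<Longrightarrow> S' \<in> carrier_mat n n \<and>
      (\<exists>c. c \<noteq> 0 \<and> (\<forall>p<r. \<forall>q<n. S' $$ (p, q) = c * W p q))"
proof -
  let ?B = "mat r r (\<lambda>(p, q). S $$ (p, q))"
  have ker: "l \<in> mat_kernel (scaling_matrix r ?B) \<longleftrightarrow>
      (\<forall>p<r. \<forall>q<p. \<alpha> p * l $ p = \<alpha> q * l $ q)" if "l \<in> carrier_vec r" for l
  proof -
    have "?B $$ (p, q) * l $ p = ?B $$ (q, p) * l $ q \<longleftrightarrow> \<alpha> p * l $ p = \<alpha> q * l $ q"
      if "p < r" "q < p" for p q
    proof -
      have "?B $$ (p, q) * l $ p = W p q * (\<alpha> p * l $ p)" "?B $$ (q, p) * l $ q = W p q * (\<alpha> q * l $ q)"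
        using that Sv[of p q] Sv[of q p] r sym[of q p] by (simp_all add: mult_ac)
      then show ?thesis using nz[of p q] that by (simp only: mult_cancel_left) auto
    qed
    then show ?thesis unfolding scaling_matrix_kernel[OF that] by simp
  qed
  show "\<exists>S'. rescaled n r S S'"
  proof (cases "r > 1")
    case True
    \<comment> \<open>The choice for which all products \<open>\<alpha> p * l p\<close> are
      1.\<close>
    define l where "l = vec r (\<lambda>p. 1 / \<alpha> p)"
    have "l \<in> mat_kernel (scaling_matrix r ?B)"
      by (subst ker) (use \<alpha> in \<open>auto simp: l_def\<close>)
    moreover have "l \<noteq> 0\<^sub>v r"
    proof
      assume "l = 0\<^sub>v r"
      then have "l $ 0 = 0" using r by simp
      then show False using \<alpha>[of 0] r by (simp add: l_def)
    qed
    ultimately show ?thesis using True unfolding rescaled_def by auto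
  qed (simp add: rescaled_def)
  assume res: "rescaled n r S S'"
  show "S' \<in> carrier_mat n n \<and> (\<exists>c. c \<noteq> 0 \<and> (\<forall>p<r. \<forall>q<n. S' $$ (p, q) = c * W p q))"
  proof (cases "r > 1")
    \<comment> \<open>For \<open>r = 1\<close> nothing is rescaled: the only row is already a
      multiple of that of \<open>W\<close>.\<close>
    case False
    then have "r = 1" "S' = S" using r res by (auto simp: rescaled_def)
    then show ?thesis using S Sv \<alpha>[of 0] by (auto intro!: exI[of _ "\<alpha> 0"])
  next
    case True
    then obtain l where l: "l \<in> mat_kernel (scaling_matrix r ?B)" "l \<noteq> 0\<^sub>v r"
      "S' = mat_diag n (\<lambda>p. if p < r then l $ p else 1) * S"
      using res by (auto simp: rescaled_def)
    have lc: "l \<in> carrier_vec r"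
      using l(1) by (auto simp: mat_kernel_def scaling_matrix_def)
    \<comment> \<open>Index 0 serves as reference; were its product zero, then all of
      \<open>l\<close> would be zero.\<close>
    have eq: "\<alpha> p * l $ p = \<alpha> 0 * l $ 0" if "p < r" for p
      using l(1) that unfolding ker[OF lc] by (cases p) auto
    have "\<alpha> 0 * l $ 0 \<noteq> 0"
    proof
      assume "\<alpha> 0 * l $ 0 = 0"
      then have "l $ p = 0" if "p < r" for p
        using eq[OF that] \<alpha>[OF that] by (metis mult_eq_0_iff)
      then have "l = 0\<^sub>v r" using lc by (intro eq_vecI) auto
      with l(2) show False ..
    qed
    moreover have S': "S' $$ (p, q) = (if p < r then l $ p else 1) * S $$ (p, q)" "S' \<in> carrier_mat n n"
      if "p < n" "q < n" for p q
      using that S unfolding l(3) by (simp_all add: mat_diag_mult_left)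
    have "S' $$ (p, q) = (\<alpha> 0 * l $ 0) * W p q" if "p < r" "q < n" for p q
    proof -
      have "S' $$ (p, q) = (\<alpha> p * l $ p) * W p q"
        using S'(1)[of p q] that r Sv[OF that] by simp
      then show ?thesis unfolding eq[OF that(1)] .
    qed
    moreover have "S' \<in> carrier_mat n n" using S'(2)[of 0 0] r by auto
    ultimately show ?thesis by blast
  qed
qed

section \<open>Correctness of one step\<close>

lemma outer_sum_scale: "c \<cdot>\<^sub>m outer_sum n s e y = outer_sum n s (\<lambda>k. c * e k) y"
  by (rule eq_matI) (auto simp: outer_sum_def sum_distrib_left mult.assoc)

text \<open>In the basis \<open>A\<close> the matrix \<open>outer_sum n s \<beta> y\<close> becomes
  \<open>\<eta> diag(\<beta>) \<eta>^T\<close>, where the top rows of \<open>\<eta>\<close> form the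
  Gram matrix of \<open>xs\<close> and \<open>y\<close>, with left inverse \<open>B\<close>. This
  factorization yields both hypotheses of \<open>completed_unique\<close>: cancelling the right
  factor by \<open>B\<close>, a combination of rows is determined by its first entries, and
  cancelling the left one, every row is a combination of the top rows. The factor \<open>c\<close>
  left by the rescaling does not affect eigenvectors.\<close>

lemma kc_step_recovers:
  assumes xs: "orthonormal_list n xs" "length xs \<le> n" and y: "orthonormal n s y" and s: "1 \<le> s"
    and \<alpha>: "\<And>p. p < length xs \<Longrightarrow> \<alpha> p \<noteq> 0"
    and \<beta>: "\<And>k. k < s \<Longrightarrow> \<beta> k \<noteq> 0" "inj_on \<beta> {..<s}"
    and nz: "\<And>p q. p < length xs \<Longrightarrow> q < length xs \<Longrightarrow> p \<noteq> q \<Longrightarrow>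
      (\<Sum>k<s. \<beta> k * (xs ! p \<bullet> y k) * (xs ! q \<bullet> y k)) \<noteq> 0"
    and B: "\<And>j j'. j < s \<Longrightarrow> j' < s \<Longrightarrow>
      (\<Sum>p<length xs. B j p * (xs ! p \<bullet> y j')) = (if j = j' then 1 else 0)"
    and T: "T = mat n n (\<lambda>(a, b). \<Sum>p<length xs. \<Sum>k<s.
      \<alpha> p * (xs ! p \<bullet> y k) * \<beta> k * (xs ! p $ a * y k $ b))"
  shows "\<exists>ys. kc_step n T xs ys" and "kc_step n T xs ys \<Longrightarrow> signed_perm s y ys"
proof -
  let ?r = "length xs"
  have xc: "xs ! p \<in> carrier_vec n" if "p < ?r" for p
    using xs that nth_mem[of p xs] unfolding orthonormal_list_def by blast
  have yc: "y k \<in> carrier_vec n" if "k < s" for k using y that by (simp add: orthonormal_def)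
  \<comment> \<open>An empty list has an empty Gram matrix, which has no left inverse when
    \<open>1 \<le> s\<close>.\<close>
  have r1: "1 \<le> ?r"
  proof (rule ccontr)
    assume "\<not> 1 \<le> ?r"
    then have "?r = 0" by linarith
    then show False using B[of 0 0] s by simp
  qed
  have Tc: "T \<in> carrier_mat n n" by (simp add: T)
  \<comment> \<open>A nonzero factor \<open>c\<close> keeps the eigenvalues nonzero and
    distinct.\<close>
  have eigen: "unit_eigenvectors n (outer_sum n s (\<lambda>k. c * \<beta> k) y) (map y [0..<s])"
    "unit_eigenvectors n (outer_sum n s (\<lambda>k. c * \<beta> k) y) ys \<Longrightarrow> signed_perm s y ys" if "c \<noteq> 0" for c ys
  proof -
    have "inj_on (\<lambda>k. c * \<beta> k) {..<s}" "\<And>k. k < s \<Longrightarrow> c * \<beta> k \<noteq> 0"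
      using that \<beta> by (simp_all add: inj_on_def)
    from unit_eigenvectors_outer_sum_basis[OF y this] unit_eigenvectors_outer_sum[OF y this]
    show "unit_eigenvectors n (outer_sum n s (\<lambda>k. c * \<beta> k) y) (map y [0..<s])"
      "unit_eigenvectors n (outer_sum n s (\<lambda>k. c * \<beta> k) y) ys \<Longrightarrow> signed_perm s y ys" by blast+
  qed
  \<comment> \<open>Stated for every possible \<open>A\<close>: existence of a run needs one such
    matrix, correctness needs all of them.\<close>
  have step: "(\<exists>S'. rescaled n ?r (transpose_mat A * T * A) S') \<and>
    (\<forall>S. rescaled n ?r (transpose_mat A * T * A) S \<longrightarrow> (\<exists>c. c \<noteq> 0 \<and>
      (\<forall>S'. completed n ?r (copy_rows n ?r S) S' \<longleftrightarrow>
         S' = c \<cdot>\<^sub>m (transpose_mat A * outer_sum n s \<beta> y * A))))"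
    if A: "A \<in> carrier_mat n n" "\<forall>p<?r. col A p = xs ! p"
      "transpose_mat A * A = 1\<^sub>m n" for A
  proof -
    define \<eta> where "\<eta> p k = col A p \<bullet> y k" for p k
    define W0 where "W0 p q = (\<Sum>k<s. \<beta> k * \<eta> p k * \<eta> q k)" for p q
    have cA: "col A p \<in> carrier_vec n" for p using A(1) by auto
    have \<eta>x: "\<eta> p k = xs ! p \<bullet> y k" if "p < ?r" for p k using A(2) that by (simp add: \<eta>_def)
    have sym0: "W0 p q = W0 q p" for p q by (simp add: W0_def mult_ac)
    have nz0: "W0 p q \<noteq> 0" if "p < ?r" "q < ?r" "p \<noteq> q" for p q
      using nz[OF that] that by (simp add: W0_def \<eta>x)
    \<comment> \<open>The first columns of \<open>A\<close> are the orthonormal \<open>xs\<close>,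
      so the left factor of \<open>T\<close> acts on row \<open>p\<close> of \<open>A^T\<close> as
      multiplication by \<open>\<alpha> p\<close>.\<close>
    have S0: "(transpose_mat A * T * A) $$ (p, q) = \<alpha> p * W0 p q" if "p < ?r" "q < n" for p q
    proof -
      have p: "p < n" using that xs by simp
      have "(transpose_mat A * T * A) $$ (p, q) = (transpose_mat A * (T * A)) $$ (p, q)"
        using A(1) Tc by (subst assoc_mult_mat[of _ n n _ n _ n]) auto
      also have "\<dots> = row (transpose_mat A) p \<bullet> col (T * A) q"
        using A(1) Tc p that by (intro index_mult_mat(1)) auto
      also have "\<dots> = xs ! p \<bullet> (T *\<^sub>v col A q)"
        unfolding col_mult2[OF Tc A(1) that(2)] using A p that(1) by simp
      also have "T *\<^sub>v col A q = vec n (\<lambda>a. \<Sum>p'<?r. (\<alpha> p' * (\<Sum>k<s. \<eta> p' k * \<beta> k * \<eta> q k)) * xs ! p' $ a)"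
      proof (rule eq_vecI)
        fix a assume "a < dim_vec (vec n (\<lambda>a. \<Sum>p'<?r. (\<alpha> p' * (\<Sum>k<s. \<eta> p' k * \<beta> k * \<eta> q k)) * xs ! p' $ a))"
        then have a: "a < n" by simp
        have "(T *\<^sub>v col A q) $ a = (\<Sum>b<n. (\<Sum>p'<?r. \<Sum>k<s. \<alpha> p' * (xs ! p' \<bullet> y k) * \<beta> k * (xs ! p' $ a * y k $ b)) * col A q $ b)"
          using a A(1) by (simp add: T scalar_prod_def atLeast0LessThan)
        also have "\<dots> = (\<Sum>b<n. \<Sum>p'<?r. \<Sum>k<s. \<alpha> p' * \<eta> p' k * \<beta> k * (xs ! p' $ a * y k $ b) * col A q $ b)"
          by (simp add: sum_distrib_right \<eta>x)
        also have "\<dots> = (\<Sum>p'<?r. \<Sum>b<n. \<Sum>k<s. \<alpha> p' * \<eta> p' k * \<beta> k * (xs ! p' $ a * y k $ b) * col A q $ b)"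
          by (rule sum.swap)
        also have "\<dots> = (\<Sum>p'<?r. \<Sum>k<s. \<Sum>b<n. \<alpha> p' * \<eta> p' k * \<beta> k * (xs ! p' $ a * y k $ b) * col A q $ b)"
          by (intro sum.cong refl sum.swap)
        also have "\<dots> = (\<Sum>p'<?r. \<Sum>k<s. \<alpha> p' * \<eta> p' k * \<beta> k * xs ! p' $ a * \<eta> q k)"
        proof (intro sum.cong refl)
          fix p' k assume "k \<in> {..<s}"
          then have "\<eta> q k = (\<Sum>b<n. col A q $ b * y k $ b)"
            using yc[of k] by (simp add: \<eta>_def scalar_prod_def atLeast0LessThan)
          then show "(\<Sum>b<n. \<alpha> p' * \<eta> p' k * \<beta> k * (xs ! p' $ a * y k $ b) * col A q $ b) =
              \<alpha> p' * \<eta> p' k * \<beta> k * xs ! p' $ a * \<eta> q k"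
            by (simp add: sum_distrib_left mult_ac)
        qed
        also have "\<dots> = (\<Sum>p'<?r. (\<alpha> p' * (\<Sum>k<s. \<eta> p' k * \<beta> k * \<eta> q k)) * xs ! p' $ a)"
          by (simp add: sum_distrib_left sum_distrib_right mult_ac)
        finally show "(T *\<^sub>v col A q) $ a = vec n (\<lambda>a. \<Sum>p'<?r. (\<alpha> p' * (\<Sum>k<s. \<eta> p' k * \<beta> k * \<eta> q k)) * xs ! p' $ a) $ a"
          using a by simp
      qed (use Tc in simp)
      also have "xs ! p \<bullet> \<dots> = (\<Sum>p'<?r. (\<alpha> p' * (\<Sum>k<s. \<eta> p' k * \<beta> k * \<eta> q k)) * (xs ! p \<bullet> xs ! p'))"
        using xc by (intro scalar_prod_lincomb) auto
      also have "\<dots> = (\<Sum>p'<?r. if p' = p then \<alpha> p * (\<Sum>k<s. \<eta> p k * \<beta> k * \<eta> q k) else 0)"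
        using xs that by (intro sum.cong refl) (auto simp: orthonormal_list_def)
      finally show ?thesis using that by (simp add: W0_def mult_ac)
    qed
    have Sc: "transpose_mat A * T * A \<in> carrier_mat n n" using A(1) Tc by simp
    have rs: "\<exists>S. rescaled n ?r (transpose_mat A * T * A) S"
      "\<And>S. rescaled n ?r (transpose_mat A * T * A) S \<Longrightarrow> S \<in> carrier_mat n n \<and>
        (\<exists>c. c \<noteq> 0 \<and> (\<forall>p<?r. \<forall>q<n. S $$ (p, q) = c * W0 p q))"
      using rescaled_rows[OF r1 xs(2) Sc, of \<alpha> W0] S0 sym0 nz0 \<alpha> by blast+
    have "\<exists>c. c \<noteq> 0 \<and> (\<forall>S'. completed n ?r (copy_rows n ?r S) S' \<longleftrightarrow>
         S' = c \<cdot>\<^sub>m (transpose_mat A * outer_sum n s \<beta> y * A))"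
      if S: "rescaled n ?r (transpose_mat A * T * A) S" for S
    proof -
      obtain c where c: "c \<noteq> 0" "S \<in> carrier_mat n n"
        "\<And>p q. p < ?r \<Longrightarrow> q < n \<Longrightarrow> S $$ (p, q) = c * W0 p q" using rs(2)[OF S] by blast
      define W where "W p q = c * W0 p q" for p q
      have W: "W p q = (\<Sum>j<s. c * \<eta> p j * (\<beta> j * \<eta> q j))" for p q
        by (simp add: W_def W0_def sum_distrib_left mult_ac)
      have symW: "W p q = W q p" for p q by (simp add: W_def sym0[of p q])
      have copy: "copy_rows n ?r S = partially_completed n W S ?r"
        unfolding copy_rows_def partially_completed_def
        using c(3) xs(2) symW by (intro cong_mat) (auto simp: W_def)
      have H: "(\<Sum>i\<le>k. u i * W i q) = 0"
        if v: "\<And>q. q < ?r \<Longrightarrow> (\<Sum>i\<le>k. u i * W i q) = 0" for k u q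
      proof -
        \<comment> \<open>The coordinates of the combination of rows with respect to the columns of
          \<open>\<eta>\<close>; \<open>B\<close> reads them off from the first columns
          alone.\<close>
        define \<omega> where "\<omega> j = (\<Sum>i\<le>k. u i * (c * \<eta> i j))" for j
        have comb: "(\<Sum>i\<le>k. u i * W i q) = (\<Sum>j<s. \<omega> j * (\<beta> j * \<eta> q j))" for q
        proof -
          have "(\<Sum>i\<le>k. u i * W i q) = (\<Sum>i\<le>k. \<Sum>j<s. u i * (c * \<eta> i j) * (\<beta> j * \<eta> q j))"
            by (simp add: W sum_distrib_left mult_ac)
          also have "\<dots> = (\<Sum>j<s. \<Sum>i\<le>k. u i * (c * \<eta> i j) * (\<beta> j * \<eta> q j))" by (rule sum.swap)
          also have "\<dots> = (\<Sum>j<s. \<omega> j * (\<beta> j * \<eta> q j))" by (simp add: \<omega>_def sum_distrib_right)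
          finally show ?thesis .
        qed
        have "\<omega> j = 0" if j: "j < s" for j
        proof -
          have "0 = (\<Sum>p<?r. B j p * (\<Sum>j'<s. \<omega> j' * (\<beta> j' * \<eta> p j')))"
            using v comb by simp
          also have "\<dots> = (\<Sum>p<?r. \<Sum>j'<s. \<omega> j' * \<beta> j' * (B j p * (xs ! p \<bullet> y j')))"
            by (simp add: sum_distrib_left \<eta>x mult_ac)
          also have "\<dots> = (\<Sum>j'<s. \<Sum>p<?r. \<omega> j' * \<beta> j' * (B j p * (xs ! p \<bullet> y j')))" by (rule sum.swap)
          also have "\<dots> = (\<Sum>j'<s. \<omega> j' * \<beta> j' * (\<Sum>p<?r. B j p * (xs ! p \<bullet> y j')))"
            by (simp add: sum_distrib_left)
          also have "\<dots> = (\<Sum>j'<s. if j' = j then \<omega> j * \<beta> j else 0)"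
            using B[OF j] by (intro sum.cong refl) auto
          also have "\<dots> = \<omega> j * \<beta> j" using j by simp
          finally show ?thesis using \<beta>(1)[OF j] by simp
        qed
        then show ?thesis unfolding comb by simp
      qed
      have dep: "\<exists>v. \<forall>q<n. W k q = (\<Sum>i<k. v i * W i q)" if k: "?r \<le> k" "k < n" for k
      proof -
        \<comment> \<open>Row \<open>k\<close> of \<open>\<eta>\<close> times \<open>B\<close>:
          since \<open>B\<close> is a left inverse of the top part of \<open>\<eta>\<close>, these
          coefficients express row \<open>k\<close> of \<open>\<eta>\<close>, hence of
          \<open>W\<close>, by the top rows.\<close>
        define v where "v i = (if i < ?r then \<Sum>j'<s. \<eta> k j' * B j' i else 0)" for i
        have "(\<Sum>i<k. v i * W i q) = W k q" for q
        proof -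
          have "(\<Sum>i<k. v i * W i q) = (\<Sum>i<?r. v i * W i q)"
            using k by (intro sum.mono_neutral_right) (auto simp: v_def)
          also have "\<dots> = (\<Sum>i<?r. (\<Sum>j'<s. \<eta> k j' * B j' i) * (\<Sum>j<s. c * \<eta> i j * (\<beta> j * \<eta> q j)))"
            by (simp add: v_def W)
          also have "\<dots> = (\<Sum>i<?r. \<Sum>j'<s. \<Sum>j<s. c * \<eta> k j' * (\<beta> j * \<eta> q j) * (B j' i * (xs ! i \<bullet> y j)))"
            by (simp add: sum_product \<eta>x mult_ac)
          also have "\<dots> = (\<Sum>j'<s. \<Sum>i<?r. \<Sum>j<s. c * \<eta> k j' * (\<beta> j * \<eta> q j) * (B j' i * (xs ! i \<bullet> y j)))"
            by (rule sum.swap)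
          also have "\<dots> = (\<Sum>j'<s. \<Sum>j<s. \<Sum>i<?r. c * \<eta> k j' * (\<beta> j * \<eta> q j) * (B j' i * (xs ! i \<bullet> y j)))"
            by (intro sum.cong refl sum.swap)
          also have "\<dots> = (\<Sum>j'<s. \<Sum>j<s. c * \<eta> k j' * (\<beta> j * \<eta> q j) * (\<Sum>i<?r. B j' i * (xs ! i \<bullet> y j)))"
            by (simp add: sum_distrib_left)
          also have "\<dots> = (\<Sum>j'<s. \<Sum>j<s. if j = j' then c * \<eta> k j' * (\<beta> j' * \<eta> q j') else 0)"
            using B by (intro sum.cong refl) auto
          also have "\<dots> = W k q" by (simp add: W)
          finally show ?thesis .
        qed
        then show ?thesis by (intro exI[of _ v]) simp
      qed
      have "mat n n (\<lambda>(p, q). W p q) = c \<cdot>\<^sub>m (transpose_mat A * outer_sum n s \<beta> y * A)"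
      proof -
        have eq: "transpose_mat A * outer_sum n s \<beta> y * A = mat n n (\<lambda>(p, q). W0 p q)"
          unfolding W0_def \<eta>_def by (rule mult_outer_sum_mult[OF A(1) yc])
        show ?thesis unfolding eq by (rule eq_matI) (simp_all add: W_def)
      qed
      moreover have "completed n ?r (copy_rows n ?r S) S' \<longleftrightarrow> S' = mat n n (\<lambda>(p, q). W p q)" for S'
        unfolding copy by (rule completed_unique[OF xs(2) symW H dep])
      ultimately show ?thesis using c(1) by auto
    qed
    then show ?thesis using rs(1) by blast
  qed
  have conj: "A * (c \<cdot>\<^sub>m (transpose_mat A * outer_sum n s \<beta> y * A)) * transpose_mat A =
      outer_sum n s (\<lambda>k. c * \<beta> k) y"
    if A: "A \<in> carrier_mat n n" "transpose_mat A * A = 1\<^sub>m n" for A c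
  proof -
    let ?Q = "outer_sum n s \<beta> y"
    have Q: "?Q \<in> carrier_mat n n" by (simp add: outer_sum_def)
    have At: "transpose_mat A \<in> carrier_mat n n" using A(1) by simp
    have AA: "A * transpose_mat A = 1\<^sub>m n" by (rule mat_mult_left_right_inverse[OF At A(1,2)])
    have QA: "?Q * A \<in> carrier_mat n n" using Q A(1) by simp
    have AQA: "transpose_mat A * ?Q * A = transpose_mat A * (?Q * A)"
      by (rule assoc_mult_mat[OF At Q A(1)])
    have "A * (c \<cdot>\<^sub>m (transpose_mat A * ?Q * A)) = c \<cdot>\<^sub>m (A * (transpose_mat A * (?Q * A)))"
      unfolding AQA by (rule mult_smult_distrib[OF A(1) mult_carrier_mat[OF At QA]])
    also have "A * (transpose_mat A * (?Q * A)) = A * transpose_mat A * (?Q * A)"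
      by (rule assoc_mult_mat[OF A(1) At QA, symmetric])
    also have "\<dots> = ?Q * A" unfolding AA by (rule left_mult_one_mat[OF QA])
    finally have "A * (c \<cdot>\<^sub>m (transpose_mat A * ?Q * A)) * transpose_mat A =
        c \<cdot>\<^sub>m (?Q * A) * transpose_mat A" by simp
    also have "\<dots> = c \<cdot>\<^sub>m (?Q * A * transpose_mat A)" by (rule mult_smult_assoc_mat[OF QA At])
    also have "?Q * A * transpose_mat A = ?Q * (A * transpose_mat A)" by (rule assoc_mult_mat[OF Q A(1) At])
    also have "\<dots> = ?Q" unfolding AA by (rule right_mult_one_mat[OF Q])
    finally show ?thesis unfolding outer_sum_scale .
  qed
  show "\<exists>ys. kc_step n T xs ys"
  proof -
    obtain A where A: "A \<in> carrier_mat n n" "transpose_mat A * A = 1\<^sub>m n" "\<forall>p<?r. col A p = xs ! p"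
      using orthogonal_completion[OF xs] by blast
    then obtain S c where S: "rescaled n ?r (transpose_mat A * T * A) S" "c \<noteq> 0"
      "\<And>S'. completed n ?r (copy_rows n ?r S) S' \<longleftrightarrow>
         S' = c \<cdot>\<^sub>m (transpose_mat A * outer_sum n s \<beta> y * A)" using step[of A] by blast
    have "kc_step n T xs (map y [0..<s])"
      unfolding kc_step_def Let_def
      using A S(1) S(3)[THEN iffD2, OF refl] eigen(1)[OF S(2), folded conj[OF A(1,2)]] by blast
    then show ?thesis by blast
  qed
  assume "kc_step n T xs ys"
  then obtain A S S' where A: "A \<in> carrier_mat n n" "transpose_mat A * A = 1\<^sub>m n" "\<forall>p<?r. col A p = xs ! p"
    and S: "rescaled n ?r (transpose_mat A * T * A) S" "completed n ?r (copy_rows n ?r S) S'"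
    and e: "unit_eigenvectors n (A * S' * transpose_mat A) ys"
    unfolding kc_step_def Let_def by blast
  obtain c where c: "c \<noteq> 0" "S' = c \<cdot>\<^sub>m (transpose_mat A * outer_sum n s \<beta> y * A)"
    using step[OF A(1,3,2)] S by blast
  show "signed_perm s y ys"
    by (rule eigen(2)[OF c(1)]) (use e in \<open>simp only: c(2) conj[OF A(1,2)]\<close>)
qed

section \<open>Contractions of a tensor train\<close>

definition carriage :: "nat \<Rightarrow> nat \<Rightarrow> nat" where
  "carriage L m = (if m = 1 then 1 else if m = L + 2 then L else m - 1)"

definition train_weight ::
    "nat \<Rightarrow> (nat \<Rightarrow> nat \<Rightarrow> real) \<Rightarrow> (nat \<Rightarrow> nat \<Rightarrow> real vec) \<Rightarrow> (nat \<Rightarrow> nat) \<Rightarrow> real" where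
  "train_weight L lam x a = (\<Prod>j=1..L. lam j (a j)) *
     (\<Prod>k=1..<L. x k (a k) \<bullet> x (k + 1) (a (k + 1)))"

lemma prod_modes:
  assumes "1 \<le> L"
  shows "(\<Prod>m=1..L + 2. F (carriage L m) m) =
    F 1 1 * (\<Prod>j=1..L. F j (j + 1)) * (F L (L + 2) :: real)"
proof -
  have "{1..L + 2} = insert 1 (insert (L + 2) (Suc ` {1..L}))"
  proof (intro equalityI subsetI)
    fix m assume m: "m \<in> {1..L + 2}"
    show "m \<in> insert 1 (insert (L + 2) (Suc ` {1..L}))"
      using m by (cases m) (auto simp: image_iff)
  qed auto
  moreover have "(\<Prod>m\<in>Suc ` {1..L}. F (carriage L m) m) = (\<Prod>j=1..L. F j (j + 1))"
    by (subst prod.reindex) (auto simp: carriage_def intro!: prod.cong)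
  ultimately show ?thesis by (subst (2) mult.commute) (auto simp: carriage_def image_iff mult_ac)
qed

text \<open>With one factor for each mode, the train is a sum of rank-one tensors, on which
  evaluation and contraction act mode by mode.\<close>

lemma tensor_train_modes:
  assumes "1 \<le> L"
  shows "tensor_train L r lam x i = (\<Sum>a\<in>midx L r. train_weight L lam x a *
    (\<Prod>m=1..L + 2. x (carriage L m) (a (carriage L m)) $ i m))"
  unfolding tensor_train_def train_weight_def
  by (subst prod_modes[OF assms, of "\<lambda>j m. x j (a j) $ i m" for a]) simp

section \<open>Evaluation and contraction of sums of rank-one tensors\<close>

lemma finite_midx: "finite (midx d N)"
  unfolding midx_def by (intro finite_PiE) auto

lemma tensor_eval_sum:
  assumes "\<And>m. m \<in> {1..d} \<Longrightarrow> dim_vec (u m) = n"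
  shows "tensor_eval n d (\<lambda>i. \<Sum>a\<in>A. w a * (\<Prod>m=1..d. X a m $ i m)) u =
    (\<Sum>a\<in>A. w a * (\<Prod>m=1..d. X a m \<bullet> u m))"
proof -
  have "(\<Sum>i\<in>midx d (\<lambda>_. n). (\<Sum>a\<in>A. w a * (\<Prod>m=1..d. X a m $ i m)) * (\<Prod>m=1..d. u m $ i m)) =
      (\<Sum>i\<in>midx d (\<lambda>_. n). \<Sum>a\<in>A. w a * (\<Prod>m=1..d. X a m $ i m * u m $ i m))"
    by (simp add: sum_distrib_right prod.distrib mult.assoc)
  also have "\<dots> = (\<Sum>a\<in>A. w a * (\<Sum>i\<in>midx d (\<lambda>_. n). \<Prod>m=1..d. X a m $ i m * u m $ i m))"
    by (subst sum.swap) (simp add: sum_distrib_left)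
  also have "\<dots> = (\<Sum>a\<in>A. w a * (\<Prod>m=1..d. X a m \<bullet> u m))"
  proof (intro sum.cong refl arg_cong2[of _ _ _ _ "(*)"])
    fix a
    have "(\<Sum>i\<in>midx d (\<lambda>_. n). \<Prod>m=1..d. X a m $ i m * u m $ i m) =
        (\<Prod>m=1..d. \<Sum>k<n. X a m $ k * u m $ k)"
      unfolding midx_def by (subst prod_sum_PiE) auto
    also have "\<dots> = (\<Prod>m=1..d. X a m \<bullet> u m)"
      using assms by (intro prod.cong refl) (simp add: scalar_prod_def atLeast0LessThan)
    finally show "(\<Sum>i\<in>midx d (\<lambda>_. n). \<Prod>m=1..d. X a m $ i m * u m $ i m) = (\<Prod>m=1..d. X a m \<bullet> u m)" .
  qed
  finally show ?thesis by (simp add: tensor_eval_def)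
qed

text \<open>Fixing the two free indices shrinks their ranges to singletons, so the index set remains
  a product set and the sum of products still factors.\<close>

lemma contract_sum:
  assumes pq: "p \<in> {1..d}" "q \<in> {1..d}" "p \<noteq> q" and ab: "a < n" "b < n" and v: "v \<in> carrier_vec n"
  shows "contract n d (\<lambda>i. \<Sum>c\<in>A. w c * (\<Prod>m=1..d. X c m $ i m)) p q v $$ (a, b) =
    (\<Sum>c\<in>A. w c * (X c p $ a * X c q $ b * (\<Prod>m\<in>{1..d} - {p, q}. X c m \<bullet> v)))"
proof -
  let ?B = "\<lambda>m. if m = p then {a} else if m = q then {b} else {..<n}"
  let ?I = "PiE {1..d} ?B"
  have I: "{i \<in> midx d (\<lambda>_. n). i p = a \<and> i q = b} = ?I"
  proof (intro equalityI subsetI)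
    fix i assume "i \<in> {i \<in> midx d (\<lambda>_. n). i p = a \<and> i q = b}"
    then have i: "i \<in> PiE {1..d} (\<lambda>_. {..<n})" "i p = a" "i q = b" by (simp_all add: midx_def)
    show "i \<in> ?I"
    proof (rule PiE_I)
      show "i m \<in> ?B m" if "m \<in> {1..d}" for m using i PiE_mem[OF i(1) that] by simp
      show "i m = undefined" if "m \<notin> {1..d}" for m using PiE_arb[OF i(1) that] .
    qed
  next
    fix i assume i: "i \<in> ?I"
    then have "i p = a" "i q = b" using PiE_mem[OF i pq(1)] PiE_mem[OF i pq(2)] pq(3) by simp_all
    moreover have "i \<in> midx d (\<lambda>_. n)" unfolding midx_def
      using i ab by (rule_tac PiE_mono[THEN subsetD, of _ ?B]) auto
    ultimately show "i \<in> {i \<in> midx d (\<lambda>_. n). i p = a \<and> i q = b}" using pq by simp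
  qed
  \<comment> \<open>The factor from \<open>v\<close> is set to 1 at the free modes, so that all
    modes have the same shape.\<close>
  let ?g = "\<lambda>c m k. X c m $ k * (if m \<in> {p, q} then 1 else v $ k)"
  have g: "(\<Prod>m=1..d. ?g c m (i m)) = (\<Prod>m=1..d. X c m $ i m) * (\<Prod>m\<in>{1..d} - {p, q}. v $ i m)" for c i
  proof -
    have "(\<Prod>m=1..d. (if m \<in> {p, q} then 1 else v $ i m)) = (\<Prod>m\<in>{1..d} - {p, q}. v $ i m)"
      by (intro prod.mono_neutral_cong_right) auto
    then show ?thesis by (simp only: prod.distrib)
  qed
  have "contract n d (\<lambda>i. \<Sum>c\<in>A. w c * (\<Prod>m=1..d. X c m $ i m)) p q v $$ (a, b) =
      (\<Sum>i\<in>?I. (\<Sum>c\<in>A. w c * (\<Prod>m=1..d. X c m $ i m)) * (\<Prod>m\<in>{1..d} - {p, q}. v $ i m))"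
    using ab by (simp add: contract_def I del: PiE_iff)
  also have "\<dots> = (\<Sum>i\<in>?I. \<Sum>c\<in>A. w c * (\<Prod>m=1..d. ?g c m (i m)))"
    unfolding g by (simp only: sum_distrib_right mult.assoc)
  also have "\<dots> = (\<Sum>c\<in>A. w c * (\<Sum>i\<in>?I. \<Prod>m=1..d. ?g c m (i m)))"
    by (subst sum.swap) (simp only: sum_distrib_left)
  also have "\<dots> = (\<Sum>c\<in>A. w c * (X c p $ a * X c q $ b * (\<Prod>m\<in>{1..d} - {p, q}. X c m \<bullet> v)))"
  proof (intro sum.cong refl arg_cong2[of _ _ _ _ "(*)"])
    fix c
    have "(\<Sum>i\<in>?I. \<Prod>m=1..d. ?g c m (i m)) = (\<Prod>m=1..d. \<Sum>k\<in>?B m. ?g c m k)"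
      by (rule prod_sum_PiE[symmetric]) auto
    also have "\<dots> = (\<Prod>m\<in>{p, q}. \<Sum>k\<in>?B m. ?g c m k) * (\<Prod>m\<in>{1..d} - {p, q}. \<Sum>k\<in>?B m. ?g c m k)"
      using pq by (subst prod.subset_diff[of "{p, q}"]) (auto simp: mult.commute)
    also have "(\<Prod>m\<in>{p, q}. \<Sum>k\<in>?B m. ?g c m k) = X c p $ a * X c q $ b" using pq by simp
    also have "(\<Prod>m\<in>{1..d} - {p, q}. \<Sum>k\<in>?B m. ?g c m k) = (\<Prod>m\<in>{1..d} - {p, q}. X c m \<bullet> v)"
      using v by (intro prod.cong refl) (auto simp: scalar_prod_def atLeast0LessThan)
    finally show "(\<Sum>i\<in>?I. \<Prod>m=1..d. ?g c m (i m)) =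
      X c p $ a * X c q $ b * (\<Prod>m\<in>{1..d} - {p, q}. X c m \<bullet> v)" .
  qed
  finally show ?thesis .
qed

text \<open>The contribution of carriages 1 to \<open>J\<close> for one choice of indices, with mode
  1 and the modes of carriages before \<open>J\<close> contracted with \<open>v\<close>. Mode
  \<open>J + 1\<close>, which belongs to carriage \<open>J\<close>, and the bond to carriage
  \<open>J + 1\<close> are left out. \<open>right_term\<close> is the mirror image.\<close>

definition left_term ::
    "(nat \<Rightarrow> nat \<Rightarrow> real) \<Rightarrow> (nat \<Rightarrow> nat \<Rightarrow> real vec) \<Rightarrow> real vec \<Rightarrow> nat \<Rightarrow> (nat \<Rightarrow> nat) \<Rightarrow> real" where
  "left_term lam x v J a = (\<Prod>j=1..J. lam j (a j)) *
     (\<Prod>k=1..<J. x k (a k) \<bullet> x (k + 1) (a (k + 1))) * (x 1 (a 1) \<bullet> v) * (\<Prod>j=1..<J. x j (a j) \<bullet> v)"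

definition right_term ::
    "nat \<Rightarrow> (nat \<Rightarrow> nat \<Rightarrow> real) \<Rightarrow> (nat \<Rightarrow> nat \<Rightarrow> real vec) \<Rightarrow> real vec \<Rightarrow> nat \<Rightarrow> (nat \<Rightarrow> nat) \<Rightarrow> real" where
  "right_term L lam x v J a = (\<Prod>j=J..L. lam j (a j)) *
     (\<Prod>k=J..<L. x k (a k) \<bullet> x (k + 1) (a (k + 1))) * (x L (a L) \<bullet> v) * (\<Prod>j=Suc J..L. x j (a j) \<bullet> v)"

text \<open>The total weight of vector \<open>p\<close> of carriage \<open>J\<close> coming from the
  left. It plays the role of \<open>\<alpha>\<close> in a step from left to right and of
  \<open>\<beta>\<close> in a step from right to left; \<open>right_sum\<close> has the opposite
  roles.\<close>

definition left_sum ::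
    "(nat \<Rightarrow> nat) \<Rightarrow> (nat \<Rightarrow> nat \<Rightarrow> real) \<Rightarrow> (nat \<Rightarrow> nat \<Rightarrow> real vec) \<Rightarrow> real vec \<Rightarrow> nat \<Rightarrow> nat \<Rightarrow> real" where
  "left_sum r lam x v J p =
     (\<Sum>a\<in>{a \<in> PiE {1..J} (\<lambda>j. {..<r j}). a J = p}. left_term lam x v J a)"

definition right_sum ::
    "nat \<Rightarrow> (nat \<Rightarrow> nat) \<Rightarrow> (nat \<Rightarrow> nat \<Rightarrow> real) \<Rightarrow> (nat \<Rightarrow> nat \<Rightarrow> real vec) \<Rightarrow> real vec \<Rightarrow> nat \<Rightarrow> nat \<Rightarrow> real" where
  "right_sum L r lam x v J p =
     (\<Sum>a\<in>{a \<in> PiE {J..L} (\<lambda>j. {..<r j}). a J = p}. right_term L lam x v J a)"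

section \<open>Cutting a train at a bond\<close>

lemma sum_PiE_group:
  fixes r :: "nat \<Rightarrow> nat" and F :: "(nat \<Rightarrow> nat) \<Rightarrow> real"
  assumes "finite I" "J \<in> I"
  shows "(\<Sum>a\<in>PiE I (\<lambda>j. {..<r j}). F a) = (\<Sum>p<r J. \<Sum>a\<in>{a \<in> PiE I (\<lambda>j. {..<r j}). a J = p}. F a)"
  using assms by (intro sum.group[symmetric] finite_PiE) (auto simp: PiE_iff)

lemma sum_PiE_split:
  fixes B :: "nat \<Rightarrow> nat set" and F :: "(nat \<Rightarrow> nat) \<Rightarrow> real"
  assumes "J < L"
  shows "(\<Sum>a\<in>PiE {1..L} B. F a) =
    (\<Sum>b\<in>PiE {1..J} B. \<Sum>c\<in>PiE {Suc J..L} B. F (\<lambda>i. if i \<le> J then b i else c i))"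
  unfolding sum.cartesian_product
proof (rule sum.reindex_bij_witness[where j = "\<lambda>a. (restrict a {1..J}, restrict a {Suc J..L})"
      and i = "\<lambda>(b, c) i. if i \<le> J then b i else c i"])
  fix a assume a: "a \<in> PiE {1..L} B"
  show eq: "(case (restrict a {1..J}, restrict a {Suc J..L}) of (b, c) \<Rightarrow> \<lambda>i. if i \<le> J then b i else c i) = a"
    using a by (auto simp: fun_eq_iff PiE_def extensional_def)
  show "(restrict a {1..J}, restrict a {Suc J..L}) \<in> PiE {1..J} B \<times> PiE {Suc J..L} B"
    using a assms by (auto simp: PiE_iff)
  show "(case (restrict a {1..J}, restrict a {Suc J..L}) of (b, c) \<Rightarrow>
      F (\<lambda>i. if i \<le> J then b i else c i)) = F a"
    using eq by simp
next
  fix bc assume "bc \<in> PiE {1..J} B \<times> PiE {Suc J..L} B"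
  then obtain b c where bc: "bc = (b, c)" "b \<in> PiE {1..J} B" "c \<in> PiE {Suc J..L} B" by auto
  show "(case bc of (b, c) \<Rightarrow> \<lambda>i. if i \<le> J then b i else c i) \<in> PiE {1..L} B"
    using bc assms by (auto simp: PiE_iff extensional_def)
  show "(restrict (case bc of (b, c) \<Rightarrow> \<lambda>i. if i \<le> J then b i else c i) {1..J},
      restrict (case bc of (b, c) \<Rightarrow> \<lambda>i. if i \<le> J then b i else c i) {Suc J..L}) = bc"
    using bc by (auto simp: fun_eq_iff PiE_def extensional_def)
qed

lemma contract_train:
  assumes L: "1 \<le> L" and pq: "p \<in> {1..L + 2}" "q \<in> {1..L + 2}" "p \<noteq> q"
    and ab: "a < n" "b < n" and v: "v \<in> carrier_vec n"
  shows "contract n (L + 2) (tensor_train L r lam x) p q v $$ (a, b) =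
    (\<Sum>c\<in>midx L r. train_weight L lam x c * (x (carriage L p) (c (carriage L p)) $ a *
      x (carriage L q) (c (carriage L q)) $ b *
      (\<Prod>m\<in>{1..L + 2} - {p, q}. x (carriage L m) (c (carriage L m)) \<bullet> v)))"
proof -
  have "tensor_train L r lam x = (\<lambda>i. \<Sum>a\<in>midx L r. train_weight L lam x a *
    (\<Prod>m=1..L + 2. x (carriage L m) (a (carriage L m)) $ i m))"
    using tensor_train_modes[OF L] by blast
  then show ?thesis
    using contract_sum[OF pq ab v, where X = "\<lambda>c m. x (carriage L m) (c (carriage L m))"] by simp
qed

text \<open>Cutting the bond between carriages \<open>J\<close> and \<open>J + 1\<close> splits each
  term into a factor in the indices up to \<open>J\<close>, a factor in the later ones, and the
  inner product at the bond. Summing with the two indices at the bond fixed leaves one weight on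
  either side.\<close>

lemma contract_middle:
  assumes J: "1 \<le> J" "J < L" and v: "v \<in> carrier_vec n"
  shows "contract n (L + 2) (tensor_train L r lam x) (J + 1) (J + 2) v = mat n n (\<lambda>(a, b).
    \<Sum>p<r J. \<Sum>q<r (J + 1). left_sum r lam x v J p * (x J p \<bullet> x (J + 1) q) *
      right_sum L r lam x v (J + 1) q * (x J p $ a * x (J + 1) q $ b))" (is "_ = ?M")
proof (rule eq_matI)
  fix a b assume "a < dim_row ?M" "b < dim_col ?M"
  then have ab: "a < n" "b < n" by simp_all
  let ?G = "\<lambda>c. left_term lam x v J c * (x J (c J) \<bullet> x (J + 1) (c (J + 1))) *
      right_term L lam x v (J + 1) c * (x J (c J) $ a * x (J + 1) (c (J + 1)) $ b)"
  have car: "carriage L (J + 1) = J" "carriage L (J + 2) = J + 1"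
    using J by (simp_all add: carriage_def)
  \<comment> \<open>The contracted modes, grouped by the side of the bond on which they lie; each
    group contains the additional mode of its end carriage.\<close>
  have modes: "{1..L + 2} - {J + 1, J + 2} =
      ({1} \<union> Suc ` {1..<J}) \<union> (Suc ` {Suc (J + 1)..L} \<union> {L + 2})"
  proof (intro equalityI subsetI)
    fix m assume m: "m \<in> {1..L + 2} - {J + 1, J + 2}"
    then show "m \<in> ({1} \<union> Suc ` {1..<J}) \<union> (Suc ` {Suc (J + 1)..L} \<union> {L + 2})"
      by (cases m) (auto simp: image_iff)
  qed (use J in auto)
  have prod: "(\<Prod>m\<in>{1..L + 2} - {J + 1, J + 2}. x (carriage L m) (c (carriage L m)) \<bullet> v) =
      (x 1 (c 1) \<bullet> v) * (\<Prod>j=1..<J. x j (c j) \<bullet> v) *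
      ((\<Prod>j=Suc (J + 1)..L. x j (c j) \<bullet> v) * (x L (c L) \<bullet> v))" for c
  proof -
    let ?F = "\<lambda>m. x (carriage L m) (c (carriage L m)) \<bullet> v"
    have s: "prod ?F (Suc ` A) = (\<Prod>j\<in>A. x j (c j) \<bullet> v)" if "A \<subseteq> {1..L}" for A
      using that by (subst prod.reindex) (auto simp: carriage_def intro!: prod.cong)
    have 1: "prod ?F ({1} \<union> Suc ` {1..<J}) = prod ?F {1} * prod ?F (Suc ` {1..<J})"
      by (rule prod.union_disjoint) auto
    have 2: "prod ?F (Suc ` {Suc (J + 1)..L} \<union> {L + 2}) = prod ?F (Suc ` {Suc (J + 1)..L}) * prod ?F {L + 2}"
      by (rule prod.union_disjoint) auto
    have 3: "prod ?F (({1} \<union> Suc ` {1..<J}) \<union> (Suc ` {Suc (J + 1)..L} \<union> {L + 2})) =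
        prod ?F ({1} \<union> Suc ` {1..<J}) * prod ?F (Suc ` {Suc (J + 1)..L} \<union> {L + 2})"
      by (rule prod.union_disjoint) (use J in auto)
    have 4: "prod ?F {1} = x 1 (c 1) \<bullet> v" "prod ?F {L + 2} = x L (c L) \<bullet> v"
      by (simp_all add: carriage_def)
    have 5: "prod ?F (Suc ` {1..<J}) = (\<Prod>j=1..<J. x j (c j) \<bullet> v)"
      "prod ?F (Suc ` {Suc (J + 1)..L}) = (\<Prod>j=Suc (J + 1)..L. x j (c j) \<bullet> v)"
      using J by (intro s; auto)+
    show ?thesis unfolding modes 3 1 2 4 5 ..
  qed
  have weight: "train_weight L lam x c = (\<Prod>j=1..J. lam j (c j)) *
      (\<Prod>k=1..<J. x k (c k) \<bullet> x (k + 1) (c (k + 1))) * (x J (c J) \<bullet> x (J + 1) (c (J + 1))) *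
      ((\<Prod>j=J + 1..L. lam j (c j)) * (\<Prod>k=J + 1..<L. x k (c k) \<bullet> x (k + 1) (c (k + 1))))" for c
  proof -
    have "{1..L} = {1..J} \<union> {J + 1..L}" "{1..<L} = {1..<J} \<union> {J} \<union> {J + 1..<L}" using J by auto
    moreover have "(\<Prod>j\<in>{1..J} \<union> {J + 1..L}. lam j (c j)) = (\<Prod>j=1..J. lam j (c j)) * (\<Prod>j=J + 1..L. lam j (c j))"
      by (rule prod.union_disjoint) auto
    moreover have "(\<Prod>k\<in>{1..<J} \<union> {J} \<union> {J + 1..<L}. x k (c k) \<bullet> x (k + 1) (c (k + 1))) =
        (\<Prod>k=1..<J. x k (c k) \<bullet> x (k + 1) (c (k + 1))) * (x J (c J) \<bullet> x (J + 1) (c (J + 1))) *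
        (\<Prod>k=J + 1..<L. x k (c k) \<bullet> x (k + 1) (c (k + 1)))"
      by (subst prod.union_disjoint, simp, simp, force)+ simp
    ultimately show ?thesis unfolding train_weight_def by simp
  qed
  have L1: "1 \<le> L" "J + 1 \<in> {1..L + 2}" "J + 2 \<in> {1..L + 2}" "J + 1 \<noteq> J + 2" using J by auto
  have "contract n (L + 2) (tensor_train L r lam x) (J + 1) (J + 2) v $$ (a, b) =
      (\<Sum>c\<in>midx L r. ?G c)"
    unfolding contract_train[OF L1 ab v] car prod weight left_term_def right_term_def
    by (simp only: mult_ac)
  also have "\<dots> = (\<Sum>b\<in>PiE {1..J} (\<lambda>j. {..<r j}). \<Sum>c\<in>PiE {Suc J..L} (\<lambda>j. {..<r j}).
      ?G (\<lambda>i. if i \<le> J then b i else c i))"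
    unfolding midx_def by (rule sum_PiE_split[OF J(2)])
  also have "\<dots> = (\<Sum>d\<in>PiE {1..J} (\<lambda>j. {..<r j}). \<Sum>c\<in>PiE {Suc J..L} (\<lambda>j. {..<r j}).
      left_term lam x v J d * (x J (d J) \<bullet> x (J + 1) (c (J + 1))) *
      right_term L lam x v (J + 1) c * (x J (d J) $ a * x (J + 1) (c (J + 1)) $ b))"
  proof (intro sum.cong refl)
    fix d c :: "nat \<Rightarrow> nat"
    let ?m = "\<lambda>i. if i \<le> J then d i else c i"
    \<comment> \<open>Each factor reads only its own half of the glued index, so the two sums become
      independent.\<close>
    have "left_term lam x v J ?m = left_term lam x v J d"
      using J unfolding left_term_def by (intro arg_cong2[of _ _ _ _ "(*)"] prod.cong) auto
    moreover have "right_term L lam x v (J + 1) ?m = right_term L lam x v (J + 1) c"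
      using J unfolding right_term_def by (intro arg_cong2[of _ _ _ _ "(*)"] prod.cong) auto
    ultimately show "?G ?m = left_term lam x v J d * (x J (d J) \<bullet> x (J + 1) (c (J + 1))) *
      right_term L lam x v (J + 1) c * (x J (d J) $ a * x (J + 1) (c (J + 1)) $ b)" by simp
  qed
  also have "\<dots> = (\<Sum>p<r J. \<Sum>d\<in>{d \<in> PiE {1..J} (\<lambda>j. {..<r j}). d J = p}.
      \<Sum>q<r (J + 1). \<Sum>c\<in>{c \<in> PiE {Suc J..L} (\<lambda>j. {..<r j}). c (J + 1) = q}.
      left_term lam x v J d * (x J (d J) \<bullet> x (J + 1) (c (J + 1))) *
      right_term L lam x v (J + 1) c * (x J (d J) $ a * x (J + 1) (c (J + 1)) $ b))"
  proof (subst sum_PiE_group[of "{1..J}" J]; (intro sum.cong refl)?)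
    show "(\<Sum>c\<in>PiE {Suc J..L} (\<lambda>j. {..<r j}).
        left_term lam x v J d * (x J (d J) \<bullet> x (J + 1) (c (J + 1))) *
        right_term L lam x v (J + 1) c * (x J (d J) $ a * x (J + 1) (c (J + 1)) $ b)) =
      (\<Sum>q<r (J + 1). \<Sum>c\<in>{c \<in> PiE {Suc J..L} (\<lambda>j. {..<r j}). c (J + 1) = q}.
        left_term lam x v J d * (x J (d J) \<bullet> x (J + 1) (c (J + 1))) *
        right_term L lam x v (J + 1) c * (x J (d J) $ a * x (J + 1) (c (J + 1)) $ b))" for d
      using J by (intro sum_PiE_group) auto
  qed (use J in auto)
  also have "\<dots> = (\<Sum>p<r J. \<Sum>d\<in>{d \<in> PiE {1..J} (\<lambda>j. {..<r j}). d J = p}.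
      \<Sum>q<r (J + 1). \<Sum>c\<in>{c \<in> PiE {Suc J..L} (\<lambda>j. {..<r j}). c (J + 1) = q}.
      left_term lam x v J d * (x J p \<bullet> x (J + 1) q) *
      right_term L lam x v (J + 1) c * (x J p $ a * x (J + 1) q $ b))"
    by (intro sum.cong refl) auto
  also have "\<dots> = (\<Sum>p<r J. \<Sum>q<r (J + 1). \<Sum>d\<in>{d \<in> PiE {1..J} (\<lambda>j. {..<r j}). d J = p}.
      \<Sum>c\<in>{c \<in> PiE {Suc J..L} (\<lambda>j. {..<r j}). c (J + 1) = q}.
      left_term lam x v J d * (x J p \<bullet> x (J + 1) q) *
      right_term L lam x v (J + 1) c * (x J p $ a * x (J + 1) q $ b))"
    by (intro sum.cong refl sum.swap)
  also have "\<dots> = (\<Sum>p<r J. \<Sum>q<r (J + 1). left_sum r lam x v J p * (x J p \<bullet> x (J + 1) q) *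
      right_sum L r lam x v (J + 1) q * (x J p $ a * x (J + 1) q $ b))"
  proof (intro sum.cong refl)
    fix p q
    let ?D = "{d \<in> PiE {1..J} (\<lambda>j. {..<r j}). d J = p}"
      and ?C = "{c \<in> PiE {Suc J..L} (\<lambda>j. {..<r j}). c (J + 1) = q}"
      and ?g = "x J p \<bullet> x (J + 1) q" and ?o = "x J p $ a * x (J + 1) q $ b"
    have "(\<Sum>d\<in>?D. \<Sum>c\<in>?C. left_term lam x v J d * ?g * right_term L lam x v (J + 1) c * ?o) =
        ?g * ?o * (\<Sum>d\<in>?D. \<Sum>c\<in>?C. left_term lam x v J d * right_term L lam x v (J + 1) c)"
      unfolding sum_distrib_left by (intro sum.cong refl) (simp only: mult_ac)
    also have "\<dots> = ?g * ?o * (left_sum r lam x v J p * right_sum L r lam x v (J + 1) q)"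
      unfolding left_sum_def right_sum_def sum_product by simp
    finally show "(\<Sum>d\<in>?D. \<Sum>c\<in>?C. left_term lam x v J d * ?g * right_term L lam x v (J + 1) c * ?o) =
        left_sum r lam x v J p * ?g * right_sum L r lam x v (J + 1) q * ?o"
      by (simp only: mult_ac)
  qed
  finally show "contract n (L + 2) (tensor_train L r lam x) (J + 1) (J + 2) v $$ (a, b) = ?M $$ (a, b)"
    using ab by simp
qed (simp_all add: contract_def)

text \<open>Both free modes belong to carriage 1, so a single index of it appears in each term, and
  the contraction is a spectral decomposition with the vectors of that carriage.\<close>

lemma contract_first:
  assumes L: "1 \<le> L" and v: "v \<in> carrier_vec n"
  shows "contract n (L + 2) (tensor_train L r lam x) 1 2 v =
    outer_sum n (r 1) (right_sum L r lam x v 1) (x 1)"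
proof (rule eq_matI)
  fix a b assume "a < dim_row (outer_sum n (r 1) (right_sum L r lam x v 1) (x 1))"
    "b < dim_col (outer_sum n (r 1) (right_sum L r lam x v 1) (x 1))"
  then have ab: "a < n" "b < n" by (simp_all add: outer_sum_def)
  have LL: "1 \<in> {1..L + 2}" "2 \<in> {1..L + 2}" "1 \<noteq> (2 :: nat)" using L by auto
  have car: "carriage L 1 = 1" "carriage L 2 = 1" using L by (simp_all add: carriage_def)
  have modes: "{1..L + 2} - {1, 2} = insert (L + 2) (Suc ` {Suc 1..L})"
  proof (intro equalityI subsetI)
    fix m assume m: "m \<in> {1..L + 2} - {1, 2}"
    then show "m \<in> insert (L + 2) (Suc ` {Suc 1..L})"
      by (cases m) (auto simp: image_iff)
  qed (use L in auto)
  have prod: "(\<Prod>m\<in>{1..L + 2} - {1, 2}. x (carriage L m) (c (carriage L m)) \<bullet> v) =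
      (x L (c L) \<bullet> v) * (\<Prod>j=Suc 1..L. x j (c j) \<bullet> v)" for c
  proof -
    have "(\<Prod>m\<in>Suc ` {Suc 1..L}. x (carriage L m) (c (carriage L m)) \<bullet> v) = (\<Prod>j=Suc 1..L. x j (c j) \<bullet> v)"
      by (subst prod.reindex) (auto simp: carriage_def intro!: prod.cong)
    then show ?thesis unfolding modes using L by (subst prod.insert) (auto simp: carriage_def)
  qed
  have "contract n (L + 2) (tensor_train L r lam x) 1 2 v $$ (a, b) =
      (\<Sum>c\<in>midx L r. right_term L lam x v 1 c * (x 1 (c 1) $ a * x 1 (c 1) $ b))"
    unfolding contract_train[OF L LL ab v] car prod train_weight_def right_term_def
    by (simp only: mult_ac)
  also have "\<dots> = (\<Sum>p<r 1. \<Sum>c\<in>{c \<in> PiE {1..L} (\<lambda>j. {..<r j}). c 1 = p}.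
      right_term L lam x v 1 c * (x 1 (c 1) $ a * x 1 (c 1) $ b))"
    unfolding midx_def using L by (intro sum_PiE_group) auto
  also have "\<dots> = (\<Sum>p<r 1. \<Sum>c\<in>{c \<in> PiE {1..L} (\<lambda>j. {..<r j}). c 1 = p}.
      right_term L lam x v 1 c * (x 1 p $ a * x 1 p $ b))"
    by (intro sum.cong refl) auto
  also have "\<dots> = outer_sum n (r 1) (right_sum L r lam x v 1) (x 1) $$ (a, b)"
    using ab by (simp add: outer_sum_def right_sum_def sum_distrib_right mult.assoc)
  finally show "contract n (L + 2) (tensor_train L r lam x) 1 2 v $$ (a, b) =
    outer_sum n (r 1) (right_sum L r lam x v 1) (x 1) $$ (a, b)" .
qed (simp_all add: contract_def outer_sum_def)

lemma contract_last:
  assumes L: "1 \<le> L" and v: "v \<in> carrier_vec n"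
  shows "contract n (L + 2) (tensor_train L r lam x) (L + 1) (L + 2) v =
    outer_sum n (r L) (left_sum r lam x v L) (x L)"
proof (rule eq_matI)
  fix a b assume "a < dim_row (outer_sum n (r L) (left_sum r lam x v L) (x L))"
    "b < dim_col (outer_sum n (r L) (left_sum r lam x v L) (x L))"
  then have ab: "a < n" "b < n" by (simp_all add: outer_sum_def)
  have LL: "L + 1 \<in> {1..L + 2}" "L + 2 \<in> {1..L + 2}" "L + 1 \<noteq> L + 2" using L by auto
  have car: "carriage L (L + 1) = L" "carriage L (L + 2) = L" using L by (simp_all add: carriage_def)
  have modes: "{1..L + 2} - {L + 1, L + 2} = insert 1 (Suc ` {1..<L})"
  proof (intro equalityI subsetI)
    fix m assume m: "m \<in> {1..L + 2} - {L + 1, L + 2}"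
    then show "m \<in> insert 1 (Suc ` {1..<L})"
      by (cases m) (auto simp: image_iff)
  qed (use L in auto)
  have prod: "(\<Prod>m\<in>{1..L + 2} - {L + 1, L + 2}. x (carriage L m) (c (carriage L m)) \<bullet> v) =
      (x 1 (c 1) \<bullet> v) * (\<Prod>j=1..<L. x j (c j) \<bullet> v)" for c
  proof -
    have "(\<Prod>m\<in>Suc ` {1..<L}. x (carriage L m) (c (carriage L m)) \<bullet> v) = (\<Prod>j=1..<L. x j (c j) \<bullet> v)"
      by (subst prod.reindex) (auto simp: carriage_def intro!: prod.cong)
    then show ?thesis unfolding modes using L by (subst prod.insert) (auto simp: carriage_def)
  qed
  have "contract n (L + 2) (tensor_train L r lam x) (L + 1) (L + 2) v $$ (a, b) =
      (\<Sum>c\<in>midx L r. left_term lam x v L c * (x L (c L) $ a * x L (c L) $ b))"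
    unfolding contract_train[OF L LL ab v] car prod train_weight_def left_term_def
    by (simp only: mult_ac)
  also have "\<dots> = (\<Sum>p<r L. \<Sum>c\<in>{c \<in> PiE {1..L} (\<lambda>j. {..<r j}). c L = p}.
      left_term lam x v L c * (x L (c L) $ a * x L (c L) $ b))"
    unfolding midx_def using L by (intro sum_PiE_group) auto
  also have "\<dots> = (\<Sum>p<r L. \<Sum>c\<in>{c \<in> PiE {1..L} (\<lambda>j. {..<r j}). c L = p}.
      left_term lam x v L c * (x L p $ a * x L p $ b))"
    by (intro sum.cong refl) auto
  also have "\<dots> = outer_sum n (r L) (left_sum r lam x v L) (x L) $$ (a, b)"
    using ab by (simp add: outer_sum_def left_sum_def sum_distrib_right mult.assoc)
  finally show "contract n (L + 2) (tensor_train L r lam x) (L + 1) (L + 2) v $$ (a, b) =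
    outer_sum n (r L) (left_sum r lam x v L) (x L) $$ (a, b)" .
qed (simp_all add: contract_def outer_sum_def)

text \<open>By orthonormality, evaluation at the recovered vectors keeps a single term of the train,
  and the Gram factors cancel against the denominator. The signs left over are one for each
  carriage, which is why signs pass from vectors to coefficients.\<close>

lemma coef_tensor_rank_one:
  assumes L: "1 \<le> L" and on: "\<And>j. j \<in> {1..L} \<Longrightarrow> orthonormal n (r j) (x j)"
    and gram: "\<And>k p q. 1 \<le> k \<Longrightarrow> k < L \<Longrightarrow> p < r k \<Longrightarrow> q < r (k + 1) \<Longrightarrow> x k p \<bullet> x (k + 1) q \<noteq> 0"
    and \<pi>: "\<And>j i. j \<in> {1..L} \<Longrightarrow> i < r j \<Longrightarrow> \<pi> j i < r j"
    and \<sigma>: "\<And>j i. j \<in> {1..L} \<Longrightarrow> i < r j \<Longrightarrow> \<sigma> j i \<in> {1, - 1}"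
    and y: "\<And>j i. j \<in> {1..L} \<Longrightarrow> i < r j \<Longrightarrow> y j ! i = \<sigma> j i \<cdot>\<^sub>v x j (\<pi> j i)"
    and i: "i \<in> midx L r"
  shows "kc_coef_tensor n L (tensor_train L r lam x) y i = (\<Prod>j=1..L. \<sigma> j (i j) * lam j (\<pi> j (i j)))"
proof -
  \<comment> \<open>The only surviving multi-index, made \<open>undefined\<close> outside the modes
    so that it is an element of \<open>midx L r\<close>.\<close>
  define b where "b j = (if j \<in> {1..L} then \<pi> j (i j) else undefined)" for j
  define t where "t j = \<sigma> j (i j)" for j
  have ir: "i j < r j" if "j \<in> {1..L}" for j using i that by (auto simp: midx_def PiE_iff)
  have bm: "b \<in> midx L r" using \<pi> ir by (auto simp: midx_def PiE_iff extensional_def b_def)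
  have t: "t j * t j = 1" "t j \<noteq> 0" if "j \<in> {1..L}" for j
    using \<sigma>[OF that ir[OF that]] by (auto simp: t_def)
  have xc: "x j p \<in> carrier_vec n" if "j \<in> {1..L}" "p < r j" for j p
    using on[OF that(1)] that(2) by (simp add: orthonormal_def)
  have yj: "y j ! i j = t j \<cdot>\<^sub>v x j (b j)" if "j \<in> {1..L}" for j
    using y[OF that ir[OF that]] that by (simp add: b_def t_def)
  have br: "b j < r j" if "j \<in> {1..L}" for j using \<pi>[OF that ir[OF that]] that by (simp add: b_def)
  have car: "carriage L m \<in> {1..L}" if "m \<in> {1..L + 2}" for m
    using that L by (auto simp: carriage_def)
  define u where "u m = t (carriage L m) \<cdot>\<^sub>v x (carriage L m) (b (carriage L m))" for m
  let ?T = "tensor_train L r lam x"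
  have "tensor_eval n (L + 2) ?T
      (\<lambda>m. if m = 1 then y 1 ! i 1 else if m = L + 2 then y L ! i L else y (m - 1) ! i (m - 1)) =
      tensor_eval n (L + 2) ?T u"
    unfolding tensor_eval_def
  proof (intro sum.cong refl arg_cong2[of _ _ _ _ "(*)"] prod.cong)
    fix k m assume m: "m \<in> {1..L + 2}"
    have "(if m = 1 then y 1 ! i 1 else if m = L + 2 then y L ! i L else y (m - 1) ! i (m - 1)) =
        y (carriage L m) ! i (carriage L m)" by (simp add: carriage_def)
    also have "\<dots> = u m" unfolding yj[OF car[OF m]] u_def ..
    finally show "(if m = 1 then y 1 ! i 1 else if m = L + 2 then y L ! i L
        else y (m - 1) ! i (m - 1)) $ k m = u m $ k m" by simp
  qed
  also have "\<dots> = (\<Sum>a\<in>midx L r. train_weight L lam x a *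
      (\<Prod>m=1..L + 2. x (carriage L m) (a (carriage L m)) \<bullet> u m))"
  proof -
    have T: "?T = (\<lambda>i. \<Sum>a\<in>midx L r. train_weight L lam x a *
      (\<Prod>m=1..L + 2. x (carriage L m) (a (carriage L m)) $ i m))"
      using tensor_train_modes[OF L] by blast
    have "dim_vec (u m) = n" if "m \<in> {1..L + 2}" for m
      using xc[OF car[OF that] br[OF car[OF that]]] by (simp add: u_def)
    then show ?thesis unfolding T by (rule tensor_eval_sum)
  qed
  also have "\<dots> = (\<Sum>a\<in>midx L r. if a = b then train_weight L lam x b * (t 1 * (\<Prod>j=1..L. t j) * t L) else 0)"
  proof (intro sum.cong refl)
    fix a assume a: "a \<in> midx L r"
    have ar: "a j < r j" if "j \<in> {1..L}" for j using a that by (auto simp: midx_def PiE_iff)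
    have inner: "x (carriage L m) (a (carriage L m)) \<bullet> u m =
        t (carriage L m) * (if a (carriage L m) = b (carriage L m) then 1 else 0)"
      if "m \<in> {1..L + 2}" for m
    proof -
      note c = car[OF that]
      have "x (carriage L m) (a (carriage L m)) \<bullet> u m =
          t (carriage L m) * (x (carriage L m) (a (carriage L m)) \<bullet> x (carriage L m) (b (carriage L m)))"
        unfolding u_def using xc[OF c ar[OF c]] xc[OF c br[OF c]] by simp
      then show ?thesis using on[OF c] ar[OF c] br[OF c] by (simp add: orthonormal_def)
    qed
    show "train_weight L lam x a * (\<Prod>m=1..L + 2. x (carriage L m) (a (carriage L m)) \<bullet> u m) =
      (if a = b then train_weight L lam x b * (t 1 * (\<Prod>j=1..L. t j) * t L) else 0)"
    proof (cases "a = b")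
      case True
      have "(\<Prod>m=1..L + 2. x (carriage L m) (a (carriage L m)) \<bullet> u m) = (\<Prod>m=1..L + 2. t (carriage L m))"
        using inner True by (intro prod.cong) auto
      then show ?thesis using True prod_modes[OF L, of "\<lambda>j m. t j"] by simp
    next
      case False
      then obtain j where "a j \<noteq> b j" by blast
      moreover have "a j = b j" if "j \<notin> {1..L}" for j
        using a bm that by (auto simp: midx_def PiE_def extensional_def)
      ultimately have j: "j \<in> {1..L}" "a j \<noteq> b j" by auto
      have cj: "carriage L (j + 1) = j" "j + 1 \<in> {1..L + 2}" using j(1) by (auto simp: carriage_def)
      have "x (carriage L (j + 1)) (a (carriage L (j + 1))) \<bullet> u (j + 1) = 0"
        using inner[OF cj(2)] j(2) cj(1) by simp
      then have "(\<Prod>m=1..L + 2. x (carriage L m) (a (carriage L m)) \<bullet> u m) = 0"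
        using cj(2) by (intro prod_zero) blast+
      then show ?thesis using False by simp
    qed
  qed
  also have "\<dots> = train_weight L lam x b * (t 1 * (\<Prod>j=1..L. t j) * t L)"
    using bm finite_midx by simp
  finally have eval: "tensor_eval n (L + 2) ?T
      (\<lambda>m. if m = 1 then y 1 ! i 1 else if m = L + 2 then y L ! i L else y (m - 1) ! i (m - 1)) =
      train_weight L lam x b * (t 1 * (\<Prod>j=1..L. t j) * t L)" .
  let ?g = "\<lambda>k. x k (b k) \<bullet> x (k + 1) (b (k + 1))"
  have den: "(\<Prod>k=1..<L. y k ! i k \<bullet> y (k + 1) ! i (k + 1)) = (\<Prod>k=1..<L. t k) * (\<Prod>k=1..<L. t (k + 1)) * (\<Prod>k=1..<L. ?g k)"
    unfolding prod.distrib[symmetric]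
  proof (intro prod.cong refl)
    fix k assume "k \<in> {1..<L}"
    then have k: "k \<in> {1..L}" "k + 1 \<in> {1..L}" by auto
    show "y k ! i k \<bullet> y (k + 1) ! i (k + 1) = t k * t (k + 1) * ?g k"
      unfolding yj[OF k(1)] yj[OF k(2)] using xc[OF k(1) br[OF k(1)]] xc[OF k(2) br[OF k(2)]] by simp
  qed
  have tl: "(\<Prod>j=1..L. t j) = (\<Prod>k=1..<L. t k) * t L"
    using L by (metis One_nat_def atLeastLessThanSuc_atLeastAtMost prod.atLeastLessThan_Suc)
  have t1: "(\<Prod>j=1..L. t j) = t 1 * (\<Prod>k=1..<L. t (k + 1))"
  proof -
    have "(\<Prod>j=1..L. t j) = t 1 * (\<Prod>j=Suc 1..L. t j)"
      using L by (rule prod.atLeast_Suc_atMost)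
    also have "(\<Prod>j=Suc 1..L. t j) = (\<Prod>k=1..<L. t (Suc k))"
      by (metis atLeastLessThanSuc_atLeastAtMost prod.shift_bounds_Suc_ivl)
    finally show ?thesis by simp
  qed
  have gnz: "(\<Prod>k=1..<L. ?g k) \<noteq> 0" using gram br by auto
  have tnz: "(\<Prod>k=1..<L. t k) \<noteq> 0" "(\<Prod>k=1..<L. t (k + 1)) \<noteq> 0" using t(2) by auto
  have t1L: "t 1 * t 1 = 1" "t L * t L = 1" using t(1) L by simp_all
  \<comment> \<open>In the denominator every interior sign occurs twice, so the signs at the two
    ends remain; they match the additional modes of the end carriages in the numerator.\<close>
  have tt: "t 1 * (\<Prod>j=1..L. t j) * t L = (\<Prod>j=1..L. t j) * ((\<Prod>k=1..<L. t k) * (\<Prod>k=1..<L. t (k + 1)))"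
  proof -
    have "(\<Prod>j=1..L. t j) * (\<Prod>j=1..L. t j) = 1"
      unfolding prod.distrib[symmetric] using t(1) by simp
    then have "t 1 * t L = t 1 * t L * ((\<Prod>j=1..L. t j) * (\<Prod>j=1..L. t j))" by simp
    also have "\<dots> = (t 1 * t 1) * (t L * t L) * ((\<Prod>k=1..<L. t k) * (\<Prod>k=1..<L. t (k + 1)))"
      by (subst (2) tl, subst t1) (simp only: mult_ac)
    finally have "t 1 * t L = (\<Prod>k=1..<L. t k) * (\<Prod>k=1..<L. t (k + 1))"
      by (simp only: t1L mult_1_left)
    then show ?thesis by (metis mult.assoc mult.commute)
  qed
  have "kc_coef_tensor n L ?T y i = (\<Prod>j=1..L. lam j (b j)) * (\<Prod>j=1..L. t j)"
    unfolding kc_coef_tensor_def eval den tt train_weight_def using gnz tnz by (simp add: field_simps)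
  also have "\<dots> = (\<Prod>j=1..L. \<sigma> j (i j) * lam j (\<pi> j (i j)))"
    unfolding prod.distrib[symmetric] by (intro prod.cong refl) (simp add: b_def t_def)
  finally show ?thesis .
qed

text \<open>The rescaling ambiguity is genuine: the tensor itself does not see it.\<close>

lemma tensor_train_rescale:
  assumes "(\<Prod>j=1..L. c j) = 1"
  shows "tensor_train L r (\<lambda>j i. c j * lam j i) x = tensor_train L r lam x"
  unfolding tensor_train_def prod.distrib assms by simp

section \<open>The two passes\<close>

lemma signed_permE:
  assumes "signed_perm s y ys"
  obtains \<pi> \<sigma> where "length ys = s" "\<pi> permutes {..<s}" "\<And>i. i < s \<Longrightarrow> \<pi> i < s"
    "\<And>i. i < s \<Longrightarrow> \<sigma> i \<in> {1, - 1 :: real}" "\<And>i. i < s \<Longrightarrow> ys ! i = \<sigma> i \<cdot>\<^sub>v y (\<pi> i)"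
proof -
  obtain \<pi> \<sigma> where *: "length ys = s" "\<pi> permutes {..<s}"
    "\<forall>i<s. \<sigma> i \<in> {1, - 1 :: real} \<and> ys ! i = \<sigma> i \<cdot>\<^sub>v y (\<pi> i)"
    using assms unfolding signed_perm_def by blast
  have "\<pi> i < s" if "i < s" for i using permutes_in_image[OF *(2), of i] that by simp
  then show ?thesis using that * by blast
qed

text \<open>Each \<open>x p\<close> enters \<open>T\<close> twice, in a Gram entry and in an outer
  product, so its sign cancels and \<open>T\<close> has the same form for the permuted, signed list;
  \<open>\<alpha>\<close> is permuted, \<open>B\<close> permuted and signed.\<close>

lemma kc_step_signed_perm:
  assumes xs: "signed_perm r x xs" and x: "orthonormal n r x" and rn: "r \<le> n"
    and y: "orthonormal n s y" and s: "1 \<le> s"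
    and \<alpha>: "\<And>p. p < r \<Longrightarrow> \<alpha> p \<noteq> 0"
    and \<beta>: "\<And>k. k < s \<Longrightarrow> \<beta> k \<noteq> 0" "inj_on \<beta> {..<s}"
    and nz: "\<And>p q. p < r \<Longrightarrow> q < r \<Longrightarrow> p \<noteq> q \<Longrightarrow>
      (\<Sum>k<s. \<beta> k * (x p \<bullet> y k) * (x q \<bullet> y k)) \<noteq> 0"
    and B: "\<And>j j'. j < s \<Longrightarrow> j' < s \<Longrightarrow> (\<Sum>p<r. B j p * (x p \<bullet> y j')) = (if j = j' then 1 else 0)"
    and T: "T = mat n n (\<lambda>(a, b). \<Sum>p<r. \<Sum>k<s. \<alpha> p * (x p \<bullet> y k) * \<beta> k * (x p $ a * y k $ b))"
  shows "\<exists>ys. kc_step n T xs ys" and "kc_step n T xs ys \<Longrightarrow> signed_perm s y ys"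
proof -
  obtain \<pi> \<sigma> where \<pi>: "length xs = r" "\<pi> permutes {..<r}" "\<And>i. i < r \<Longrightarrow> \<pi> i < r"
    and \<sigma>: "\<And>i. i < r \<Longrightarrow> \<sigma> i \<in> {1, - 1 :: real}" "\<And>i. i < r \<Longrightarrow> xs ! i = \<sigma> i \<cdot>\<^sub>v x (\<pi> i)"
    by (rule signed_permE[OF xs]) blast
  have xc: "x p \<in> carrier_vec n" if "p < r" for p using x that by (simp add: orthonormal_def)
  have yc: "y k \<in> carrier_vec n" if "k < s" for k using y that by (simp add: orthonormal_def)
  have \<sigma>2: "\<sigma> i * \<sigma> i = 1" if "i < r" for i using \<sigma>(1)[OF that] by auto
  have \<sigma>3: "\<sigma> i * (\<sigma> i * c) = c" if "i < r" for i c using \<sigma>2[OF that] by (simp flip: mult.assoc)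
  have xy: "xs ! p \<bullet> y k = \<sigma> p * (x (\<pi> p) \<bullet> y k)" if "p < r" "k < s" for p k
    unfolding \<sigma>(2)[OF that(1)] using xc[OF \<pi>(3)[OF that(1)]] yc[OF that(2)] by simp
  have inj: "\<pi> p = \<pi> q \<longleftrightarrow> p = q" for p q using permutes_inj[OF \<pi>(2)] by (auto dest: injD)
  have xx: "xs ! p \<bullet> xs ! q = (if p = q then 1 else 0)" if "p < r" "q < r" for p q
  proof -
    have "xs ! p \<bullet> xs ! q = \<sigma> p * (\<sigma> q * (x (\<pi> p) \<bullet> x (\<pi> q)))"
      unfolding \<sigma>(2)[OF that(1)] \<sigma>(2)[OF that(2)]
      using xc[OF \<pi>(3)[OF that(1)]] xc[OF \<pi>(3)[OF that(2)]] by simp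
    then show ?thesis using x \<pi>(3)[OF that(1)] \<pi>(3)[OF that(2)] \<sigma>2[OF that(1)] inj[of p q]
      by (auto simp: orthonormal_def)
  qed
  have on: "orthonormal_list n xs"
    unfolding orthonormal_list_def \<pi>(1)
  proof (intro conjI subsetI allI impI)
    fix v assume "v \<in> set xs"
    then obtain i where "i < r" "v = xs ! i" using \<pi>(1) by (auto simp: in_set_conv_nth)
    then show "v \<in> carrier_vec n" using \<sigma>(2) xc \<pi>(3) by simp
  qed (rule xx)
  have perm: "(\<Sum>p<r. F (\<pi> p)) = (\<Sum>p<r. F p)" for F :: "nat \<Rightarrow> real"
    using sum.permute[OF \<pi>(2), of F] by (simp add: comp_def)
  have nz': "(\<Sum>k<s. \<beta> k * (xs ! p \<bullet> y k) * (xs ! q \<bullet> y k)) \<noteq> 0"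
    if "p < length xs" "q < length xs" "p \<noteq> q" for p q
  proof -
    have pq: "p < r" "q < r" using that \<pi>(1) by simp_all
    have "(\<Sum>k<s. \<beta> k * (xs ! p \<bullet> y k) * (xs ! q \<bullet> y k)) =
        (\<Sum>k<s. \<sigma> p * \<sigma> q * (\<beta> k * (x (\<pi> p) \<bullet> y k) * (x (\<pi> q) \<bullet> y k)))"
      by (intro sum.cong refl) (simp add: xy[OF pq(1)] xy[OF pq(2)] mult_ac)
    also have "\<dots> = \<sigma> p * \<sigma> q * (\<Sum>k<s. \<beta> k * (x (\<pi> p) \<bullet> y k) * (x (\<pi> q) \<bullet> y k))"
      by (simp only: sum_distrib_left)
    also have "\<dots> \<noteq> 0"
      using nz[OF \<pi>(3)[OF pq(1)] \<pi>(3)[OF pq(2)]] inj[of p q] that(3) \<sigma>(1)[OF pq(1)] \<sigma>(1)[OF pq(2)]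
      by auto
    finally show ?thesis .
  qed
  have B': "(\<Sum>p<length xs. (\<sigma> p * B j (\<pi> p)) * (xs ! p \<bullet> y j')) = (if j = j' then 1 else 0)"
    if "j < s" "j' < s" for j j'
  proof -
    have "(\<Sum>p<length xs. (\<sigma> p * B j (\<pi> p)) * (xs ! p \<bullet> y j')) =
        (\<Sum>p<r. B j (\<pi> p) * (x (\<pi> p) \<bullet> y j'))"
      unfolding \<pi>(1) using that by (intro sum.cong refl) (simp add: xy \<sigma>3 mult.left_commute mult.assoc)
    also have "\<dots> = (\<Sum>p<r. B j p * (x p \<bullet> y j'))" by (rule perm)
    finally show ?thesis using B[OF that] by simp
  qed
  have T': "T = mat n n (\<lambda>(a, b). \<Sum>p<length xs. \<Sum>k<s.
      \<alpha> (\<pi> p) * (xs ! p \<bullet> y k) * \<beta> k * (xs ! p $ a * y k $ b))"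
    unfolding T
  proof (intro cong_mat refl, clarify)
    fix a b assume ab: "a < n" "b < n"
    have "(\<Sum>p<length xs. \<Sum>k<s. \<alpha> (\<pi> p) * (xs ! p \<bullet> y k) * \<beta> k * (xs ! p $ a * y k $ b)) =
       (\<Sum>p<r. \<Sum>k<s. \<alpha> (\<pi> p) * (x (\<pi> p) \<bullet> y k) * \<beta> k * (x (\<pi> p) $ a * y k $ b))"
      unfolding \<pi>(1)
    proof (intro sum.cong refl)
      fix p k assume "p \<in> {..<r}" "k \<in> {..<s}"
      then have pk: "p < r" "k < s" by simp_all
      have "xs ! p $ a = \<sigma> p * x (\<pi> p) $ a"
        unfolding \<sigma>(2)[OF pk(1)] using xc[OF \<pi>(3)[OF pk(1)]] ab by simp
      then show "\<alpha> (\<pi> p) * (xs ! p \<bullet> y k) * \<beta> k * (xs ! p $ a * y k $ b) =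
          \<alpha> (\<pi> p) * (x (\<pi> p) \<bullet> y k) * \<beta> k * (x (\<pi> p) $ a * y k $ b)"
        using \<sigma>3[OF pk(1)] by (simp add: xy[OF pk] mult.left_commute mult.assoc)
    qed
    also have "\<dots> = (\<Sum>p<r. \<Sum>k<s. \<alpha> p * (x p \<bullet> y k) * \<beta> k * (x p $ a * y k $ b))"
      by (rule perm)
    finally show "(\<Sum>p<r. \<Sum>k<s. \<alpha> p * (x p \<bullet> y k) * \<beta> k * (x p $ a * y k $ b)) =
      (\<Sum>p<length xs. \<Sum>k<s. \<alpha> (\<pi> p) * (xs ! p \<bullet> y k) * \<beta> k * (xs ! p $ a * y k $ b))" by simp
  qed
  have len: "length xs \<le> n" using \<pi>(1) rn by simp
  have \<alpha>': "\<alpha> (\<pi> p) \<noteq> 0" if "p < length xs" for p using \<alpha> \<pi> that by simp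
  show "\<exists>ys. kc_step n T xs ys"
    by (rule kc_step_recovers(1)[OF on len y s \<alpha>' \<beta> nz' B' T'])
  show "kc_step n T xs ys \<Longrightarrow> signed_perm s y ys"
    by (rule kc_step_recovers(2)[OF on len y s \<alpha>' \<beta> nz' B' T'])
qed

section \<open>Transitions of a pass\<close>

lemma kc_next_total: "\<exists>new. kc_next n T prev new"
  unfolding kc_next_def by auto

text \<open>The stopping rule keeps lists from growing even where the step is not known to be
  correct; beyond the minimal rank this bound is what the comparison of the passes rests on.\<close>

lemma kc_next_length: "kc_next n T prev new \<Longrightarrow> length new \<le> length prev"
  by (auto simp: kc_next_def split: if_splits)

text \<open>Since the correct number of vectors does not exceed the previous one, the stopping rule
  does not fire.\<close>

lemma kc_next_signed_perm:
  assumes "kc_next n T prev new" "\<exists>ys. kc_step n T prev ys" "prev \<noteq> []"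
    "\<And>ys. kc_step n T prev ys \<Longrightarrow> signed_perm s y ys" "s \<le> length prev"
  shows "signed_perm s y new"
proof -
  obtain ys where ys: "kc_step n T prev ys" "new = (if length ys > length prev then [] else ys)"
    using assms(1,2,3) unfolding kc_next_def by auto
  from assms(4)[OF ys(1)] have s: "signed_perm s y ys" .
  then have "length ys = s" by (simp add: signed_perm_def)
  then show ?thesis using ys(2) assms(5) s by simp
qed

text \<open>What the passes ask of a direction: the weights are nonzero and distinct, which gives
  simple nonzero eigenvalues, and the sums in the last two clauses are, up to nonzero row factors,
  the off-diagonal entries from which the rescaling is read off.\<close>

definition generic_direction ::
    "nat \<Rightarrow> nat \<Rightarrow> (nat \<Rightarrow> nat) \<Rightarrow> (nat \<Rightarrow> nat \<Rightarrow> real) \<Rightarrow> (nat \<Rightarrow> nat \<Rightarrow> real vec) \<Rightarrow> real vec \<Rightarrow> bool" where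
  "generic_direction n L r lam x v \<longleftrightarrow> v \<in> carrier_vec n \<and>
    (\<forall>j\<in>{1..L}. \<forall>p<r j. left_sum r lam x v j p \<noteq> 0 \<and> right_sum L r lam x v j p \<noteq> 0) \<and>
    (\<forall>j\<in>{1..L}. inj_on (left_sum r lam x v j) {..<r j} \<and> inj_on (right_sum L r lam x v j) {..<r j}) \<and>
    (\<forall>j\<in>{1..<L}. \<forall>p<r j. \<forall>q<r j. p \<noteq> q \<longrightarrow>
      (\<Sum>k<r (j + 1). right_sum L r lam x v (j + 1) k * (x j p \<bullet> x (j + 1) k) * (x j q \<bullet> x (j + 1) k)) \<noteq> 0) \<and>
    (\<forall>j\<in>{1..<L}. \<forall>p<r (j + 1). \<forall>q<r (j + 1). p \<noteq> q \<longrightarrow>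
      (\<Sum>k<r j. left_sum r lam x v j k * (x (j + 1) p \<bullet> x j k) * (x (j + 1) q \<bullet> x j k)) \<noteq> 0)"

lemma generic_directionD:
  assumes "generic_direction n L r lam x v"
  shows "v \<in> carrier_vec n"
    and "j \<in> {1..L} \<Longrightarrow> p < r j \<Longrightarrow> left_sum r lam x v j p \<noteq> 0"
    and "j \<in> {1..L} \<Longrightarrow> p < r j \<Longrightarrow> right_sum L r lam x v j p \<noteq> 0"
    and "j \<in> {1..L} \<Longrightarrow> inj_on (left_sum r lam x v j) {..<r j}"
    and "j \<in> {1..L} \<Longrightarrow> inj_on (right_sum L r lam x v j) {..<r j}"
    and "j \<in> {1..<L} \<Longrightarrow> p < r j \<Longrightarrow> q < r j \<Longrightarrow> p \<noteq> q \<Longrightarrow>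
      (\<Sum>k<r (j + 1). right_sum L r lam x v (j + 1) k * (x j p \<bullet> x (j + 1) k) * (x j q \<bullet> x (j + 1) k)) \<noteq> 0"
    and "j \<in> {1..<L} \<Longrightarrow> p < r (j + 1) \<Longrightarrow> q < r (j + 1) \<Longrightarrow> p \<noteq> q \<Longrightarrow>
      (\<Sum>k<r j. left_sum r lam x v j k * (x (j + 1) p \<bullet> x j k) * (x (j + 1) q \<bullet> x j k)) \<noteq> 0"
  using assms unfolding generic_direction_def by simp_all

text \<open>The part of genericity in which no direction occurs. An inverse of the Gram matrix at a
  bond is demanded only for the direction in which the ranks do not increase.\<close>

locale generic_train =
  fixes n L :: nat and r :: "nat \<Rightarrow> nat" and lam :: "nat \<Rightarrow> nat \<Rightarrow> real"
    and x :: "nat \<Rightarrow> nat \<Rightarrow> real vec"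
  assumes L: "1 \<le> L"
    and ranks: "\<And>j. j \<in> {1..L} \<Longrightarrow> 1 \<le> r j \<and> r j \<le> n"
    and orthonormal: "\<And>j. j \<in> {1..L} \<Longrightarrow> orthonormal n (r j) (x j)"
    and gram: "\<And>k p q. k \<in> {1..<L} \<Longrightarrow> p < r k \<Longrightarrow> q < r (k + 1) \<Longrightarrow> x k p \<bullet> x (k + 1) q \<noteq> 0"
    and left_inverse: "\<And>k. k \<in> {1..<L} \<Longrightarrow> r (k + 1) \<le> r k \<Longrightarrow> \<exists>B. \<forall>i<r (k + 1). \<forall>i'<r (k + 1).
      (\<Sum>p<r k. B i p * (x k p \<bullet> x (k + 1) i')) = (if i = i' then 1 else (0 :: real))"
    and right_inverse: "\<And>k. k \<in> {1..<L} \<Longrightarrow> r k \<le> r (k + 1) \<Longrightarrow> \<exists>B. \<forall>i<r k. \<forall>i'<r k.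
      (\<Sum>p<r (k + 1). B i p * (x (k + 1) p \<bullet> x k i')) = (if i = i' then 1 else (0 :: real))"
begin

abbreviation "T \<equiv> tensor_train L r lam x"

text \<open>Here \<open>left_sum\<close> at carriage \<open>k\<close> is the \<open>\<alpha>\<close>
  and \<open>right_sum\<close> at carriage \<open>k + 1\<close> the \<open>\<beta>\<close> of the
  step. The rank condition supplies the left inverse and also prevents the pass from
  stopping.\<close>

lemma left_right_step:
  assumes k: "k \<in> {1..<L}" "r (k + 1) \<le> r k" and v: "generic_direction n L r lam x v"
    and xs: "signed_perm (r k) (x k) xs"
    and new: "kc_next n (contract n (L + 2) T (k + 1) (k + 2) v) xs new"
  shows "signed_perm (r (k + 1)) (x (k + 1)) new"
proof -
  have k': "k \<in> {1..L}" "k + 1 \<in> {1..L}" "1 \<le> k" "k < L" using k by auto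
  obtain B where B: "\<And>i i'. i < r (k + 1) \<Longrightarrow> i' < r (k + 1) \<Longrightarrow>
      (\<Sum>p<r k. B i p * (x k p \<bullet> x (k + 1) i')) = (if i = i' then 1 else (0 :: real))"
    using left_inverse[OF k] by blast
  have rk: "r k \<le> n" "1 \<le> r (k + 1)" "1 \<le> r k" using ranks k' by auto
  note vD = generic_directionD[OF v]
  note step = kc_step_signed_perm[OF xs orthonormal[OF k'(1)] rk(1) orthonormal[OF k'(2)] rk(2)
      vD(2)[OF k'(1)] vD(3)[OF k'(2)] vD(5)[OF k'(2)] vD(6)[OF k(1)] B
      contract_middle[OF k'(3,4) vD(1)]]
  have len: "length xs = r k" using xs by (simp add: signed_perm_def)
  show ?thesis
    by (rule kc_next_signed_perm[OF new step(1) _ step(2)]) (use len rk(3) k(2) in auto)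
qed

text \<open>Transposition exchanges the two factors of the contraction, so the step applies with the
  roles of \<open>left_sum\<close> and \<open>right_sum\<close> swapped.\<close>

lemma right_left_step:
  assumes k: "k \<in> {1..<L}" "r k \<le> r (k + 1)" and v: "generic_direction n L r lam x v"
    and xs: "signed_perm (r (k + 1)) (x (k + 1)) xs"
    and new: "kc_next n (transpose_mat (contract n (L + 2) T (k + 1) (k + 2) v)) xs new"
  shows "signed_perm (r k) (x k) new"
proof -
  have k': "k \<in> {1..L}" "k + 1 \<in> {1..L}" "1 \<le> k" "k < L" using k by auto
  obtain B where B: "\<And>i i'. i < r k \<Longrightarrow> i' < r k \<Longrightarrow>
      (\<Sum>p<r (k + 1). B i p * (x (k + 1) p \<bullet> x k i')) = (if i = i' then 1 else (0 :: real))"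
    using right_inverse[OF k] by blast
  have rk: "r (k + 1) \<le> n" "1 \<le> r k" "1 \<le> r (k + 1)" using ranks k' by auto
  note vD = generic_directionD[OF v]
  have comm: "x k p \<bullet> x (k + 1) q = x (k + 1) q \<bullet> x k p" if "p < r k" "q < r (k + 1)" for p q
    using orthonormal[OF k'(1)] orthonormal[OF k'(2)] that
    by (intro comm_scalar_prod[of _ n]) (auto simp: orthonormal_def)
  have "transpose_mat (contract n (L + 2) T (k + 1) (k + 2) v) = mat n n (\<lambda>(a, b).
    \<Sum>q<r (k + 1). \<Sum>p<r k. right_sum L r lam x v (k + 1) q * (x (k + 1) q \<bullet> x k p) *
      left_sum r lam x v k p * (x (k + 1) q $ a * x k p $ b))" (is "_ = ?M")
  proof (rule eq_matI)
    fix a b assume "a < dim_row ?M" "b < dim_col ?M"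
    then have ab: "a < n" "b < n" by simp_all
    have "transpose_mat (contract n (L + 2) T (k + 1) (k + 2) v) $$ (a, b) =
       (\<Sum>p<r k. \<Sum>q<r (k + 1). left_sum r lam x v k p * (x k p \<bullet> x (k + 1) q) *
         right_sum L r lam x v (k + 1) q * (x k p $ b * x (k + 1) q $ a))"
      unfolding contract_middle[OF k'(3,4) vD(1)] using ab by simp
    also have "\<dots> = (\<Sum>q<r (k + 1). \<Sum>p<r k. left_sum r lam x v k p * (x k p \<bullet> x (k + 1) q) *
         right_sum L r lam x v (k + 1) q * (x k p $ b * x (k + 1) q $ a))" by (rule sum.swap)
    also have "\<dots> = ?M $$ (a, b)"
      using ab by (simp del: One_nat_def add: comm mult_ac)
    finally show "transpose_mat (contract n (L + 2) T (k + 1) (k + 2) v) $$ (a, b) = ?M $$ (a, b)" .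
  qed (simp_all add: contract_def)
  note step = kc_step_signed_perm[OF xs orthonormal[OF k'(2)] rk(1) orthonormal[OF k'(1)] rk(2)
      vD(3)[OF k'(2)] vD(2)[OF k'(1)] vD(4)[OF k'(1)] vD(7)[OF k(1)] B this]
  have len: "length xs = r (k + 1)" using xs by (simp add: signed_perm_def)
  show ?thesis
    by (rule kc_next_signed_perm[OF new step(1) _ step(2)]) (use len rk(3) k(2) in auto)
qed

text \<open>The condition \<open>j = 1 \<or> j < L\<close> is the range of the pass: carriage 1 is
  always treated, even if it is the last one, while otherwise carriage \<open>L\<close> is left to
  the opposite pass.\<close>

lemma left_right_pass_recovers:
  assumes X: "left_right_pass n L T v X" and v: "\<And>j. generic_direction n L r lam x (v j)"
    and j: "1 \<le> j" "j = 1 \<or> j < L" "antimono_on {1..j} r"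
  shows "signed_perm (r j) (x j) (X j)"
  using j
proof (induction j rule: dec_induct)
  case base
  have L1: "1 \<in> {1..L}" using L by simp
  note vD = generic_directionD[OF v[of 1]]
  have "unit_eigenvectors n (contract n (L + 2) T 1 2 (v 1)) (X 1)"
    using X unfolding left_right_pass_def by blast
  note X1 = this[unfolded contract_first[OF L vD(1)]]
  show ?case
    by (rule unit_eigenvectors_outer_sum[OF orthonormal[OF L1] vD(5)[OF L1] _ X1]) (rule vD(3)[OF L1])
next
  case (step j)
  then have j: "j \<in> {1..<L}" "Suc j \<in> {2..<L}" by auto
  have "antimono_on {1..j} r" using step.prems(2) by (rule monotone_on_subset) auto
  then have "signed_perm (r j) (x j) (X j)" using step j by simp
  moreover have "r (j + 1) \<le> r j"
    using monotone_onD[OF step.prems(2), of j "Suc j"] step.hyps by simp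
  moreover have "kc_next n (contract n (L + 2) T (j + 1) (j + 2) (v (Suc j))) (X j) (X (j + 1))"
  proof -
    have "kc_next n (contract n (L + 2) T (Suc j) (Suc j + 1) (v (Suc j))) (X (Suc j - 1)) (X (Suc j))"
      using X j(2) unfolding left_right_pass_def by blast
    then show ?thesis by simp
  qed
  ultimately show ?case using left_right_step[OF j(1) _ v] by simp
qed

text \<open>The mirror image, where the pass starts at carriage \<open>L\<close> and ends before
  carriage 1.\<close>

lemma right_left_pass_recovers:
  assumes Z: "right_left_pass n L T v Z" and v: "\<And>j. generic_direction n L r lam x (v j)"
    and j: "j \<le> L" "j = L \<or> 2 \<le> j" "mono_on {j..L} r"
  shows "signed_perm (r j) (x j) (Z j)"
  using j
proof (induction j rule: inc_induct)
  case base
  have L1: "L \<in> {1..L}" using L by simp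
  note vD = generic_directionD[OF v[of L]]
  have "unit_eigenvectors n (contract n (L + 2) T (L + 1) (L + 2) (v L)) (Z L)"
    using Z unfolding right_left_pass_def by blast
  note ZL = this[unfolded contract_last[OF L vD(1)]]
  show ?case
    by (rule unit_eigenvectors_outer_sum[OF orthonormal[OF L1] vD(4)[OF L1] _ ZL]) (rule vD(2)[OF L1])
next
  case (step j)
  then have j: "j \<in> {1..<L}" "j \<in> {2..<L}" by auto
  have "mono_on {Suc j..L} r" using step.prems(2) by (rule monotone_on_subset) auto
  then have "signed_perm (r (j + 1)) (x (j + 1)) (Z (j + 1))" using step j by simp
  moreover have "r j \<le> r (j + 1)"
    using monotone_onD[OF step.prems(2), of j "Suc j"] step.hyps by simp
  moreover have "kc_next n (transpose_mat (contract n (L + 2) T (j + 1) (j + 2) (v j))) (Z (j + 1)) (Z j)"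
    using Z j(2) unfolding right_left_pass_def by blast
  ultimately show ?case using right_left_step[OF j(1) _ v] by simp
qed

lemma left_right_pass_length:
  assumes X: "left_right_pass n L T v X" and ij: "1 \<le> i" "i \<le> j" "j < L"
  shows "length (X j) \<le> length (X i)"
  using ij(2,3)
proof (induction j rule: dec_induct)
  case (step j)
  then have "Suc j \<in> {2..<L}" using ij(1) by auto
  then have "length (X (Suc j)) \<le> length (X j)"
    using X kc_next_length unfolding left_right_pass_def by (metis diff_Suc_1)
  then show ?case using step by simp
qed simp

lemma right_left_pass_length:
  assumes Z: "right_left_pass n L T v Z" and ij: "2 \<le> j" "j \<le> i" "i \<le> L"
  shows "length (Z j) \<le> length (Z i)"
  using ij(2,1)
proof (induction j rule: inc_induct)
  case (step j)
  then have "j \<in> {2..<L}" using ij(3) by auto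
  then have "length (Z j) \<le> length (Z (Suc j))"
    using Z kc_next_length unfolding right_left_pass_def by (metis Suc_eq_plus1)
  then show ?case using step by simp
qed simp

section \<open>Existence of runs of the two passes\<close>

lemma left_right_pass_exists:
  assumes v: "generic_direction n L r lam x (v 1)"
  shows "\<exists>X. left_right_pass n L T v X"
proof -
  let ?M = "\<lambda>j. contract n (L + 2) T j (j + 1) (v j)"
  \<comment> \<open>The lists are chosen one after the other, which \<open>kc_next_total\<close>
    permits. Entry 0 is a dummy, and the first step of the recursion produces the list of carriage
    1.\<close>
  define X where "X = rec_nat [] (\<lambda>j prev. if j = 0 then map (x 1) [0..<r 1]
    else SOME new. kc_next n (?M (Suc j)) prev new)"
  have X1: "X 1 = map (x 1) [0..<r 1]" by (simp add: X_def)
  have XS: "X (Suc j) = (SOME new. kc_next n (?M (Suc j)) (X j) new)" if "j \<noteq> 0" for j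
    using that by (simp add: X_def)
  have L1: "1 \<in> {1..L}" using L by simp
  note vD = generic_directionD[OF v]
  have "unit_eigenvectors n (contract n (L + 2) T 1 2 (v 1)) (X 1)"
    unfolding X1 contract_first[OF L vD(1)]
    by (rule unit_eigenvectors_outer_sum_basis[OF orthonormal[OF L1] vD(5)[OF L1] vD(3)[OF L1]])
  moreover have "kc_next n (?M j) (X (j - 1)) (X j)" if "j \<in> {2..<L}" for j
  proof -
    have i: "j - 1 \<noteq> 0" "Suc (j - 1) = j" using that by auto
    show ?thesis unfolding XS[OF i(1), unfolded i(2)]
      by (rule someI_ex) (rule kc_next_total)
  qed
  ultimately show ?thesis unfolding left_right_pass_def by blast
qed

lemma right_left_pass_exists:
  assumes v: "generic_direction n L r lam x (v L)"
  shows "\<exists>Z. right_left_pass n L T v Z"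
proof -
  let ?M = "\<lambda>j. transpose_mat (contract n (L + 2) T (j + 1) (j + 2) (v j))"
  \<comment> \<open>Indexed by the distance from the right end: \<open>W i\<close> is the list of
    carriage \<open>L - i\<close>.\<close>
  define W where "W = rec_nat (map (x L) [0..<r L])
    (\<lambda>i prev. SOME new. kc_next n (?M (L - Suc i)) prev new)"
  have W0: "W 0 = map (x L) [0..<r L]" by (simp add: W_def)
  have WS: "W (Suc i) = (SOME new. kc_next n (?M (L - Suc i)) (W i) new)" for i
    by (simp add: W_def)
  have L1: "L \<in> {1..L}" using L by simp
  note vD = generic_directionD[OF v]
  have "unit_eigenvectors n (contract n (L + 2) T (L + 1) (L + 2) (v L)) (W (L - L))"
    unfolding diff_self_eq_0 W0 contract_last[OF L vD(1)]
    by (rule unit_eigenvectors_outer_sum_basis[OF orthonormal[OF L1] vD(4)[OF L1] vD(2)[OF L1]])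
  moreover have "kc_next n (?M j) (W (L - (j + 1))) (W (L - j))" if "j \<in> {2..<L}" for j
  proof -
    have i: "L - j = Suc (L - (j + 1))" "L - Suc (L - (j + 1)) = j" using that by auto
    show ?thesis unfolding i(1) WS i(2)
      by (rule someI_ex) (rule kc_next_total)
  qed
  ultimately show ?thesis unfolding right_left_pass_def by (intro exI[of _ "\<lambda>j. W (L - j)"]) blast
qed

text \<open>
  The list of a carriage on the wrong side of the minimum either is correct as well, or it is
  shorter than the one of the other pass, because it is no longer than the one at the minimum.
\<close>

lemma kc_vectors_recovers:
  assumes dec: "decreasing_ranks L r"
    and v: "\<And>j. generic_direction n L r lam x (v j)" and w: "\<And>j. generic_direction n L r lam x (w j)"
    and y: "kc_vectors n L T v w y" and j: "j \<in> {1..L}"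
  shows "signed_perm (r j) (x j) (y j)"
proof -
  obtain X Z where X: "left_right_pass n L T v X" and Z: "right_left_pass n L T w Z"
    and y1: "y 1 = X 1" and yL: "L \<ge> 2 \<Longrightarrow> y L = Z L"
    and ym: "\<And>j. j \<in> {2..<L} \<Longrightarrow> y j = X j \<and> length (Z j) \<le> length (X j) \<or>
                      y j = Z j \<and> length (X j) \<le> length (Z j)"
    using y unfolding kc_vectors_def by blast
  obtain m where m: "m \<in> {1..L}" "antimono_on {1..m} r" "mono_on {m..L} r"
    using dec unfolding decreasing_ranks_def by blast
  note LR = left_right_pass_recovers[OF X v] and RL = right_left_pass_recovers[OF Z w]
  have len: "length ys = s" if "signed_perm s u ys" for s u ys using that by (simp add: signed_perm_def)
  consider "j = 1" | "j = L" "2 \<le> L" | "j \<in> {2..<L}" using j by force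
  then show ?thesis
  proof cases
    case 1
    have "antimono_on {1..1} r" by (simp add: monotone_on_def)
    then show ?thesis using LR[of 1] y1 1 by simp
  next
    case 2
    have "mono_on {L..L} r" by (simp add: monotone_on_def)
    then show ?thesis using RL[of L] yL 2 by simp
  next
    case 3
    show ?thesis
    proof (cases "j \<le> m")
      case True
      have "antimono_on {1..j} r" using m(2) True by (auto intro: monotone_on_subset)
      then have Xj: "signed_perm (r j) (x j) (X j)" using LR[of j] 3 by simp
      have "signed_perm (r j) (x j) (Z j)" if "length (X j) \<le> length (Z j)"
      proof -
        have "signed_perm (r m) (x m) (Z m)" using RL[of m] m 3 True by auto
        then have "length (Z j) \<le> r m" using right_left_pass_length[OF Z, of j m] 3 True m len by auto
        then have jm: "r j \<le> r m" using that len[OF Xj] by simp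
        \<comment> \<open>The ranks between \<open>j\<close> and \<open>m\<close> are squeezed
          between \<open>r m\<close> and \<open>r j\<close>, hence constant, so that they are
          nondecreasing from \<open>j\<close> on and the right-to-left result applies at
          \<open>j\<close>.\<close>
        have "r a = r m" if "a \<in> {j..m}" for a
        proof -
          have "r m \<le> r a" "r a \<le> r j" using monotone_onD[OF m(2), of a m] monotone_onD[OF m(2), of j a] that 3 True
            by auto
          then show ?thesis using jm by simp
        qed
        note const = this
        have "r a \<le> r b" if ab: "a \<in> {j..L}" "b \<in> {j..L}" "a \<le> b" for a b
        proof (cases "b \<le> m")
          case True
          then show ?thesis using const[of a] const[of b] ab by simp
        next
          case False
          then have "r (max a m) \<le> r b" using monotone_onD[OF m(3), of "max a m" b] ab m(1) by auto
          then show ?thesis using const[of a] ab by (cases "a \<le> m") (simp_all add: max_def)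
        qed
        then have "mono_on {j..L} r" by (auto simp: monotone_on_def)
        then show ?thesis using RL[of j] 3 by simp
      qed
      then show ?thesis using ym[OF 3] Xj by auto
    next
      case False
      then have mj: "m < j" by simp
      have "mono_on {j..L} r" using m(3) mj by (auto intro: monotone_on_subset)
      then have Zj: "signed_perm (r j) (x j) (Z j)" using RL[of j] 3 by simp
      have "signed_perm (r j) (x j) (X j)" if "length (Z j) \<le> length (X j)"
      proof -
        have "signed_perm (r m) (x m) (X m)" using LR[of m] m 3 mj by auto
        then have "length (X j) \<le> r m" using left_right_pass_length[OF X, of m j] 3 mj m len by auto
        then have jm: "r j \<le> r m" using that len[OF Zj] by simp
        have "r a = r m" if "a \<in> {m..j}" for a
        proof -
          have "r m \<le> r a" "r a \<le> r j" using monotone_onD[OF m(3), of m a] monotone_onD[OF m(3), of a j] that 3 mj m(1)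
            by auto
          then show ?thesis using jm by simp
        qed
        note const = this
        have "r b \<le> r a" if ab: "a \<in> {1..j}" "b \<in> {1..j}" "a \<le> b" for a b
        proof (cases "m \<le> a")
          case True
          then show ?thesis using const[of a] const[of b] ab by simp
        next
          case False
          then have "r (min b m) \<le> r a" using monotone_onD[OF m(2), of a "min b m"] ab m(1) by auto
          then show ?thesis using const[of b] ab by (cases "m \<le> b") (auto simp: min_def split: if_splits)
        qed
        then have "antimono_on {1..j} r" by (auto simp: monotone_on_def)
        then show ?thesis using LR[of j] 3 by simp
      qed
      then show ?thesis using ym[OF 3] Zj by auto
    qed
  qed
qed

lemma kc_vectors_exists:
  assumes "\<And>j. generic_direction n L r lam x (v j)" "\<And>j. generic_direction n L r lam x (w j)"
  shows "\<exists>y. kc_vectors n L T v w y"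
proof -
  obtain X Z where "left_right_pass n L T v X" "right_left_pass n L T w Z"
    using left_right_pass_exists right_left_pass_exists assms by blast
  then show ?thesis unfolding kc_vectors_def
    by (intro exI[of _ "\<lambda>j. if j = 1 then X 1 else if j = L then Z L
        else if length (Z j) \<le> length (X j) then X j else Z j"] exI[of _ X] exI[of _ Z]) auto
qed

end

section \<open>Alternating least squares for a tensor of rank one\<close>

lemma sum_midx_prod:
  "(\<Sum>i\<in>midx L N. \<Prod>j=1..L. f j (i j)) = (\<Prod>j=1..L. \<Sum>k<N j. f j k :: real)"
  unfolding midx_def by (subst prod_sum_PiE) auto

locale rank_one_tensor =
  fixes L :: nat and N :: "nat \<Rightarrow> nat" and \<mu> :: "nat \<Rightarrow> nat \<Rightarrow> real" and R :: tensor
  assumes N: "\<And>j. j \<in> {1..L} \<Longrightarrow> 1 \<le> N j"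
    and nonzero: "\<And>j k. j \<in> {1..L} \<Longrightarrow> k < N j \<Longrightarrow> \<mu> j k \<noteq> 0"
    and L: "1 \<le> L"
    and R: "\<And>i. i \<in> midx L N \<Longrightarrow> R i = (\<Prod>j=1..L. \<mu> j (i j))"
begin

definition overlap :: "(nat \<Rightarrow> real vec) \<Rightarrow> nat \<Rightarrow> real" where
  "overlap u j = (\<Sum>k<N j. \<mu> j k * u j $ k)"

definition norm2 :: "(nat \<Rightarrow> real vec) \<Rightarrow> nat \<Rightarrow> real" where
  "norm2 u j = (\<Sum>k<N j. (u j $ k)\<^sup>2)"

text \<open>With the other factors fixed, the least-squares solution in mode \<open>j\<close> is
  this multiple of \<open>\<mu> j\<close>.\<close>

definition factor :: "(nat \<Rightarrow> real vec) \<Rightarrow> nat \<Rightarrow> real" where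
  "factor u j = (\<Prod>j'\<in>{1..L} - {j}. overlap u j' / norm2 u j')"

text \<open>Nonzero overlaps exclude degenerate runs: they force positive norms, so that each
  least-squares problem has exactly one solution, and they make this solution nonzero.\<close>

definition admissible :: "(nat \<Rightarrow> real vec) \<Rightarrow> bool" where
  "admissible u \<longleftrightarrow> (\<forall>j\<in>{1..L}. dim_vec (u j) = N j \<and> overlap u j \<noteq> 0)"

definition best_update :: "nat \<Rightarrow> (nat \<Rightarrow> real vec) \<Rightarrow> (nat \<Rightarrow> real vec)" where
  "best_update j u = u(j := vec (N j) (\<lambda>k. factor u j * \<mu> j k))"

lemma norm2_pos:
  assumes "admissible u" "j \<in> {1..L}"
  shows "norm2 u j > 0"
proof -
  have "\<exists>k<N j. u j $ k \<noteq> 0"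
  proof (rule ccontr)
    assume "\<not> (\<exists>k<N j. u j $ k \<noteq> 0)"
    then have "overlap u j = 0" unfolding overlap_def by (intro sum.neutral) simp
    with assms show False by (simp add: admissible_def)
  qed
  then obtain k where "k < N j" "u j $ k \<noteq> 0" by blast
  then show ?thesis unfolding norm2_def by (intro sum_pos2[of _ k]) auto
qed

text \<open>As \<open>R\<close> is itself a product over the modes, the mixed sum and the sum of
  squares factor, and the error is an explicit quadratic function of \<open>w\<close>.\<close>

lemma rank1_error_update:
  assumes j: "j \<in> {1..L}"
  shows "rank1_error L N R (u(j := w)) = (\<Sum>i\<in>midx L N. (R i)\<^sup>2) -
    2 * (\<Prod>j'\<in>{1..L} - {j}. overlap u j') * (\<Sum>k<N j. \<mu> j k * w $ k) +
    (\<Prod>j'\<in>{1..L} - {j}. norm2 u j') * (\<Sum>k<N j. (w $ k)\<^sup>2)"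
proof -
  let ?u = "u(j := w)"
  have split: "(\<Prod>j'=1..L. F j') = F j * (\<Prod>j'\<in>{1..L} - {j}. F j')" for F :: "nat \<Rightarrow> real"
    using j by (intro prod.remove) auto
  have 1: "(\<Sum>i\<in>midx L N. R i * (\<Prod>j'=1..L. ?u j' $ i j')) =
      (\<Sum>k<N j. \<mu> j k * w $ k) * (\<Prod>j'\<in>{1..L} - {j}. overlap u j')"
  proof -
    have "(\<Sum>i\<in>midx L N. R i * (\<Prod>j'=1..L. ?u j' $ i j')) =
        (\<Sum>i\<in>midx L N. \<Prod>j'=1..L. \<mu> j' (i j') * ?u j' $ i j')"
      by (intro sum.cong refl) (simp only: R prod.distrib)
    also have "\<dots> = (\<Prod>j'=1..L. \<Sum>k<N j'. \<mu> j' k * ?u j' $ k)" by (rule sum_midx_prod)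
    also have "\<dots> = (\<Sum>k<N j. \<mu> j k * ?u j $ k) * (\<Prod>j'\<in>{1..L} - {j}. \<Sum>k<N j'. \<mu> j' k * ?u j' $ k)"
      by (rule split)
    finally show ?thesis by (simp add: overlap_def)
  qed
  have 2: "(\<Sum>i\<in>midx L N. (\<Prod>j'=1..L. ?u j' $ i j')\<^sup>2) =
      (\<Sum>k<N j. (w $ k)\<^sup>2) * (\<Prod>j'\<in>{1..L} - {j}. norm2 u j')"
  proof -
    have "(\<Sum>i\<in>midx L N. (\<Prod>j'=1..L. ?u j' $ i j')\<^sup>2) =
        (\<Sum>i\<in>midx L N. \<Prod>j'=1..L. (?u j' $ i j')\<^sup>2)"
      by (simp only: prod_power_distrib)
    also have "\<dots> = (\<Prod>j'=1..L. \<Sum>k<N j'. (?u j' $ k)\<^sup>2)" by (rule sum_midx_prod)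
    also have "\<dots> = (\<Sum>k<N j. (?u j $ k)\<^sup>2) * (\<Prod>j'\<in>{1..L} - {j}. \<Sum>k<N j'. (?u j' $ k)\<^sup>2)"
      by (rule split)
    finally show ?thesis by (simp add: norm2_def)
  qed
  have "rank1_error L N R ?u = (\<Sum>i\<in>midx L N. (R i)\<^sup>2 - 2 * (R i * (\<Prod>j'=1..L. ?u j' $ i j')) +
      (\<Prod>j'=1..L. ?u j' $ i j')\<^sup>2)"
    unfolding rank1_error_def by (intro sum.cong refl) (simp only: power2_diff mult.assoc algebra_simps)
  also have "\<dots> = (\<Sum>i\<in>midx L N. (R i)\<^sup>2) - 2 * (\<Sum>i\<in>midx L N. R i * (\<Prod>j'=1..L. ?u j' $ i j')) +
      (\<Sum>i\<in>midx L N. (\<Prod>j'=1..L. ?u j' $ i j')\<^sup>2)"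
    by (simp only: sum.distrib sum_subtractf sum_distrib_left)
  finally show ?thesis unfolding 1 2 by (simp only: mult_ac)
qed

text \<open>Completing the square: the error exceeds its value at the best update by a positive
  multiple of the squared distance to it, so the minimizer is unique.\<close>

lemma als_update_iff:
  assumes j: "j \<in> {1..L}" and u: "admissible u"
  shows "als_update L N R j u u' \<longleftrightarrow> u' = best_update j u"
proof -
  define C where "C = (\<Prod>j'\<in>{1..L} - {j}. overlap u j')"
  define D where "D = (\<Prod>j'\<in>{1..L} - {j}. norm2 u j')"
  have D: "D > 0" unfolding D_def using norm2_pos[OF u] by (intro prod_pos) auto
  have f: "factor u j = C / D" by (simp add: factor_def C_def D_def prod_dividef)
  let ?w = "vec (N j) (\<lambda>k. factor u j * \<mu> j k)"
  let ?E = "\<lambda>w. rank1_error L N R (u(j := w))"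
  have E: "?E w = ?E ?w + D * (\<Sum>k<N j. (w $ k - ?w $ k)\<^sup>2)" for w
  proof -
    define K where "K = (\<Sum>i\<in>midx L N. (R i)\<^sup>2)"
    have "?E w - ?E ?w = D * ((\<Sum>k<N j. (w $ k)\<^sup>2) - (\<Sum>k<N j. (?w $ k)\<^sup>2)) -
        2 * C * ((\<Sum>k<N j. \<mu> j k * w $ k) - (\<Sum>k<N j. \<mu> j k * ?w $ k))"
      unfolding rank1_error_update[OF j] C_def[symmetric] D_def[symmetric] by (simp only: algebra_simps)
    also have "\<dots> = (\<Sum>k<N j. D * ((w $ k)\<^sup>2 - (?w $ k)\<^sup>2) - 2 * C * (\<mu> j k * w $ k - \<mu> j k * ?w $ k))"
      by (simp only: sum_subtractf[symmetric] sum_distrib_left)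
    also have "\<dots> = (\<Sum>k<N j. D * (w $ k - ?w $ k)\<^sup>2)"
    proof (intro sum.cong refl)
      fix k assume "k \<in> {..<N j}"
      \<comment> \<open>The normal equation of the least-squares problem.\<close>
      then have "D * ?w $ k = C * \<mu> j k" using D by (simp add: f)
      then have "D * ((w $ k)\<^sup>2 - (?w $ k)\<^sup>2) - 2 * (C * \<mu> j k) * (w $ k - ?w $ k) = D * (w $ k - ?w $ k)\<^sup>2"
        by (simp only: flip: \<open>D * ?w $ k = C * \<mu> j k\<close>) (simp add: power2_eq_square algebra_simps)
      then show "D * ((w $ k)\<^sup>2 - (?w $ k)\<^sup>2) - 2 * C * (\<mu> j k * w $ k - \<mu> j k * ?w $ k) =
          D * (w $ k - ?w $ k)\<^sup>2" by (simp add: algebra_simps)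
    qed
    finally show ?thesis by (simp add: sum_distrib_left)
  qed
  have min: "?E ?w \<le> ?E w" for w unfolding E[of w] using D by (simp add: sum_nonneg)
  have "w = ?w" if w: "w \<in> carrier_vec (N j)" "?E w \<le> ?E ?w" for w
  proof -
    have "(\<Sum>k<N j. (w $ k - ?w $ k)\<^sup>2) \<le> 0" using w(2) D unfolding E[of w] by (simp add: mult_le_0_iff)
    moreover have "(\<Sum>k<N j. (w $ k - ?w $ k)\<^sup>2) \<ge> 0" by (intro sum_nonneg) simp
    ultimately have "(\<Sum>k<N j. (w $ k - ?w $ k)\<^sup>2) = 0" by linarith
    then have "\<forall>k<N j. w $ k = ?w $ k" by (subst (asm) sum_nonneg_eq_0_iff) auto
    then show ?thesis using w(1) by (intro eq_vecI) auto
  qed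
  moreover have "?w \<in> carrier_vec (N j)" by simp
  ultimately show ?thesis unfolding als_update_def best_update_def using min by blast
qed

text \<open>The new factor is a nonzero multiple of \<open>\<mu> j\<close>, so its overlap is a
  nonzero multiple of a positive sum of squares; the other overlaps are untouched.\<close>

lemma admissible_best_update:
  assumes j: "j \<in> {1..L}" and u: "admissible u"
  shows "admissible (best_update j u)" and "factor u j \<noteq> 0"
proof -
  have nz: "overlap u i / norm2 u i \<noteq> 0" if "i \<in> {1..L}" for i
    using norm2_pos[OF u that] u that by (auto simp: admissible_def)
  then show f: "factor u j \<noteq> 0" unfolding factor_def by auto
  have "overlap (best_update j u) j = factor u j * (\<Sum>k<N j. (\<mu> j k)\<^sup>2)"
    by (simp add: overlap_def best_update_def sum_distrib_left power2_eq_square mult_ac)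
  moreover have "(\<Sum>k<N j. (\<mu> j k)\<^sup>2) > 0"
    using N[OF j] nonzero[OF j] by (intro sum_pos) (auto simp: lessThan_empty_iff)
  ultimately have "overlap (best_update j u) j \<noteq> 0" using f by simp
  moreover have "overlap (best_update j u) i = overlap u i" if "i \<noteq> j" for i
    using that by (simp add: overlap_def best_update_def)
  ultimately show "admissible (best_update j u)"
    using u unfolding admissible_def by (metis best_update_def dim_vec fun_upd_apply)
qed

text \<open>One sweep is already exact: after update \<open>m\<close> the first \<open>m\<close>
  factors are multiples of the true ones, and the last update meets only such factors, which forces
  its constant to be the inverse of the product of the others.\<close>

lemma als_sweep_admissible:
  assumes u: "admissible u" and s: "als_sweep L N R u u'"
  shows "admissible u'"
    and "\<exists>c. (\<Prod>j=1..L. c j) = 1 \<and> (\<forall>j\<in>{1..L}. c j \<noteq> 0 \<and> (\<forall>k<N j. u' j $ k = c j * \<mu> j k))"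
proof -
  obtain U where U: "U 0 = u" "U L = u'" "\<And>j. j \<in> {1..L} \<Longrightarrow> als_update L N R j (U (j - 1)) (U j)"
    using s unfolding als_sweep_def by blast
  have inv: "m \<le> L \<Longrightarrow> admissible (U m) \<and> (\<exists>c. \<forall>j\<in>{1..m}. c j \<noteq> 0 \<and> (\<forall>k<N j. U m j $ k = c j * \<mu> j k))" for m
  proof (induction m)
    case 0
    then show ?case using u U(1) by simp
  next
    case (Suc m)
    then obtain c where a: "admissible (U m)"
      and c: "\<forall>j\<in>{1..m}. c j \<noteq> 0 \<and> (\<forall>k<N j. U m j $ k = c j * \<mu> j k)" by auto
    have m: "Suc m \<in> {1..L}" using Suc.prems by simp
    have US: "U (Suc m) = best_update (Suc m) (U m)"
      using U(3)[OF m] als_update_iff[OF m a] by simp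
    have "\<forall>j\<in>{1..Suc m}. (c(Suc m := factor (U m) (Suc m))) j \<noteq> 0 \<and>
        (\<forall>k<N j. U (Suc m) j $ k = (c(Suc m := factor (U m) (Suc m))) j * \<mu> j k)"
    proof
      fix j assume "j \<in> {1..Suc m}"
      then show "(c(Suc m := factor (U m) (Suc m))) j \<noteq> 0 \<and>
        (\<forall>k<N j. U (Suc m) j $ k = (c(Suc m := factor (U m) (Suc m))) j * \<mu> j k)"
        using c admissible_best_update(2)[OF m a]
        by (cases "j = Suc m") (auto simp: US best_update_def)
    qed
    then show ?case using admissible_best_update(1)[OF m a] US by auto
  qed
  show "admissible u'" using inv[of L] U(2) by simp
  define M where "M = L - 1"
  have LM: "L = Suc M" "M \<le> L" using L by (simp_all add: M_def)
  obtain c where a: "admissible (U M)"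
    and c: "\<forall>j\<in>{1..M}. c j \<noteq> 0 \<and> (\<forall>k<N j. U M j $ k = c j * \<mu> j k)"
    using inv[OF LM(2)] by blast
  have Lin: "L \<in> {1..L}" using L by simp
  have uL: "u' = best_update L (U M)"
    using U(2) U(3)[OF Lin] als_update_iff[OF Lin a] by (simp add: M_def)
  \<comment> \<open>Overlap and squared norm of \<open>c j\<close> times \<open>\<mu> j\<close> are
    \<open>c j * S\<close> and \<open>(c j)^2 * S\<close>.\<close>
  have "overlap (U M) j / norm2 (U M) j = 1 / c j" if j: "j \<in> {1..M}" for j
  proof -
    have jL: "j \<in> {1..L}" using j LM(1) by simp
    define S where "S = (\<Sum>k<N j. (\<mu> j k)\<^sup>2)"
    have "S > 0" unfolding S_def
      using N[OF jL] nonzero[OF jL] by (intro sum_pos) (auto simp: lessThan_empty_iff)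
    moreover have "overlap (U M) j = c j * S" "norm2 (U M) j = (c j)\<^sup>2 * S"
      using c j by (simp_all add: overlap_def norm2_def S_def sum_distrib_left power2_eq_square mult_ac)
    ultimately show ?thesis using c j by (simp add: power2_eq_square)
  qed
  moreover have "{1..L} - {L} = {1..M}" using LM(1) by auto
  ultimately have f: "factor (U M) L = (\<Prod>j=1..M. 1 / c j)" unfolding factor_def by simp
  let ?c = "c(L := factor (U M) L)"
  have "(\<Prod>j=1..L. ?c j) = factor (U M) L * (\<Prod>j=1..M. c j)"
    using LM(1) by (simp add: mult.commute)
  also have "\<dots> = (\<Prod>j=1..M. 1 / c j * c j)" unfolding f prod.distrib ..
  also have "\<dots> = 1" using c by (intro prod.neutral) simp
  finally have "(\<Prod>j=1..L. ?c j) = 1" .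
  moreover have "\<forall>j\<in>{1..L}. ?c j \<noteq> 0 \<and> (\<forall>k<N j. u' j $ k = ?c j * \<mu> j k)"
  proof
    fix j assume "j \<in> {1..L}"
    then have "j = L \<or> j \<in> {1..M} \<and> j \<noteq> L" using LM(1) by auto
    then show "?c j \<noteq> 0 \<and> (\<forall>k<N j. u' j $ k = ?c j * \<mu> j k)"
      using c admissible_best_update(2)[OF Lin a] unfolding uL by (auto simp: best_update_def)
  qed
  ultimately show "\<exists>c. (\<Prod>j=1..L. c j) = 1 \<and> (\<forall>j\<in>{1..L}. c j \<noteq> 0 \<and> (\<forall>k<N j. u' j $ k = c j * \<mu> j k))"
    by blast
qed

lemma als_sweep_exists:
  assumes u: "admissible u"
  shows "\<exists>u'. als_sweep L N R u u'"
proof -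
  define U where "U = rec_nat u (\<lambda>m. best_update (Suc m))"
  have U: "U 0 = u" "\<And>m. U (Suc m) = best_update (Suc m) (U m)" by (simp_all add: U_def)
  have a: "m \<le> L \<Longrightarrow> admissible (U m)" for m
    by (induction m) (simp_all add: U u admissible_best_update)
  have "als_update L N R j (U (j - 1)) (U j)" if j: "j \<in> {1..L}" for j
  proof -
    have "Suc (j - 1) = j" "admissible (U (j - 1))" using j a by auto
    then show ?thesis using als_update_iff[OF j] U(2)[of "j - 1"] by simp
  qed
  then show ?thesis unfolding als_sweep_def using U(1) by blast
qed

lemma als_result_admissible:
  assumes "als_result L N R u u'" "admissible u"
  shows "admissible u' \<and>
    (\<exists>c. (\<Prod>j=1..L. c j) = 1 \<and> (\<forall>j\<in>{1..L}. c j \<noteq> 0 \<and> (\<forall>k<N j. u' j $ k = c j * \<mu> j k)))"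
  using assms unfolding als_result_def
proof (induction rule: tranclp_induct)
  case (base u')
  then show ?case using als_sweep_admissible by blast
next
  case (step u' u'')
  then show ?case using als_sweep_admissible by blast
qed

lemma als_result_exists: "admissible u \<Longrightarrow> \<exists>u'. als_result L N R u u'"
  using als_sweep_exists unfolding als_result_def by blast

end

section \<open>Moves in the space of train parameters\<close>

lemma scalar_prod_self_eq_0:
  assumes "v \<in> carrier_vec n" "v \<bullet> v = (0 :: real)"
  shows "v = 0\<^sub>v n"
proof -
  have "(\<Sum>i<n. v $ i * v $ i) = 0" using assms by (simp add: scalar_prod_def atLeast0LessThan)
  then have "\<forall>i\<in>{..<n}. v $ i * v $ i = 0" by (subst (asm) sum_nonneg_eq_0_iff) auto
  then show ?thesis using assms(1) by (intro eq_vecI) auto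
qed

lemma scalar_prod_self_nonneg: "v \<bullet> v \<ge> (0 :: real)"
  by (simp add: scalar_prod_def sum_nonneg)

text \<open>The rational parametrization of the unit circle by the tangent of half the angle. Its
  denominator has no real zero, and it misses only the point \<open>(-1, 0)\<close>.\<close>

definition rcos :: "real \<Rightarrow> real" where "rcos t = (1 - t\<^sup>2) / (1 + t\<^sup>2)"
definition rsin :: "real \<Rightarrow> real" where "rsin t = 2 * t / (1 + t\<^sup>2)"

lemma rcos_rsin: "(rcos t)\<^sup>2 + (rsin t)\<^sup>2 = 1"
proof -
  have "1 + t\<^sup>2 > 0" by (simp add: add_pos_nonneg)
  then have "1 + t\<^sup>2 \<noteq> 0" by simp
  then have "(rcos t)\<^sup>2 + (rsin t)\<^sup>2 = ((1 - t\<^sup>2)\<^sup>2 + (2 * t)\<^sup>2) / (1 + t\<^sup>2)\<^sup>2"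
    by (simp add: rcos_def rsin_def power_divide add_divide_distrib)
  also have "(1 - t\<^sup>2)\<^sup>2 + (2 * t)\<^sup>2 = (1 + t\<^sup>2)\<^sup>2" by (simp add: power2_eq_square algebra_simps)
  finally show ?thesis using \<open>1 + t\<^sup>2 \<noteq> 0\<close> by simp
qed

lemma rational_fun_rcos: "rational_fun rcos" and rational_fun_rsin: "rational_fun rsin"
proof -
  have nz: "1 + t\<^sup>2 \<noteq> 0" for t :: real
  proof -
    have "1 + t\<^sup>2 > 0" by (simp add: add_pos_nonneg)
    then show ?thesis by simp
  qed
  have q: "poly [:1, 0, 1:] t = 1 + t\<^sup>2" "poly [:1, 0, - 1:] t = 1 - t\<^sup>2" "poly [:0, 2:] t = 2 * t" for t :: real
    by (simp_all add: power2_eq_square)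
  show "rational_fun rcos" unfolding rational_fun_def rcos_def
    by (intro exI[of _ "[:1, 0, - 1:]"] exI[of _ "[:1, 0, 1:]"] allI) (simp only: q nz not_False_eq_True simp_thms)
  show "rational_fun rsin" unfolding rational_fun_def rsin_def
    by (intro exI[of _ "[:0, 2:]"] exI[of _ "[:1, 0, 1:]"] allI) (simp only: q nz not_False_eq_True simp_thms)
qed

text \<open>The parameter is the half-angle formula
  \<open>tan (\<phi> / 2) = sin \<phi> / (1 + cos \<phi>)\<close>.\<close>

lemma rcos_rsin_parametrization:
  assumes "c\<^sup>2 + s\<^sup>2 = 1" "c \<noteq> - 1"
  shows "rcos (s / (1 + c)) = c" "rsin (s / (1 + c)) = s"
proof -
  have c1: "1 + c \<noteq> 0" using assms(2) by auto
  have s2: "s\<^sup>2 = (1 - c) * (1 + c)" using assms(1) by (simp add: power2_eq_square algebra_simps)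
  then have t2: "(s / (1 + c))\<^sup>2 = (1 - c) / (1 + c)"
    using c1 by (simp add: power_divide power2_eq_square)
  have d: "1 + (1 - c) / (1 + c) = 2 / (1 + c)" using c1 by (simp add: field_simps)
  show "rcos (s / (1 + c)) = c" unfolding rcos_def t2 d using c1 by (simp add: field_simps)
  show "rsin (s / (1 + c)) = s" unfolding rsin_def t2 d using c1 by (simp add: field_simps)
qed

text \<open>For orthonormal \<open>u\<close> and \<open>w\<close>, the rotation of their plane from
  \<open>u\<close> towards \<open>w\<close>, written as a correction of \<open>v\<close> so that
  vectors orthogonal to the plane are visibly fixed.\<close>

definition rotation :: "real vec \<Rightarrow> real vec \<Rightarrow> real \<Rightarrow> real vec \<Rightarrow> real vec" where
  "rotation u w t v = v + (((rcos t - 1) * (v \<bullet> u) - rsin t * (v \<bullet> w)) \<cdot>\<^sub>v u +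
     (rsin t * (v \<bullet> u) + (rcos t - 1) * (v \<bullet> w)) \<cdot>\<^sub>v w)"

text \<open>All terms beyond \<open>v \<bullet> v'\<close> collect into a multiple of
  \<open>(rcos t)^2 + (rsin t)^2 - 1\<close>.\<close>

lemma rotation_orthogonal:
  assumes c: "u \<in> carrier_vec n" "w \<in> carrier_vec n" "v \<in> carrier_vec n" "v' \<in> carrier_vec n"
    and uw: "u \<bullet> u = 1" "w \<bullet> w = 1" "u \<bullet> w = 0"
  shows "rotation u w t v \<bullet> rotation u w t v' = v \<bullet> v'"
proof -
  define a b a' b' where ab: "a = v \<bullet> u" "b = v \<bullet> w" "a' = v' \<bullet> u" "b' = v' \<bullet> w"
  define \<alpha> \<beta> \<alpha>' \<beta>' where \<alpha>: "\<alpha> = (rcos t - 1) * a - rsin t * b" "\<beta> = rsin t * a + (rcos t - 1) * b"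
    "\<alpha>' = (rcos t - 1) * a' - rsin t * b'" "\<beta>' = rsin t * a' + (rcos t - 1) * b'"
  have comm: "u \<bullet> v' = a'" "w \<bullet> v' = b'" "w \<bullet> u = 0"
    using c uw comm_scalar_prod[OF c(1,4)] comm_scalar_prod[OF c(2,4)] comm_scalar_prod[OF c(2,1)]
    by (simp_all add: ab)
  have inner: "(v + (\<alpha> \<cdot>\<^sub>v u + \<beta> \<cdot>\<^sub>v w)) \<bullet> q = v \<bullet> q + (\<alpha> * (u \<bullet> q) + \<beta> * (w \<bullet> q))"
    if "q \<in> carrier_vec n" for q
    using c that by (simp add: add_scalar_prod_distrib[of _ n])
  have inner': "p \<bullet> (v' + (\<alpha>' \<cdot>\<^sub>v u + \<beta>' \<cdot>\<^sub>v w)) = p \<bullet> v' + (\<alpha>' * (p \<bullet> u) + \<beta>' * (p \<bullet> w))"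
    if "p \<in> carrier_vec n" for p
    using c that by (simp add: scalar_prod_add_distrib[of _ n])
  have q: "v' + (\<alpha>' \<cdot>\<^sub>v u + \<beta>' \<cdot>\<^sub>v w) \<in> carrier_vec n" using c by simp
  have "rotation u w t v \<bullet> rotation u w t v' = v \<bullet> v' + (\<alpha>' * a + \<beta>' * b) +
      (\<alpha> * (a' + \<alpha>') + \<beta> * (b' + \<beta>'))"
    unfolding rotation_def ab[symmetric] \<alpha>[symmetric] inner[OF q] inner'[OF c(1)] inner'[OF c(2)]
      inner'[OF c(3)] comm uw by simp
  also have "\<dots> = v \<bullet> v' + (a * a' + b * b') * ((rcos t)\<^sup>2 + (rsin t)\<^sup>2 - 1)"
    unfolding \<alpha> by (simp add: power2_eq_square algebra_simps)
  finally show ?thesis by (simp add: rcos_rsin)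
qed

lemma rotation_carrier:
  "u \<in> carrier_vec n \<Longrightarrow> w \<in> carrier_vec n \<Longrightarrow> v \<in> carrier_vec n \<Longrightarrow> rotation u w t v \<in> carrier_vec n"
  by (simp add: rotation_def)

lemma rotation_nth:
  assumes "u \<in> carrier_vec n" "w \<in> carrier_vec n" "v \<in> carrier_vec n" "k < n"
  shows "rotation u w t v $ k = v $ k + (((rcos t - 1) * (v \<bullet> u) - rsin t * (v \<bullet> w)) * u $ k +
     (rsin t * (v \<bullet> u) + (rcos t - 1) * (v \<bullet> w)) * w $ k)"
  using assms by (simp add: rotation_def)

lemma rotation_zero:
  assumes "u \<in> carrier_vec n" "w \<in> carrier_vec n" "v \<in> carrier_vec n"
  shows "rotation u w 0 v = v"
  using assms by (intro eq_vecI) (auto simp: rotation_nth rotation_carrier rcos_def rsin_def carrier_vecD[OF rotation_carrier])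

lemma rotation_fixed:
  assumes "u \<in> carrier_vec n" "w \<in> carrier_vec n" "v \<in> carrier_vec n" "v \<bullet> u = 0" "v \<bullet> w = 0"
  shows "rotation u w t v = v"
  using assms by (intro eq_vecI) (auto simp: rotation_nth carrier_vecD[OF rotation_carrier])

lemma rotation_first:
  assumes "u \<in> carrier_vec n" "w \<in> carrier_vec n" "u \<bullet> u = 1" "u \<bullet> w = 0"
  shows "rotation u w t u = rcos t \<cdot>\<^sub>v u + rsin t \<cdot>\<^sub>v w"
  using assms by (intro eq_vecI) (auto simp: rotation_nth carrier_vecD[OF rotation_carrier] algebra_simps)

section \<open>Coordinates of a train and moves that change them\<close>

lemma train_vec_carrier: "train_vec n z j i \<in> carrier_vec n"
  by (simp add: train_vec_def)

lemma train_params_orthonormal: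
  assumes "z \<in> train_params n L r" "j \<in> {1..L}"
  shows "orthonormal n (r j) (train_vec n z j)"
  using assms by (simp add: train_params_def orthonormal_def train_vec_carrier)

lemma scalar_prod_train_vec:
  assumes "v \<in> carrier_vec n"
  shows "train_vec n z j i \<bullet> v = (\<Sum>k<n. z (Comp j i k) * v $ k)"
  using assms by (simp add: train_vec_def scalar_prod_def atLeast0LessThan)

lemma poly_fun_train_coef:
  "j \<in> {1..L} \<Longrightarrow> i < r j \<Longrightarrow> poly_fun (train_coords n L r) (\<lambda>z. train_coef z j i)"
  unfolding train_coef_def by (rule poly_fun_coord) (simp add: train_coords_def)

lemma poly_fun_train_comp:
  "j \<in> {1..L} \<Longrightarrow> i < r j \<Longrightarrow> k < n \<Longrightarrow> poly_fun (train_coords n L r) (\<lambda>z. z (Comp j i k))"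
  by (rule poly_fun_coord) (simp add: train_coords_def)

lemma poly_fun_train_vec_scalar_prod:
  assumes "j \<in> {1..L}" "i < r j" "v \<in> carrier_vec n"
  shows "poly_fun (train_coords n L r) (\<lambda>z. train_vec n z j i \<bullet> v)"
  unfolding scalar_prod_train_vec[OF assms(3)]
  by (intro poly_fun_sum poly_fun_mult poly_fun_const poly_fun_train_comp assms) simp

lemma poly_fun_train_gram:
  assumes "j \<in> {1..L}" "i < r j" "j' \<in> {1..L}" "i' < r j'"
  shows "poly_fun (train_coords n L r) (\<lambda>z. train_vec n z j i \<bullet> train_vec n z j' i')"
proof -
  have "train_vec n z j i \<bullet> train_vec n z j' i' = (\<Sum>k<n. z (Comp j i k) * z (Comp j' i' k))" for z
    unfolding scalar_prod_train_vec[OF train_vec_carrier] by (simp add: train_vec_def)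
  then show ?thesis
    by (simp only:) (intro poly_fun_sum poly_fun_mult poly_fun_train_comp assms; simp)
qed

text \<open>The coefficients are unconstrained coordinates, so one translation brings them to any
  values without disturbing the vectors.\<close>

lemma reach_coefficients:
  assumes z: "z \<in> train_params n L r"
  shows "\<exists>z'. reach (train_coords n L r) (train_params n L r) z z' \<and>
    (\<forall>j\<in>{1..L}. \<forall>i<r j. train_coef z' j i = \<mu> j i) \<and> train_vec n z' = train_vec n z"
proof -
  let ?I = "train_coords n L r" and ?V = "train_params n L r"
  define d where "d c = (case c of Coef j i \<Rightarrow> \<mu> j i - z (Coef j i) | Comp j i k \<Rightarrow> 0)" for c
  define m where "m t y c = (if c \<in> ?I then y c + t * d c else y c)" for t y c
  have vec: "train_vec n (m t y) = train_vec n y" for t y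
    by (simp add: train_vec_def m_def d_def fun_eq_iff cong: if_cong)
  have "rational_fun (\<lambda>t. a + t * b)" for a b :: real
    using rational_fun_poly[of "[:a, b:]"] by simp
  moreover have "poly_fun ?I (\<lambda>y. y c + b)" if "c \<in> ?I" for c b
    by (rule poly_fun_add[OF poly_fun_coord[OF that] poly_fun_const])
  moreover have "m t y \<in> ?V" if "y \<in> ?V" for t y
  proof -
    have "m t y \<in> ?I \<rightarrow>\<^sub>E UNIV" using that by (auto simp: train_params_def PiE_def extensional_def m_def)
    then show ?thesis using that unfolding train_params_def mem_Collect_eq vec by blast
  qed
  ultimately have "is_move ?I ?V m" unfolding is_move_def by (simp add: m_def fun_eq_iff)
  from reach_move[OF this, of z 1] have "reach ?I ?V z (m 1 z)" .
  moreover have "train_coef (m 1 z) j i = \<mu> j i" if "j \<in> {1..L}" "i < r j" for j i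
    using that by (simp add: train_coef_def m_def d_def train_coords_def)
  ultimately show ?thesis using vec by blast
qed

text \<open>All vectors of the carriage are rotated together, which preserves orthonormality. The
  plane is held constant, even when it is chosen in view of one particular \<open>z\<close>; so the
  move stays polynomial in the point.\<close>

lemma reach_rotation:
  assumes z: "z \<in> train_params n L r" and J: "J \<in> {1..L}"
    and uw: "u \<in> carrier_vec n" "w \<in> carrier_vec n" "u \<bullet> u = 1" "w \<bullet> w = 1" "u \<bullet> w = 0"
  shows "\<exists>z'. reach (train_coords n L r) (train_params n L r) z z' \<and>
    (\<forall>i<r J. train_vec n z' J i = rotation u w t (train_vec n z J i)) \<and>
    (\<forall>j. j \<noteq> J \<longrightarrow> train_vec n z' j = train_vec n z j)"
proof -
  let ?I = "train_coords n L r" and ?V = "train_params n L r"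
  define m where "m t y c = (case c of Coef j i \<Rightarrow> y c
    | Comp j i k \<Rightarrow> if j = J \<and> i < r J \<and> k < n then rotation u w t (train_vec n y J i) $ k else y c)" for t y c
  have rn: "rotation u w t (train_vec n y J i) $ k = y (Comp J i k) +
      (((rcos t - 1) * (train_vec n y J i \<bullet> u) - rsin t * (train_vec n y J i \<bullet> w)) * u $ k +
       (rsin t * (train_vec n y J i \<bullet> u) + (rcos t - 1) * (train_vec n y J i \<bullet> w)) * w $ k)"
    if "k < n" for t y i k
    using that rotation_nth[OF uw(1,2) train_vec_carrier that] by (simp add: train_vec_def)
  have mJ: "train_vec n (m t y) J i = rotation u w t (train_vec n y J i)" if "i < r J" for t y i
    using that by (intro eq_vecI)
      (auto simp: m_def train_vec_def carrier_vecD[OF rotation_carrier[OF uw(1,2) vec_carrier]])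
  have mj: "train_vec n (m t y) j = train_vec n y j" if "j \<noteq> J" for t y j
    using that by (simp add: train_vec_def m_def fun_eq_iff)
  have "is_move ?I ?V m" unfolding is_move_def
  proof (intro conjI ballI allI)
    fix y assume y: "y \<in> ?V"
    show "m 0 y = y"
    proof
      fix c show "m 0 y c = y c"
        using rotation_zero[OF uw(1,2) train_vec_carrier]
        by (cases c) (auto simp: m_def train_vec_def)
    qed
    fix t
    have "m t y c = undefined" if "c \<notin> ?I" for c
    proof -
      have "y c = undefined" using y that by (auto simp: train_params_def PiE_def extensional_def)
      then show ?thesis using that J by (cases c) (auto simp: m_def train_coords_def)
    qed
    then have "m t y \<in> ?I \<rightarrow>\<^sub>E UNIV" by (auto simp: PiE_def extensional_def)
    moreover have "train_vec n (m t y) j p \<bullet> train_vec n (m t y) j q = (if p = q then 1 else 0)"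
      if "j \<in> {1..L}" "p < r j" "q < r j" for j p q
    proof -
      have "train_vec n (m t y) j p \<bullet> train_vec n (m t y) j q = train_vec n y j p \<bullet> train_vec n y j q"
        using that rotation_orthogonal[OF uw(1,2) train_vec_carrier train_vec_carrier uw(3,4,5)]
        by (cases "j = J") (simp_all add: mJ mj)
      then show ?thesis using y that by (simp add: train_params_def)
    qed
    ultimately show "m t y \<in> ?V" unfolding train_params_def by blast
  next
    fix c t assume c: "c \<in> ?I"
    show "poly_fun ?I (\<lambda>y. m t y c)"
    proof (cases "\<exists>i k. c = Comp J i k \<and> i < r J \<and> k < n")
      case True
      then obtain i k where ik: "c = Comp J i k" "i < r J" "k < n" by blast
      then have eq: "m t y c = rotation u w t (train_vec n y J i) $ k" for y by (simp add: m_def)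
      show ?thesis unfolding eq rn[OF ik(3)]
        by (intro poly_fun_add poly_fun_mult poly_fun_diff poly_fun_const poly_fun_train_comp
            poly_fun_train_vec_scalar_prod J ik uw)
    next
      case False
      then have "m t y c = y c" for y by (cases c) (auto simp: m_def)
      then show ?thesis using poly_fun_coord[OF c] by simp
    qed
  next
    fix c y assume c: "c \<in> ?I"
    show "rational_fun (\<lambda>t. m t y c)"
    proof (cases "\<exists>i k. c = Comp J i k \<and> i < r J \<and> k < n")
      case True
      then obtain i k where ik: "c = Comp J i k" "i < r J" "k < n" by blast
      have "rational_fun (\<lambda>t. rcos t - 1)"
        using rational_fun_add[OF rational_fun_rcos rational_fun_const[of "-1"]] by simp
      note rc = rational_fun_mult[OF this rational_fun_const]
        and rs = rational_fun_mult[OF rational_fun_rsin rational_fun_const]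
      have neg: "rational_fun (\<lambda>t. - (rsin t * b))" for b
        using rs[of "- b"] by simp
      have eq: "m t y c = rotation u w t (train_vec n y J i) $ k" for t using ik by (simp add: m_def)
      show ?thesis unfolding eq rn[OF ik(3)] diff_conv_add_uminus[of "(rcos t - 1) * b" for t b]
        by (intro rational_fun_add rational_fun_mult[OF _ rational_fun_const] rational_fun_const rc rs neg)
    next
      case False
      then have "m t y c = y c" for t by (cases c) (auto simp: m_def)
      then show ?thesis using rational_fun_const by simp
    qed
  qed
  from reach_move[OF this, of z t] have "reach ?I ?V z (m t z)" .
  then show ?thesis using mJ mj by blast
qed

text \<open>If the two vectors are orthogonal, the quarter turn in their plane, which is parameter
  1, takes the first to the second.\<close>

lemma reach_gram_nonzero:
  assumes z: "z \<in> train_params n L r" and k: "k \<in> {1..<L}" "p < r k" "q < r (k + 1)"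
  shows "\<exists>z'. reach (train_coords n L r) (train_params n L r) z z' \<and>
    train_vec n z' k p \<bullet> train_vec n z' (k + 1) q \<noteq> 0"
proof (cases "train_vec n z k p \<bullet> train_vec n z (k + 1) q = 0")
  case False
  then show ?thesis using reach_refl by blast
next
  case True
  let ?a = "train_vec n z k p" and ?b = "train_vec n z (k + 1) q"
  have k': "k \<in> {1..L}" "k + 1 \<in> {1..L}" using k by auto
  have ab: "?a \<bullet> ?a = 1" "?b \<bullet> ?b = 1"
    using train_params_orthonormal[OF z k'(1)] train_params_orthonormal[OF z k'(2)] k(2,3)
    by (simp_all add: orthonormal_def)
  obtain z' where z': "reach (train_coords n L r) (train_params n L r) z z'"
    "\<forall>i<r k. train_vec n z' k i = rotation ?a ?b 1 (train_vec n z k i)"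
    "\<forall>j. j \<noteq> k \<longrightarrow> train_vec n z' j = train_vec n z j"
    using reach_rotation[OF z k'(1) train_vec_carrier train_vec_carrier ab True, of 1] by blast
  have "train_vec n z' k p = rcos 1 \<cdot>\<^sub>v ?a + rsin 1 \<cdot>\<^sub>v ?b"
    using z'(2) k(2) rotation_first[OF train_vec_carrier train_vec_carrier ab(1) True] by simp
  also have "\<dots> = ?b"
    using train_vec_carrier[of n z k p] train_vec_carrier[of n z "k + 1" q]
    by (intro eq_vecI) (auto simp: rcos_def rsin_def)
  finally have "train_vec n z' k p \<bullet> train_vec n z' (k + 1) q = 1" using z'(3) ab(2) by simp
  then show ?thesis using z'(1) by (intro exI[of _ z']) simp
qed

text \<open>The vector \<open>w\<close> is the normalized component of \<open>b\<close> orthogonal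
  to \<open>a\<close>; in the two excluded cases this component is zero. The last clause serves to
  leave vectors orthogonal to both \<open>a\<close> and \<open>b\<close> in place.\<close>

lemma rotation_onto:
  assumes c: "a \<in> carrier_vec n" "b \<in> carrier_vec n" and ab: "a \<bullet> a = 1" "b \<bullet> b = 1"
    and ne: "b \<noteq> a" "b \<noteq> - 1 \<cdot>\<^sub>v a"
  shows "\<exists>w t. w \<in> carrier_vec n \<and> w \<bullet> w = 1 \<and> a \<bullet> w = 0 \<and> rotation a w t a = b \<and>
    (\<forall>v\<in>carrier_vec n. v \<bullet> a = 0 \<longrightarrow> v \<bullet> b = 0 \<longrightarrow> v \<bullet> w = 0)"
proof -
  define c0 where "c0 = a \<bullet> b"
  have ba: "b \<bullet> a = c0" using comm_scalar_prod[OF c] by (simp add: c0_def)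
  have sq: "(b + e \<cdot>\<^sub>v a) \<bullet> (b + e \<cdot>\<^sub>v a) = 1 + 2 * e * c0 + e\<^sup>2" for e
    using c ab ba by (simp add: add_scalar_prod_distrib[of _ n] scalar_prod_add_distrib[of _ n]
      c0_def[symmetric] power2_eq_square algebra_simps)
  have eq: "b = - e \<cdot>\<^sub>v a" if "b + e \<cdot>\<^sub>v a = 0\<^sub>v n" for e
  proof (rule eq_vecI)
    fix i assume "i < dim_vec (- e \<cdot>\<^sub>v a)"
    then have i: "i < n" using c by simp
    have "(b + e \<cdot>\<^sub>v a) $ i = 0" using that i by simp
    then show "b $ i = (- e \<cdot>\<^sub>v a) $ i" using c i by simp
  qed (use c in simp)
  \<comment> \<open>Used with \<open>e = 1\<close> and \<open>e = - 1\<close>: together these are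
    the strict Cauchy-Schwarz inequality for the unit vectors \<open>a\<close> and
    \<open>b\<close>.\<close>
  have pos: "1 + 2 * e * c0 + e\<^sup>2 > 0" if "b \<noteq> - e \<cdot>\<^sub>v a" for e
  proof -
    have "(b + e \<cdot>\<^sub>v a) \<bullet> (b + e \<cdot>\<^sub>v a) \<noteq> 0"
    proof
      assume "(b + e \<cdot>\<^sub>v a) \<bullet> (b + e \<cdot>\<^sub>v a) = 0"
      then have "b + e \<cdot>\<^sub>v a = 0\<^sub>v n" using c by (intro scalar_prod_self_eq_0) auto
      then show False using eq that by blast
    qed
    then show ?thesis using scalar_prod_self_nonneg[of "b + e \<cdot>\<^sub>v a"] unfolding sq by linarith
  qed
  have "1 \<cdot>\<^sub>v a = a" by simp
  then have lt: "c0 < 1" "- 1 < c0" using pos[of "- 1"] pos[of 1] ne by simp_all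
  define s where "s = sqrt (1 - c0\<^sup>2)"
  have c2: "1 - c0\<^sup>2 > 0"
  proof -
    have "0 < (1 - c0) * (1 + c0)" using lt by (intro mult_pos_pos) auto
    then show ?thesis by (simp add: power2_eq_square algebra_simps)
  qed
  then have s: "s > 0" "s\<^sup>2 = 1 - c0\<^sup>2" by (simp_all add: s_def)
  define w where "w = (1 / s) \<cdot>\<^sub>v (b + (- c0) \<cdot>\<^sub>v a)"
  have wc: "w \<in> carrier_vec n" using c by (simp add: w_def)
  have vw: "v \<bullet> w = (1 / s) * (v \<bullet> b - c0 * (v \<bullet> a))" if "v \<in> carrier_vec n" for v
    using c that by (simp add: w_def scalar_prod_add_distrib[of _ n])
  have "w \<bullet> w = (1 / s) * ((1 / s) * (1 + 2 * (- c0) * c0 + (- c0)\<^sup>2))"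
    unfolding sq[symmetric] using c by (simp add: w_def)
  also have "\<dots> = (1 - c0\<^sup>2) / s\<^sup>2" using s(1) by (simp add: power2_eq_square)
  finally have ww: "w \<bullet> w = 1" using s c2 by simp
  have aw: "a \<bullet> w = 0" using vw[OF c(1)] ab(1) by (simp add: c0_def)
  have "rotation a w (s / (1 + c0)) a = c0 \<cdot>\<^sub>v a + s \<cdot>\<^sub>v w"
    using rcos_rsin_parametrization[of c0 s] s lt rotation_first[OF c(1) wc ab(1) aw] by simp
  also have "\<dots> = b" using c s(1) by (intro eq_vecI) (auto simp: w_def)
  finally show ?thesis using wc ww aw vw by (intro exI[of _ w] exI[of _ "s / (1 + c0)"]) auto
qed

text \<open>The vectors of carriage \<open>k\<close> are rotated into place one at a time. Those
  placed earlier are orthogonal to the next vector and to its target, hence fixed. A vector opposite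
  to its target is left there with sign -1: rotations preserve orientation, so for full orthonormal
  bases the sign cannot always be removed.\<close>

lemma reach_aligned:
  assumes z: "z \<in> train_params n L r" and k: "k \<in> {1..<L}" and m: "m \<le> min (r k) (r (k + 1))"
  shows "\<exists>z' \<sigma>. reach (train_coords n L r) (train_params n L r) z z' \<and>
    (\<forall>p<m. \<sigma> p \<in> {1, - 1} \<and> train_vec n z' k p = \<sigma> p \<cdot>\<^sub>v train_vec n z' (k + 1) p)"
  using m
proof (induction m)
  case 0
  then show ?case using reach_refl by auto
next
  case (Suc m)
  let ?R = "reach (train_coords n L r) (train_params n L r)"
  obtain y \<sigma> where y: "?R z y"
    "\<And>p. p < m \<Longrightarrow> \<sigma> p \<in> {1, - 1 :: real} \<and> train_vec n y k p = \<sigma> p \<cdot>\<^sub>v train_vec n y (k + 1) p"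
    using Suc by auto
  have yV: "y \<in> train_params n L r" using reach_in[OF z y(1)] .
  have k': "k \<in> {1..L}" "k + 1 \<in> {1..L}" using k by auto
  let ?a = "train_vec n y k m" and ?b = "train_vec n y (k + 1) m"
  have m': "m < r k" "m < r (k + 1)" using Suc.prems by auto
  note on = train_params_orthonormal[OF yV k'(1)] train_params_orthonormal[OF yV k'(2)]
  have ab: "?a \<bullet> ?a = 1" "?b \<bullet> ?b = 1" using on m' by (simp_all add: orthonormal_def)
  consider "?b = ?a" | "?b = - 1 \<cdot>\<^sub>v ?a" | "?b \<noteq> ?a" "?b \<noteq> - 1 \<cdot>\<^sub>v ?a" by blast
  then show ?case
  proof cases
    case 1
    then have "\<forall>p<Suc m. (\<sigma>(m := 1)) p \<in> {1, - 1} \<and>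
        train_vec n y k p = (\<sigma>(m := 1)) p \<cdot>\<^sub>v train_vec n y (k + 1) p"
      using y(2) by (simp add: less_Suc_eq)
    then show ?thesis using y(1) by blast
  next
    case 2
    have "?a = - 1 \<cdot>\<^sub>v ?b" unfolding 2 by (simp add: smult_smult_assoc)
    then have "\<forall>p<Suc m. (\<sigma>(m := - 1)) p \<in> {1, - 1} \<and>
        train_vec n y k p = (\<sigma>(m := - 1)) p \<cdot>\<^sub>v train_vec n y (k + 1) p"
      using y(2) by (simp add: less_Suc_eq)
    then show ?thesis using y(1) by blast
  next
    case 3
    obtain w t where w: "w \<in> carrier_vec n" "w \<bullet> w = 1" "?a \<bullet> w = 0" "rotation ?a w t ?a = ?b"
      "\<And>v. v \<in> carrier_vec n \<Longrightarrow> v \<bullet> ?a = 0 \<Longrightarrow> v \<bullet> ?b = 0 \<Longrightarrow> v \<bullet> w = 0"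
      using rotation_onto[OF train_vec_carrier train_vec_carrier ab 3] by blast
    obtain y' where y': "?R y y'"
      "\<forall>i<r k. train_vec n y' k i = rotation ?a w t (train_vec n y k i)"
      "\<forall>j. j \<noteq> k \<longrightarrow> train_vec n y' j = train_vec n y j"
      using reach_rotation[OF yV k'(1) train_vec_carrier w(1) ab(1) w(2,3), of t] by blast
    have "train_vec n y' k p = train_vec n y k p" if p: "p < m" for p
    proof -
      have pa: "train_vec n y k p \<bullet> ?a = 0" using on(1) m' p by (simp add: orthonormal_def)
      have "train_vec n y k p \<bullet> ?b = \<sigma> p * (train_vec n y (k + 1) p \<bullet> ?b)"
        using y(2)[OF p] train_vec_carrier[of n y "k + 1" p] train_vec_carrier[of n y "k + 1" m]
        by simp
      also have "\<dots> = 0" using on(2) m' p by (simp add: orthonormal_def)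
      finally have pb: "train_vec n y k p \<bullet> ?b = 0" .
      have "rotation ?a w t (train_vec n y k p) = train_vec n y k p"
        by (rule rotation_fixed[OF train_vec_carrier w(1) train_vec_carrier pa w(5)[OF train_vec_carrier pa pb]])
      then show ?thesis using y'(2) m' p by simp
    qed
    moreover have "train_vec n y' k m = ?b" using y'(2) m' w(4) by simp
    ultimately have "\<forall>p<Suc m. (\<sigma>(m := 1)) p \<in> {1, - 1} \<and>
        train_vec n y' k p = (\<sigma>(m := 1)) p \<cdot>\<^sub>v train_vec n y' (k + 1) p"
      using y(2) y'(3) by (simp add: less_Suc_eq)
    then show ?thesis using reach_trans[OF y(1) y'(1)] by blast
  qed
qed

section \<open>Generic trains and generic directions\<close>

text \<open>The square block whose size is the smaller rank, so that one determinant controls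
  one-sided inverses for both directions.\<close>

definition leading_gram :: "(nat \<Rightarrow> nat) \<Rightarrow> (nat \<Rightarrow> nat \<Rightarrow> real vec) \<Rightarrow> nat \<Rightarrow> real mat" where
  "leading_gram r x k = mat (min (r k) (r (k + 1))) (min (r k) (r (k + 1))) (\<lambda>(p, q). x k p \<bullet> x (k + 1) q)"

definition right_mixed ::
    "nat \<Rightarrow> (nat \<Rightarrow> nat) \<Rightarrow> (nat \<Rightarrow> nat \<Rightarrow> real) \<Rightarrow> (nat \<Rightarrow> nat \<Rightarrow> real vec) \<Rightarrow> real vec \<Rightarrow>
     nat \<Rightarrow> nat \<Rightarrow> nat \<Rightarrow> real" where
  "right_mixed L r lam x v j p q =
     (\<Sum>k<r (j + 1). right_sum L r lam x v (j + 1) k * (x j p \<bullet> x (j + 1) k) * (x j q \<bullet> x (j + 1) k))"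

definition left_mixed ::
    "(nat \<Rightarrow> nat) \<Rightarrow> (nat \<Rightarrow> nat \<Rightarrow> real) \<Rightarrow> (nat \<Rightarrow> nat \<Rightarrow> real vec) \<Rightarrow> real vec \<Rightarrow>
     nat \<Rightarrow> nat \<Rightarrow> nat \<Rightarrow> real" where
  "left_mixed r lam x v j p q =
     (\<Sum>k<r j. left_sum r lam x v j k * (x (j + 1) p \<bullet> x j k) * (x (j + 1) q \<bullet> x j k))"

text \<open>Names for the finitely many polynomials that must not vanish, so that the same index set
  serves genericity of the train and of the direction.\<close>

datatype condition =
  Coef_cond nat nat | Left_cond nat nat | Right_cond nat nat
  | Left_diff nat nat nat | Right_diff nat nat nat | Det_cond nat | Gram_cond nat nat nat
  | Right_mixed nat nat nat | Left_mixed nat nat nat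

fun condition_value ::
    "nat \<Rightarrow> (nat \<Rightarrow> nat) \<Rightarrow> condition \<Rightarrow> (nat \<Rightarrow> nat \<Rightarrow> real) \<Rightarrow> (nat \<Rightarrow> nat \<Rightarrow> real vec) \<Rightarrow> real vec \<Rightarrow> real"
  where
  "condition_value L r (Coef_cond j p) lam x v = lam j p"
| "condition_value L r (Left_cond j p) lam x v = left_sum r lam x v j p"
| "condition_value L r (Right_cond j p) lam x v = right_sum L r lam x v j p"
| "condition_value L r (Left_diff j p q) lam x v = left_sum r lam x v j p - left_sum r lam x v j q"
| "condition_value L r (Right_diff j p q) lam x v = right_sum L r lam x v j p - right_sum L r lam x v j q"
| "condition_value L r (Det_cond k) lam x v = det (leading_gram r x k)"
| "condition_value L r (Gram_cond k p q) lam x v = x k p \<bullet> x (k + 1) q"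
| "condition_value L r (Right_mixed k p q) lam x v = right_mixed L r lam x v k p q"
| "condition_value L r (Left_mixed k p q) lam x v = left_mixed r lam x v k p q"

definition train_conditions :: "nat \<Rightarrow> (nat \<Rightarrow> nat) \<Rightarrow> condition set" where
  "train_conditions L r =
    (\<Union>j\<in>{1..L}. \<Union>p\<in>{..<r j}. {Coef_cond j p, Left_cond j p, Right_cond j p}) \<union>
    (\<Union>j\<in>{1..L}. \<Union>p\<in>{..<r j}. \<Union>q\<in>{..<r j} - {p}. {Left_diff j p q, Right_diff j p q}) \<union>
    (\<Union>k\<in>{1..<L}. {Det_cond k}) \<union>
    (\<Union>k\<in>{1..<L}. \<Union>p\<in>{..<r k}. \<Union>q\<in>{..<r (k + 1)}. {Gram_cond k p q}) \<union>
    (\<Union>k\<in>{1..<L}. \<Union>p\<in>{..<r k}. \<Union>q\<in>{..<r k} - {p}. {Right_mixed k p q}) \<union>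
    (\<Union>k\<in>{1..<L}. \<Union>p\<in>{..<r (k + 1)}. \<Union>q\<in>{..<r (k + 1)} - {p}. {Left_mixed k p q})"

lemma finite_train_conditions: "finite (train_conditions L r)"
  unfolding train_conditions_def by (intro finite_UnI finite_UN_I finite_Diff) auto

lemma train_conditions_iff:
  "Coef_cond j p \<in> train_conditions L r \<longleftrightarrow> j \<in> {1..L} \<and> p < r j"
  "Left_cond j p \<in> train_conditions L r \<longleftrightarrow> j \<in> {1..L} \<and> p < r j"
  "Right_cond j p \<in> train_conditions L r \<longleftrightarrow> j \<in> {1..L} \<and> p < r j"
  "Left_diff j p q \<in> train_conditions L r \<longleftrightarrow> j \<in> {1..L} \<and> p < r j \<and> q < r j \<and> p \<noteq> q"
  "Right_diff j p q \<in> train_conditions L r \<longleftrightarrow> j \<in> {1..L} \<and> p < r j \<and> q < r j \<and> p \<noteq> q"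
  "Det_cond k \<in> train_conditions L r \<longleftrightarrow> k \<in> {1..<L}"
  "Gram_cond k p q \<in> train_conditions L r \<longleftrightarrow> k \<in> {1..<L} \<and> p < r k \<and> q < r (k + 1)"
  "Right_mixed k p q \<in> train_conditions L r \<longleftrightarrow> k \<in> {1..<L} \<and> p < r k \<and> q < r k \<and> p \<noteq> q"
  "Left_mixed k p q \<in> train_conditions L r \<longleftrightarrow> k \<in> {1..<L} \<and> p < r (k + 1) \<and> q < r (k + 1) \<and> p \<noteq> q"
  unfolding train_conditions_def by auto

text \<open>Coefficients, vectors and direction may all depend on \<open>z\<close>; this covers
  polynomials in the train for a fixed direction as well as polynomials in the direction for a fixed
  train.\<close>

lemma poly_fun_left_sum:
  assumes "\<And>j i. j \<in> {1..L} \<Longrightarrow> i < r j \<Longrightarrow> poly_fun I (\<lambda>z. lam z j i)"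
    and "\<And>j i. j \<in> {1..L} \<Longrightarrow> i < r j \<Longrightarrow> poly_fun I (\<lambda>z. x z j i \<bullet> v z)"
    and "\<And>j i j' i'. j \<in> {1..L} \<Longrightarrow> i < r j \<Longrightarrow> j' \<in> {1..L} \<Longrightarrow> i' < r j' \<Longrightarrow>
      poly_fun I (\<lambda>z. x z j i \<bullet> x z j' i')"
    and J: "J \<in> {1..L}"
  shows "poly_fun I (\<lambda>z. left_sum r (lam z) (x z) (v z) J p)"
  unfolding left_sum_def left_term_def
proof (intro poly_fun_sum poly_fun_mult poly_fun_prod)
  fix a assume "a \<in> {a \<in> PiE {1..J} (\<lambda>j. {..<r j}). a J = p}"
  then have a: "a j < r j" if "j \<in> {1..J}" for j using that by auto
  show "poly_fun I (\<lambda>z. lam z j (a j))" if "j \<in> {1..J}" for j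
    using that J a by (intro assms(1)) auto
  show "poly_fun I (\<lambda>z. x z k (a k) \<bullet> x z (k + 1) (a (k + 1)))" if "k \<in> {1..<J}" for k
    using that J a[of k] a[of "k + 1"] by (intro assms(3)) auto
  show "poly_fun I (\<lambda>z. x z 1 (a 1) \<bullet> v z)" using J a[of 1] by (intro assms(2)) auto
  show "poly_fun I (\<lambda>z. x z k (a k) \<bullet> v z)" if "k \<in> {1..<J}" for k
    using that J a[of k] by (intro assms(2)) auto
qed

lemma poly_fun_right_sum:
  assumes "\<And>j i. j \<in> {1..L} \<Longrightarrow> i < r j \<Longrightarrow> poly_fun I (\<lambda>z. lam z j i)"
    and "\<And>j i. j \<in> {1..L} \<Longrightarrow> i < r j \<Longrightarrow> poly_fun I (\<lambda>z. x z j i \<bullet> v z)"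
    and "\<And>j i j' i'. j \<in> {1..L} \<Longrightarrow> i < r j \<Longrightarrow> j' \<in> {1..L} \<Longrightarrow> i' < r j' \<Longrightarrow>
      poly_fun I (\<lambda>z. x z j i \<bullet> x z j' i')"
    and J: "J \<in> {1..L}"
  shows "poly_fun I (\<lambda>z. right_sum L r (lam z) (x z) (v z) J p)"
  unfolding right_sum_def right_term_def
proof (intro poly_fun_sum poly_fun_mult poly_fun_prod)
  fix a assume "a \<in> {a \<in> PiE {J..L} (\<lambda>j. {..<r j}). a J = p}"
  then have a: "a j < r j" if "j \<in> {J..L}" for j using that by auto
  show "poly_fun I (\<lambda>z. lam z j (a j))" if "j \<in> {J..L}" for j
    using that J a by (intro assms(1)) auto
  show "poly_fun I (\<lambda>z. x z k (a k) \<bullet> x z (k + 1) (a (k + 1)))" if "k \<in> {J..<L}" for k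
    using that J a[of k] a[of "k + 1"] by (intro assms(3)) auto
  show "poly_fun I (\<lambda>z. x z L (a L) \<bullet> v z)" using J a[of L] by (intro assms(2)) auto
  show "poly_fun I (\<lambda>z. x z k (a k) \<bullet> v z)" if "k \<in> {Suc J..L}" for k
    using that J a[of k] by (intro assms(2)) auto
qed

lemma poly_fun_det:
  assumes "\<And>p q. p < s \<Longrightarrow> q < s \<Longrightarrow> poly_fun I (\<lambda>z. M z p q)"
  shows "poly_fun I (\<lambda>z. det (mat s s (\<lambda>(p, q). M z p q)))"
proof -
  have eq: "det (mat s s (\<lambda>(p, q). M z p q)) =
      (\<Sum>\<pi>\<in>{\<pi>. \<pi> permutes {0..<s}}. signof \<pi> * (\<Prod>i=0..<s. M z i (\<pi> i)))" for z
  proof -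
    have "\<pi> i < s" if "\<pi> permutes {0..<s}" "i < s" for \<pi> i
      using permutes_in_image[OF that(1), of i] that(2) by simp
    then show ?thesis by (simp add: det_def)
  qed
  show ?thesis unfolding eq
  proof (intro poly_fun_sum poly_fun_mult poly_fun_const poly_fun_prod assms)
    fix \<pi> i assume "\<pi> \<in> {\<pi>. \<pi> permutes {0..<s}}" "i \<in> {0..<s}"
    then show "\<pi> i < s" "i < s" using permutes_in_image[of \<pi> "{0..<s}" i] by auto
  qed
qed

lemma poly_fun_train_condition:
  assumes c: "c \<in> train_conditions L r"
    and lam: "\<And>j i. j \<in> {1..L} \<Longrightarrow> i < r j \<Longrightarrow> poly_fun I (\<lambda>z. lam z j i)"
    and v: "\<And>j i. j \<in> {1..L} \<Longrightarrow> i < r j \<Longrightarrow> poly_fun I (\<lambda>z. x z j i \<bullet> v z)"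
    and g: "\<And>j i j' i'. j \<in> {1..L} \<Longrightarrow> i < r j \<Longrightarrow> j' \<in> {1..L} \<Longrightarrow> i' < r j' \<Longrightarrow>
      poly_fun I (\<lambda>z. x z j i \<bullet> x z j' i')"
  shows "poly_fun I (\<lambda>z. condition_value L r c (lam z) (x z) (v z))"
proof -
  have left: "poly_fun I (\<lambda>z. left_sum r (lam z) (x z) (v z) j p)" if "j \<in> {1..L}" for j p
    by (rule poly_fun_left_sum[OF lam v g that])
  have right: "poly_fun I (\<lambda>z. right_sum L r (lam z) (x z) (v z) j p)" if "j \<in> {1..L}" for j p
    by (rule poly_fun_right_sum[OF lam v g that])
  show ?thesis
  proof (cases c)
    case (Coef_cond j p)
    then show ?thesis using c lam by (simp add: train_conditions_iff)
  next
    case (Left_cond j p)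
    then show ?thesis using c left by (simp add: train_conditions_iff)
  next
    case (Right_cond j p)
    then show ?thesis using c right by (simp add: train_conditions_iff)
  next
    case (Left_diff j p q)
    then show ?thesis using c left by (simp add: train_conditions_iff poly_fun_diff)
  next
    case (Right_diff j p q)
    then show ?thesis using c right by (simp add: train_conditions_iff poly_fun_diff)
  next
    case (Det_cond k)
    then have "k \<in> {1..L}" "k + 1 \<in> {1..L}" using c by (auto simp: train_conditions_iff)
    then show ?thesis unfolding Det_cond condition_value.simps leading_gram_def
      by (intro poly_fun_det g) auto
  next
    case (Gram_cond k p q)
    then have "k \<in> {1..L}" "k + 1 \<in> {1..L}" "p < r k" "q < r (k + 1)"
      using c by (auto simp: train_conditions_iff)
    then show ?thesis unfolding Gram_cond condition_value.simps by (intro g)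
  next
    case (Right_mixed k p q)
    then have k: "k \<in> {1..L}" "k + 1 \<in> {1..L}" "p < r k" "q < r k"
      using c by (auto simp: train_conditions_iff)
    show ?thesis unfolding Right_mixed condition_value.simps right_mixed_def
      by (intro poly_fun_sum poly_fun_mult right g k) auto
  next
    case (Left_mixed k p q)
    then have k: "k \<in> {1..L}" "k + 1 \<in> {1..L}" "p < r (k + 1)" "q < r (k + 1)"
      using c by (auto simp: train_conditions_iff)
    show ?thesis unfolding Left_mixed condition_value.simps left_mixed_def
      by (intro poly_fun_sum poly_fun_mult left g k) auto
  qed
qed

text \<open>Coefficients that are 1 at \<open>b j\<close> and 0 elsewhere leave one term of the sum,
  a plain product of inner products, so no cancellation can occur.\<close>

lemma left_sum_delta:
  assumes J: "1 \<le> J" and b: "\<And>j. j \<in> {1..J} \<Longrightarrow> b j < r j"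
    and lam: "\<And>j i. j \<in> {1..J} \<Longrightarrow> i < r j \<Longrightarrow> lam j i = (if i = b j then 1 else 0)"
  shows "left_sum r lam x v J p = (if p = b J then
    (\<Prod>k=1..<J. x k (b k) \<bullet> x (k + 1) (b (k + 1))) * (x 1 (b 1) \<bullet> v) * (\<Prod>j=1..<J. x j (b j) \<bullet> v) else 0)"
proof -
  let ?A = "{a \<in> PiE {1..J} (\<lambda>j. {..<r j}). a J = p}"
  let ?b = "restrict b {1..J}"
  have zero: "left_term lam x v J a = 0" if "a \<in> ?A" "a \<noteq> ?b" for a
  proof -
    obtain j where j: "a j \<noteq> ?b j" using \<open>a \<noteq> ?b\<close> by blast
    have jJ: "j \<in> {1..J}"
    proof (rule ccontr)
      assume "j \<notin> {1..J}"
      then have "a j = undefined" "?b j = undefined" using that(1) by auto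
      with j show False by simp
    qed
    then have "a j \<noteq> b j" "a j < r j" using j that(1) by auto
    then have "lam j (a j) = 0" using lam[OF jJ] by simp
    then have "(\<Prod>j=1..J. lam j (a j)) = 0" using jJ by (intro prod_zero) auto
    then show ?thesis by (simp add: left_term_def)
  qed
  have fin: "finite ?A" using finite_PiE[of "{1..J}" "\<lambda>j. {..<r j}"] by auto
  show ?thesis
  proof (cases "p = b J")
    case True
    then have bA: "?b \<in> ?A" using b J by auto
    have "left_sum r lam x v J p = (\<Sum>a\<in>{?b}. left_term lam x v J a)"
      unfolding left_sum_def by (rule sum.mono_neutral_right[OF fin]) (use bA zero in auto)
    also have "\<dots> = left_term lam x v J ?b" by simp
    also have "\<dots> = (\<Prod>k=1..<J. x k (b k) \<bullet> x (k + 1) (b (k + 1))) * (x 1 (b 1) \<bullet> v) *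
        (\<Prod>j=1..<J. x j (b j) \<bullet> v)"
    proof -
      have 1: "(\<Prod>j=1..J. lam j (?b j)) = 1" using lam b by (intro prod.neutral) auto
      have 2: "(\<Prod>k=1..<J. x k (?b k) \<bullet> x (k + 1) (?b (k + 1))) = (\<Prod>k=1..<J. x k (b k) \<bullet> x (k + 1) (b (k + 1)))"
        by (intro prod.cong) auto
      have 3: "(\<Prod>j=1..<J. x j (?b j) \<bullet> v) = (\<Prod>j=1..<J. x j (b j) \<bullet> v)" by (intro prod.cong) auto
      have 4: "?b 1 = b 1" using J by simp
      show ?thesis unfolding left_term_def 1 2 3 4 by simp
    qed
    finally show ?thesis using True by simp
  next
    case False
    have "left_term lam x v J a = 0" if "a \<in> ?A" for a
    proof (rule zero[OF that])
      show "a \<noteq> ?b" using that False J by auto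
    qed
    then show ?thesis using False by (simp add: left_sum_def)
  qed
qed

lemma right_sum_delta:
  assumes J: "J \<le> L" and b: "\<And>j. j \<in> {J..L} \<Longrightarrow> b j < r j"
    and lam: "\<And>j i. j \<in> {J..L} \<Longrightarrow> i < r j \<Longrightarrow> lam j i = (if i = b j then 1 else 0)"
  shows "right_sum L r lam x v J p = (if p = b J then
    (\<Prod>k=J..<L. x k (b k) \<bullet> x (k + 1) (b (k + 1))) * (x L (b L) \<bullet> v) * (\<Prod>j=Suc J..L. x j (b j) \<bullet> v) else 0)"
proof -
  let ?A = "{a \<in> PiE {J..L} (\<lambda>j. {..<r j}). a J = p}"
  let ?b = "restrict b {J..L}"
  have zero: "right_term L lam x v J a = 0" if "a \<in> ?A" "a \<noteq> ?b" for a
  proof -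
    obtain j where j: "a j \<noteq> ?b j" using \<open>a \<noteq> ?b\<close> by blast
    have jJ: "j \<in> {J..L}"
    proof (rule ccontr)
      assume "j \<notin> {J..L}"
      then have "a j = undefined" "?b j = undefined" using that(1) by auto
      with j show False by simp
    qed
    then have "a j \<noteq> b j" "a j < r j" using j that(1) by auto
    then have "lam j (a j) = 0" using lam[OF jJ] by simp
    then have "(\<Prod>j=J..L. lam j (a j)) = 0" using jJ by (intro prod_zero) auto
    then show ?thesis by (simp add: right_term_def)
  qed
  have fin: "finite ?A" using finite_PiE[of "{J..L}" "\<lambda>j. {..<r j}"] by auto
  show ?thesis
  proof (cases "p = b J")
    case True
    then have bA: "?b \<in> ?A" using b J by auto
    have "right_sum L r lam x v J p = (\<Sum>a\<in>{?b}. right_term L lam x v J a)"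
      unfolding right_sum_def by (rule sum.mono_neutral_right[OF fin]) (use bA zero in auto)
    also have "\<dots> = right_term L lam x v J ?b" by simp
    also have "\<dots> = (\<Prod>k=J..<L. x k (b k) \<bullet> x (k + 1) (b (k + 1))) * (x L (b L) \<bullet> v) *
        (\<Prod>j=Suc J..L. x j (b j) \<bullet> v)"
    proof -
      have 1: "(\<Prod>j=J..L. lam j (?b j)) = 1" using lam b by (intro prod.neutral) auto
      have 2: "(\<Prod>k=J..<L. x k (?b k) \<bullet> x (k + 1) (?b (k + 1))) = (\<Prod>k=J..<L. x k (b k) \<bullet> x (k + 1) (b (k + 1)))"
        by (intro prod.cong) auto
      have 3: "(\<Prod>j=Suc J..L. x j (?b j) \<bullet> v) = (\<Prod>j=Suc J..L. x j (b j) \<bullet> v)" by (intro prod.cong) auto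
      have 4: "?b L = b L" using J by simp
      show ?thesis unfolding right_term_def 1 2 3 4 by simp
    qed
    finally show ?thesis using True by simp
  next
    case False
    have "right_term L lam x v J a = 0" if "a \<in> ?A" for a
    proof (rule zero[OF that])
      show "a \<noteq> ?b" using that False J by auto
    qed
    then show ?thesis using False by (simp add: right_sum_def)
  qed
qed

section \<open>Witnesses for the single conditions\<close>

lemma generic_set_nonempty:
  assumes "generic_set I V U" "V \<noteq> {}"
  shows "U \<noteq> {}"
proof
  assume "U = {}"
  have "zariski_closed I {}" unfolding zariski_closed_def
    by (intro exI[of _ "{\<lambda>_. 1}"]) (simp add: poly_fun_const)
  then have "V \<subseteq> {}" using assms(1) \<open>U = {}\<close> unfolding generic_set_def by blast
  then show False using assms(2) by simp
qed

text \<open>Each functional is nonzero at \<open>x\<close> itself, so the genericity result makes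
  all of them nonzero at a common direction.\<close>

lemma direction_exists:
  fixes X :: "real vec set"
  assumes "finite X" "\<And>x. x \<in> X \<Longrightarrow> x \<in> carrier_vec n \<and> x \<bullet> x = 1"
  shows "\<exists>v\<in>carrier_vec n. \<forall>x\<in>X. x \<bullet> v \<noteq> 0"
proof -
  have inner: "x \<bullet> vec n f = (\<Sum>k<n. x $ k * f k)" for x f
    by (simp add: scalar_prod_def atLeast0LessThan)
  have "generic_set {..<n} ({..<n} \<rightarrow>\<^sub>E UNIV) {f \<in> {..<n} \<rightarrow>\<^sub>E UNIV. \<forall>x\<in>X. x \<bullet> vec n f \<noteq> 0}"
  proof (rule generic_set_affine_space[OF assms(1)])
    fix x assume x: "x \<in> X"
    show "poly_fun {..<n} (\<lambda>f. x \<bullet> vec n f)"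
      unfolding inner by (intro poly_fun_sum poly_fun_mult poly_fun_const poly_fun_coord)
    have "vec n (restrict (($) x) {..<n}) = x" using assms(2)[OF x] by (intro eq_vecI) auto
    then show "\<exists>f\<in>{..<n} \<rightarrow>\<^sub>E UNIV. x \<bullet> vec n f \<noteq> 0"
      using assms(2)[OF x] by (intro bexI[of _ "restrict (($) x) {..<n}"]) auto
  qed
  moreover have "({..<n} \<rightarrow>\<^sub>E (UNIV :: real set)) \<noteq> {}" by (simp add: PiE_eq_empty_iff)
  ultimately obtain f where "\<forall>x\<in>X. x \<bullet> vec n f \<noteq> 0" using generic_set_nonempty by blast
  then show ?thesis by (intro bexI[of _ "vec n f"]) auto
qed

lemma reach_all_gram_nonzero:
  assumes z: "z \<in> train_params n L r"
  shows "\<exists>z'. reach (train_coords n L r) (train_params n L r) z z' \<and>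
    (\<forall>k\<in>{1..<L}. \<forall>p<r k. \<forall>q<r (k + 1). train_vec n z' k p \<bullet> train_vec n z' (k + 1) q \<noteq> 0)"
proof -
  let ?I = "train_coords n L r" and ?V = "train_params n L r"
  let ?A = "Sigma {1..<L} (\<lambda>k. {..<r k} \<times> {..<r (k + 1)})"
  let ?f = "\<lambda>(k, p, q) (b :: unit) z. train_vec n z k p \<bullet> train_vec n z (k + 1) q"
  have "\<exists>z'. reach ?I ?V z z' \<and> (1 :: real) \<noteq> 0 \<and> (\<forall>a\<in>?A. \<exists>b\<in>{()}. ?f a b z' \<noteq> 0)"
  \<comment> \<open>The constant 1 takes the place of the polynomial to be kept.\<close>
  proof (rule reach_common_nonzero[where g = "\<lambda>_. 1"])
    show "finite ?A" by auto
    fix a b assume "a \<in> ?A" "b \<in> {()}"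
    then obtain k p q where a: "a = (k, p, q)" "k \<in> {1..<L}" "p < r k" "q < r (k + 1)" by auto
    then have "k \<in> {1..L}" "k + 1 \<in> {1..L}" by auto
    then show "poly_fun ?I (?f a b)" unfolding a(1) prod.case using a by (intro poly_fun_train_gram)
  next
    fix a z assume "a \<in> ?A" and z: "z \<in> ?V"
    then obtain k p q where a: "a = (k, p, q)" "k \<in> {1..<L}" "p < r k" "q < r (k + 1)" by auto
    show "\<exists>z'. reach ?I ?V z z' \<and> (\<exists>b\<in>{()}. ?f a b z' \<noteq> 0)"
      using reach_gram_nonzero[OF z a(2-4)] unfolding a(1) by simp
  qed (use z poly_fun_const in auto)
  then obtain z' where z': "reach ?I ?V z z'" "\<forall>a\<in>?A. \<exists>b\<in>{()}. ?f a b z' \<noteq> 0" by blast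
  have "train_vec n z' k p \<bullet> train_vec n z' (k + 1) q \<noteq> 0"
    if "k \<in> {1..<L}" "p < r k" "q < r (k + 1)" for k p q
    using z'(2)[rule_format, of "(k, p, q)"] that by simp
  then show ?thesis using z'(1) by blast
qed

text \<open>The order of the choices matters: avoiding zeros preserves nonvanishing only, not exact
  values. So the Gram entries are treated before the coefficients are set, which leaves the vectors
  alone, and the direction is chosen last.\<close>

lemma reach_delta:
  assumes z: "z \<in> train_params n L r"
  shows "\<exists>z' v. reach (train_coords n L r) (train_params n L r) z z' \<and> v \<in> carrier_vec n \<and>
    (\<forall>k\<in>{1..<L}. \<forall>p<r k. \<forall>q<r (k + 1). train_vec n z' k p \<bullet> train_vec n z' (k + 1) q \<noteq> 0) \<and>
    (\<forall>j\<in>{1..L}. \<forall>p<r j. train_vec n z' j p \<bullet> v \<noteq> 0) \<and>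
    (\<forall>j\<in>{1..L}. \<forall>i<r j. train_coef z' j i = (if i = b j then 1 else 0))"
proof -
  obtain z1 where z1: "reach (train_coords n L r) (train_params n L r) z z1"
    "\<forall>k\<in>{1..<L}. \<forall>p<r k. \<forall>q<r (k + 1). train_vec n z1 k p \<bullet> train_vec n z1 (k + 1) q \<noteq> 0"
    using reach_all_gram_nonzero[OF z] by blast
  have V1: "z1 \<in> train_params n L r" by (rule reach_in[OF z z1(1)])
  obtain z2 where z2: "reach (train_coords n L r) (train_params n L r) z1 z2"
    "\<forall>j\<in>{1..L}. \<forall>i<r j. train_coef z2 j i = (if i = b j then 1 else 0)" "train_vec n z2 = train_vec n z1"
    using reach_coefficients[OF V1, of "\<lambda>j i. if i = b j then 1 else 0"] by blast
  let ?X = "\<Union>j\<in>{1..L}. train_vec n z1 j ` {..<r j}"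
  have "\<exists>v\<in>carrier_vec n. \<forall>x\<in>?X. x \<bullet> v \<noteq> 0"
  proof (rule direction_exists)
    fix x assume "x \<in> ?X"
    then obtain j p where "j \<in> {1..L}" "p < r j" "x = train_vec n z1 j p" by auto
    then show "x \<in> carrier_vec n \<and> x \<bullet> x = 1"
      using train_params_orthonormal[OF V1, of j] by (simp add: orthonormal_def)
  qed simp
  then obtain v where "v \<in> carrier_vec n" "\<forall>j\<in>{1..L}. \<forall>p<r j. train_vec n z1 j p \<bullet> v \<noteq> 0" by blast
  then show ?thesis using z1(2) z2(2) reach_trans[OF z1(1) z2(1)]
    by (intro exI[of _ z2] exI[of _ v] conjI) (simp_all only: z2(3))
qed

text \<open>With one index singled out in each carriage, a weight is nonzero for exactly one vector
  of a carriage. This settles the weights, their differences and the mixed sums; the determinant is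
  instead made nonzero by aligning neighbouring carriages.\<close>

lemma reach_train_condition:
  assumes r: "\<And>j. j \<in> {1..L} \<Longrightarrow> 1 \<le> r j" and z: "z \<in> train_params n L r"
    and c: "c \<in> train_conditions L r"
  shows "\<exists>z'. reach (train_coords n L r) (train_params n L r) z z' \<and>
    (\<exists>v\<in>carrier_vec n. condition_value L r c (train_coef z') (train_vec n z') v \<noteq> 0)"
proof -
  let ?R = "reach (train_coords n L r) (train_params n L r)"
  define good where "good b z' v \<longleftrightarrow> v \<in> carrier_vec n \<and>
    (\<forall>k\<in>{1..<L}. \<forall>p<r k. \<forall>q<r (k + 1). train_vec n z' k p \<bullet> train_vec n z' (k + 1) q \<noteq> 0) \<and>
    (\<forall>j\<in>{1..L}. \<forall>p<r j. train_vec n z' j p \<bullet> v \<noteq> 0) \<and>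
    (\<forall>j\<in>{1..L}. \<forall>i<r j. train_coef z' j i = (if i = b j then 1 else 0))" for b z' v
  have ex: "\<exists>z' v. ?R z z' \<and> good b z' v" for b
    using reach_delta[OF z, of b] unfolding good_def by blast
  \<comment> \<open>Index \<open>p\<close> at carriage \<open>j\<close>, and index 0, which exists
    because the ranks are positive, at all others.\<close>
  define b where "b j p i = (if i = j then p else 0)" for j p i :: nat
  have bj: "b j p j = p" for j p by (simp add: b_def)
  have br: "b j p i < r i" if "i \<in> {1..L}" "p < r j" for i j p
    using r[OF that(1)] that(2) by (auto simp: b_def)
  have left: "left_sum r (train_coef z') (train_vec n z') v j q \<noteq> 0 \<longleftrightarrow> q = p"
    if g: "good (b j p) z' v" and j: "j \<in> {1..L}" "p < r j" for z' v j p q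
  proof -
    have "left_sum r (train_coef z') (train_vec n z') v j q = (if q = b j p j then
      (\<Prod>k=1..<j. train_vec n z' k (b j p k) \<bullet> train_vec n z' (k + 1) (b j p (k + 1))) *
      (train_vec n z' 1 (b j p 1) \<bullet> v) * (\<Prod>i=1..<j. train_vec n z' i (b j p i) \<bullet> v) else 0)"
      using g j br by (intro left_sum_delta) (auto simp: good_def)
    moreover have "(\<Prod>k=1..<j. train_vec n z' k (b j p k) \<bullet> train_vec n z' (k + 1) (b j p (k + 1))) \<noteq> 0"
      "train_vec n z' 1 (b j p 1) \<bullet> v \<noteq> 0" "(\<Prod>i=1..<j. train_vec n z' i (b j p i) \<bullet> v) \<noteq> 0"
      using g j br[OF _ j(2)] by (auto simp: good_def)
    ultimately show ?thesis by (simp add: bj)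
  qed
  have right: "right_sum L r (train_coef z') (train_vec n z') v j q \<noteq> 0 \<longleftrightarrow> q = p"
    if g: "good (b j p) z' v" and j: "j \<in> {1..L}" "p < r j" for z' v j p q
  proof -
    have "right_sum L r (train_coef z') (train_vec n z') v j q = (if q = b j p j then
      (\<Prod>k=j..<L. train_vec n z' k (b j p k) \<bullet> train_vec n z' (k + 1) (b j p (k + 1))) *
      (train_vec n z' L (b j p L) \<bullet> v) * (\<Prod>i=Suc j..L. train_vec n z' i (b j p i) \<bullet> v) else 0)"
      using g j br by (intro right_sum_delta) (auto simp: good_def)
    moreover have "(\<Prod>k=j..<L. train_vec n z' k (b j p k) \<bullet> train_vec n z' (k + 1) (b j p (k + 1))) \<noteq> 0"
      "train_vec n z' L (b j p L) \<bullet> v \<noteq> 0" "(\<Prod>i=Suc j..L. train_vec n z' i (b j p i) \<bullet> v) \<noteq> 0"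
      using g j br[OF _ j(2)] by (auto simp: good_def)
    ultimately show ?thesis by (simp add: bj)
  qed
  have witness: ?thesis if "\<And>z' v. good b0 z' v \<Longrightarrow> condition_value L r c (train_coef z') (train_vec n z') v \<noteq> 0" for b0
  proof -
    obtain z' v where zv: "?R z z'" "good b0 z' v" using ex by blast
    then have "v \<in> carrier_vec n" by (simp add: good_def)
    then show ?thesis using zv that by blast
  qed
  show ?thesis
  proof (cases c)
    case (Coef_cond j p)
    then have "j \<in> {1..L}" "p < r j" using c by (simp_all add: train_conditions_iff)
    then show ?thesis by (intro witness[of "b j p"]) (simp add: Coef_cond good_def bj)
  next
    case (Left_cond j p)
    then have "j \<in> {1..L}" "p < r j" using c by (simp_all add: train_conditions_iff)
    then show ?thesis using left by (intro witness[of "b j p"]) (simp add: Left_cond)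
  next
    case (Right_cond j p)
    then have "j \<in> {1..L}" "p < r j" using c by (simp_all add: train_conditions_iff)
    then show ?thesis using right by (intro witness[of "b j p"]) (simp add: Right_cond)
  next
    case (Left_diff j p q)
    then have j: "j \<in> {1..L}" "p < r j" "p \<noteq> q" using c by (simp_all add: train_conditions_iff)
    show ?thesis
    proof (rule witness[of "b j p"])
      fix z' v assume "good (b j p) z' v"
      from left[OF this j(1,2), of p] left[OF this j(1,2), of q] j(3)
      show "condition_value L r c (train_coef z') (train_vec n z') v \<noteq> 0" by (simp add: Left_diff)
    qed
  next
    case (Right_diff j p q)
    then have j: "j \<in> {1..L}" "p < r j" "p \<noteq> q" using c by (simp_all add: train_conditions_iff)
    show ?thesis
    proof (rule witness[of "b j p"])
      fix z' v assume "good (b j p) z' v"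
      from right[OF this j(1,2), of p] right[OF this j(1,2), of q] j(3)
      show "condition_value L r c (train_coef z') (train_vec n z') v \<noteq> 0" by (simp add: Right_diff)
    qed
  next
    case (Gram_cond k p q)
    then show ?thesis using c
      by (intro witness[of "b 1 0"]) (simp add: train_conditions_iff good_def)
  next
    case (Right_mixed k p q)
    then have c: "k \<in> {1..<L}" "p < r k" "q < r k" using c by (simp_all add: train_conditions_iff)
    then have k: "k + 1 \<in> {1..L}" "0 < r (k + 1)" using r[of "k + 1"] by auto
    show ?thesis
    \<comment> \<open>Singling out index 0 of carriage \<open>k + 1\<close> leaves one summand, a
      weight times two nonzero Gram entries.\<close>
    proof (rule witness[of "b (k + 1) 0"])
      fix z' v assume g: "good (b (k + 1) 0) z' v"
      let ?t = "\<lambda>i. right_sum L r (train_coef z') (train_vec n z') v (k + 1) i *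
        (train_vec n z' k p \<bullet> train_vec n z' (k + 1) i) * (train_vec n z' k q \<bullet> train_vec n z' (k + 1) i)"
      have "?t i = 0" if "i \<noteq> 0" for i
      proof -
        have "right_sum L r (train_coef z') (train_vec n z') v (k + 1) i = 0"
          using right[OF g k, of i] that by blast
        then show ?thesis by (simp only: mult_zero_left)
      qed
      then have "(\<Sum>i<r (k + 1). ?t i) = (\<Sum>i\<in>{0}. ?t i)"
        using k(2) by (intro sum.mono_neutral_right) blast+
      moreover have "?t 0 \<noteq> 0" using right[OF g k, of 0] g c k(2) by (simp add: good_def)
      ultimately show "condition_value L r c (train_coef z') (train_vec n z') v \<noteq> 0"
        by (simp add: Right_mixed right_mixed_def)
    qed
  next
    case (Left_mixed k p q)
    then have c: "k \<in> {1..<L}" "p < r (k + 1)" "q < r (k + 1)"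
      using c by (simp_all add: train_conditions_iff)
    then have k: "k \<in> {1..L}" "0 < r k" using r[of k] by auto
    show ?thesis
    proof (rule witness[of "b k 0"])
      fix z' v assume g: "good (b k 0) z' v"
      let ?t = "\<lambda>i. left_sum r (train_coef z') (train_vec n z') v k i *
        (train_vec n z' (k + 1) p \<bullet> train_vec n z' k i) * (train_vec n z' (k + 1) q \<bullet> train_vec n z' k i)"
      have "?t i = 0" if "i \<noteq> 0" for i
      proof -
        have "left_sum r (train_coef z') (train_vec n z') v k i = 0"
          using left[OF g k, of i] that by blast
        then show ?thesis by (simp only: mult_zero_left)
      qed
      then have "(\<Sum>i<r k. ?t i) = (\<Sum>i\<in>{0}. ?t i)"
        using k(2) by (intro sum.mono_neutral_right) blast+
      moreover have "?t 0 \<noteq> 0"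
        using left[OF g k, of 0] g c k(2)
          comm_scalar_prod[OF train_vec_carrier[of n z' "k + 1" p] train_vec_carrier[of n z' k 0]]
          comm_scalar_prod[OF train_vec_carrier[of n z' "k + 1" q] train_vec_carrier[of n z' k 0]]
        by (simp add: good_def)
      ultimately show "condition_value L r c (train_coef z') (train_vec n z') v \<noteq> 0"
        by (simp add: Left_mixed left_mixed_def)
    qed
  next
    case (Det_cond k)
    then have k: "k \<in> {1..<L}" using c by (simp add: train_conditions_iff)
    let ?s = "min (r k) (r (k + 1))"
    obtain z' \<sigma> where z': "?R z z'"
      "\<And>p. p < ?s \<Longrightarrow> \<sigma> p \<in> {1, - 1 :: real} \<and> train_vec n z' k p = \<sigma> p \<cdot>\<^sub>v train_vec n z' (k + 1) p"
      using reach_aligned[OF z k order.refl] by blast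
    have zV: "z' \<in> train_params n L r" by (rule reach_in[OF z z'(1)])
    let ?M = "leading_gram r (train_vec n z') k"
    have M: "?M = mat ?s ?s (\<lambda>(p, q). if p = q then \<sigma> p else 0)"
      unfolding leading_gram_def
    proof (intro cong_mat refl, clarify)
      fix p q assume pq: "p < ?s" "q < ?s"
      have "train_vec n z' k p \<bullet> train_vec n z' (k + 1) q =
          \<sigma> p * (train_vec n z' (k + 1) p \<bullet> train_vec n z' (k + 1) q)"
        using z'(2)[OF pq(1)] train_vec_carrier[of n z' "k + 1" p] train_vec_carrier[of n z' "k + 1" q]
        by simp
      then show "train_vec n z' k p \<bullet> train_vec n z' (k + 1) q = (if p = q then \<sigma> p else 0)"
        using train_params_orthonormal[OF zV, of "k + 1"] k pq by (simp add: orthonormal_def)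
    qed
    \<comment> \<open>A diagonal matrix of signs is its own inverse, so its determinant cannot
      vanish.\<close>
    have "?M * ?M = 1\<^sub>m ?s"
    proof (rule eq_matI)
      fix i j assume "i < dim_row (1\<^sub>m ?s :: real mat)" "j < dim_col (1\<^sub>m ?s :: real mat)"
      then have ij: "i < ?s" "j < ?s" by simp_all
      have "(?M * ?M) $$ (i, j) = (\<Sum>l<?s. (if i = l then \<sigma> i else 0) * (if l = j then \<sigma> l else 0))"
        unfolding M using ij by (simp add: scalar_prod_def atLeast0LessThan)
      also have "\<dots> = (\<Sum>l<?s. if l = i then (if i = j then \<sigma> i * \<sigma> i else 0) else 0)"
        by (intro sum.cong) auto
      also have "\<dots> = (if i = j then 1 else 0)" using ij z'(2)[OF ij(1)] by (subst sum.delta) auto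
      finally show "(?M * ?M) $$ (i, j) = 1\<^sub>m ?s $$ (i, j)" using ij by simp
    qed (simp_all add: M)
    moreover have "?M \<in> carrier_mat ?s ?s" by (simp add: M)
    ultimately have "det ?M * det ?M = 1" by (metis det_mult det_one)
    then have "det ?M \<noteq> 0" by auto
    \<comment> \<open>The determinant does not involve the direction, so any vector of the right
      dimension serves.\<close>
    then show ?thesis using z'(1) by (intro exI[of _ z'] conjI bexI[of _ "0\<^sub>v n"]) (simp_all add: Det_cond)
  qed
qed

text \<open>The inverse of the leading block, padded with zeros. The second claim reads it as a
  right inverse, with the two indices of \<open>B\<close> exchanged.\<close>

lemma left_inverse_of_leading_gram:
  assumes "det (leading_gram r x k) \<noteq> 0"
  shows "r (k + 1) \<le> r k \<Longrightarrow> \<exists>B. \<forall>i<r (k + 1). \<forall>i'<r (k + 1).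
      (\<Sum>p<r k. B i p * (x k p \<bullet> x (k + 1) i')) = (if i = i' then 1 else (0 :: real))"
    and "r k \<le> r (k + 1) \<Longrightarrow> \<exists>B. \<forall>i<r k. \<forall>i'<r k.
      (\<Sum>p<r (k + 1). B i p * (x k i' \<bullet> x (k + 1) p)) = (if i = i' then 1 else (0 :: real))"
proof -
  let ?M = "leading_gram r x k" and ?s = "min (r k) (r (k + 1))"
  have M: "?M \<in> carrier_mat ?s ?s" by (simp add: leading_gram_def)
  obtain B where B: "B \<in> carrier_mat ?s ?s" "B * ?M = 1\<^sub>m ?s" "?M * B = 1\<^sub>m ?s"
    using det_non_zero_imp_unit[OF M assms, of "()"] by (auto simp: Units_def ring_mat_def)
  show "\<exists>B. \<forall>i<r (k + 1). \<forall>i'<r (k + 1).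
      (\<Sum>p<r k. B i p * (x k p \<bullet> x (k + 1) i')) = (if i = i' then 1 else (0 :: real))"
    if le: "r (k + 1) \<le> r k"
  proof (intro exI[of _ "\<lambda>i p. if p < ?s then B $$ (i, p) else 0"] allI impI)
    fix i i' assume i: "i < r (k + 1)" "i' < r (k + 1)"
    have s: "?s = r (k + 1)" using le by simp
    have "(\<Sum>p<r k. (if p < ?s then B $$ (i, p) else 0) * (x k p \<bullet> x (k + 1) i')) =
        (\<Sum>p<?s. B $$ (i, p) * (x k p \<bullet> x (k + 1) i'))"
      by (rule sum.mono_neutral_cong_right) auto
    also have "\<dots> = (B * ?M) $$ (i, i')"
      using i B(1) s by (simp add: scalar_prod_def atLeast0LessThan leading_gram_def)
    also have "\<dots> = (if i = i' then 1 else 0)" unfolding B(2) using i s by simp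
    finally show "(\<Sum>p<r k. (if p < ?s then B $$ (i, p) else 0) * (x k p \<bullet> x (k + 1) i')) =
      (if i = i' then 1 else 0)" .
  qed
  show "\<exists>B. \<forall>i<r k. \<forall>i'<r k.
      (\<Sum>p<r (k + 1). B i p * (x k i' \<bullet> x (k + 1) p)) = (if i = i' then 1 else (0 :: real))"
    if le: "r k \<le> r (k + 1)"
  proof (intro exI[of _ "\<lambda>i p. if p < ?s then B $$ (p, i) else 0"] allI impI)
    fix i i' assume i: "i < r k" "i' < r k"
    have s: "?s = r k" using le by simp
    have "(\<Sum>p<r (k + 1). (if p < ?s then B $$ (p, i) else 0) * (x k i' \<bullet> x (k + 1) p)) =
        (\<Sum>p<?s. (x k i' \<bullet> x (k + 1) p) * B $$ (p, i))"
      by (rule sum.mono_neutral_cong_right) auto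
    also have "\<dots> = (?M * B) $$ (i', i)"
      using i B(1) s by (simp add: scalar_prod_def atLeast0LessThan leading_gram_def)
    also have "\<dots> = (if i = i' then 1 else 0)" unfolding B(3) using i s by simp
    finally show "(\<Sum>p<r (k + 1). (if p < ?s then B $$ (p, i) else 0) * (x k i' \<bullet> x (k + 1) p)) =
      (if i = i' then 1 else 0)" .
  qed
qed

section \<open>From nonvanishing conditions to generic trains and directions\<close>

lemma generic_train_of_conditions:
  assumes L: "1 \<le> L" and r: "\<And>j. j \<in> {1..L} \<Longrightarrow> 1 \<le> r j \<and> r j \<le> n"
    and z: "z \<in> train_params n L r"
    and c: "\<And>c. c \<in> train_conditions L r \<Longrightarrow>
      \<exists>v\<in>carrier_vec n. condition_value L r c (train_coef z) (train_vec n z) v \<noteq> 0"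
  shows "generic_train n L r (train_vec n z)"
proof
  show "1 \<le> L" by (rule L)
  show "1 \<le> r j \<and> r j \<le> n" if "j \<in> {1..L}" for j using r that .
  show "orthonormal n (r j) (train_vec n z j)" if "j \<in> {1..L}" for j
    by (rule train_params_orthonormal[OF z that])
  show "train_vec n z k p \<bullet> train_vec n z (k + 1) q \<noteq> 0"
    if "k \<in> {1..<L}" "p < r k" "q < r (k + 1)" for k p q
    using c[of "Gram_cond k p q"] that by (auto simp: train_conditions_iff)
  fix k assume k: "k \<in> {1..<L}"
  have "det (leading_gram r (train_vec n z) k) \<noteq> 0"
    using c[of "Det_cond k"] k by (auto simp: train_conditions_iff)
  note inv = left_inverse_of_leading_gram[OF this]
  show "\<exists>B. \<forall>i<r (k + 1). \<forall>i'<r (k + 1).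
      (\<Sum>p<r k. B i p * (train_vec n z k p \<bullet> train_vec n z (k + 1) i')) = (if i = i' then 1 else (0 :: real))"
    if "r (k + 1) \<le> r k" by (rule inv(1)[OF that])
  show "\<exists>B. \<forall>i<r k. \<forall>i'<r k.
      (\<Sum>p<r (k + 1). B i p * (train_vec n z (k + 1) p \<bullet> train_vec n z k i')) = (if i = i' then 1 else (0 :: real))"
    if "r k \<le> r (k + 1)"
    using inv(2)[OF that] by (simp only: comm_scalar_prod[OF train_vec_carrier train_vec_carrier, of n z "k + 1" _ z k])
qed

lemma generic_direction_of_conditions:
  assumes v: "v \<in> carrier_vec n"
    and c: "\<And>c. c \<in> train_conditions L r \<Longrightarrow> condition_value L r c lam x v \<noteq> 0"
  shows "generic_direction n L r lam x v"
  unfolding generic_direction_def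
proof (intro conjI ballI allI impI inj_onI v)
  fix j p assume j: "j \<in> {1..L}" "p < r j"
  show "left_sum r lam x v j p \<noteq> 0" using c[of "Left_cond j p"] j by (simp add: train_conditions_iff)
  show "right_sum L r lam x v j p \<noteq> 0" using c[of "Right_cond j p"] j by (simp add: train_conditions_iff)
next
  fix j p q assume j: "j \<in> {1..L}" "p \<in> {..<r j}" "q \<in> {..<r j}"
  show "p = q" if "left_sum r lam x v j p = left_sum r lam x v j q"
    using c[of "Left_diff j p q"] j that by (auto simp: train_conditions_iff)
  show "p = q" if "right_sum L r lam x v j p = right_sum L r lam x v j q"
    using c[of "Right_diff j p q"] j that by (auto simp: train_conditions_iff)
next
  fix j p q assume j: "j \<in> {1..<L}" "p < r j" "q < r j" "p \<noteq> q"
  then show "(\<Sum>k<r (j + 1). right_sum L r lam x v (j + 1) k * (x j p \<bullet> x (j + 1) k) *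
      (x j q \<bullet> x (j + 1) k)) \<noteq> 0"
    using c[of "Right_mixed j p q"] by (simp add: train_conditions_iff right_mixed_def)
next
  fix j p q assume j: "j \<in> {1..<L}" "p < r (j + 1)" "q < r (j + 1)" "p \<noteq> q"
  then show "(\<Sum>k<r j. left_sum r lam x v j k * (x (j + 1) p \<bullet> x j k) * (x (j + 1) q \<bullet> x j k)) \<noteq> 0"
    using c[of "Left_mixed j p q"] by (simp add: train_conditions_iff left_mixed_def)
qed

text \<open>Correct vectors make the coefficient tensor a product of the permuted, signed
  coefficients \<open>\<mu>\<close>, and starting points with nonzero overlap in every mode are
  generic. The order and signs of the vectors are those of the coefficients because
  \<open>\<mu>\<close> is built from the same \<open>\<pi>\<close> and
  \<open>\<sigma>\<close>.\<close>

lemma als_recovers: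
  assumes gt: "generic_train n L r x" and lam: "\<And>j i. j \<in> {1..L} \<Longrightarrow> i < r j \<Longrightarrow> lam j i \<noteq> 0"
    and y: "\<And>j. j \<in> {1..L} \<Longrightarrow> signed_perm (r j) (x j) (y j)"
  defines "N \<equiv> \<lambda>j. length (y j)" and "R \<equiv> kc_coef_tensor n L (tensor_train L r lam x) y"
  shows "\<exists>H. generic_set (als_coords L N) (als_coords L N \<rightarrow>\<^sub>E UNIV) H \<and>
    (\<forall>h\<in>H. (\<exists>u. als_result L N R (als_start N h) u) \<and>
      (\<forall>u. als_result L N R (als_start N h) u \<longrightarrow> recovers L r lam x y u))"
proof -
  interpret generic_train n L r lam x by (rule gt)
  have "\<exists>\<pi> \<sigma>. length (y j) = r j \<and> \<pi> permutes {..<r j} \<and> (\<forall>i<r j. \<pi> i < r j \<and>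
      \<sigma> i \<in> {1, - 1 :: real} \<and> y j ! i = \<sigma> i \<cdot>\<^sub>v x j (\<pi> i))" if "j \<in> {1..L}" for j
    using y[OF that] by (rule signed_permE) blast
  then obtain \<pi> \<sigma> where
    ps: "\<And>j. j \<in> {1..L} \<Longrightarrow> length (y j) = r j \<and> \<pi> j permutes {..<r j} \<and> (\<forall>i<r j. \<pi> j i < r j \<and>
      \<sigma> j i \<in> {1, - 1 :: real} \<and> y j ! i = \<sigma> j i \<cdot>\<^sub>v x j (\<pi> j i))"
    by metis
  have NN: "N j = r j" if "j \<in> {1..L}" for j using ps[OF that] by (simp add: N_def)
  define \<mu> where "\<mu> j i = \<sigma> j i * lam j (\<pi> j i)" for j i
  have midx: "midx L N = midx L r" unfolding midx_def by (rule PiE_cong) (simp add: NN)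
  have nz: "\<mu> j i \<noteq> 0" if "j \<in> {1..L}" "i < r j" for j i
    using ps[OF that(1)] that lam by (auto simp: \<mu>_def)
  interpret als: rank_one_tensor L N \<mu> R
  proof
    fix i assume "i \<in> midx L N"
    then have "i \<in> midx L r" using midx by simp
    then show "R i = (\<Prod>j=1..L. \<mu> j (i j))" unfolding R_def \<mu>_def
    proof (rule coef_tensor_rank_one[OF L orthonormal, rotated -1])
      show "x k p \<bullet> x (k + 1) q \<noteq> 0" if "1 \<le> k" "k < L" "p < r k" "q < r (k + 1)" for k p q
        using gram that by simp
    qed (use ps in auto)
  qed (use L NN nz ranks in auto)
  let ?C = "als_coords L N"
  define H where "H = {h \<in> ?C \<rightarrow>\<^sub>E UNIV. \<forall>j\<in>{1..L}. (\<Sum>k<N j. \<mu> j k * h (j, k)) \<noteq> 0}"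
  have "generic_set ?C (?C \<rightarrow>\<^sub>E UNIV) H" unfolding H_def
  proof (rule generic_set_affine_space)
    fix j assume j: "j \<in> {1..L}"
    show "poly_fun ?C (\<lambda>h. \<Sum>k<N j. \<mu> j k * h (j, k))"
      by (intro poly_fun_sum poly_fun_mult poly_fun_const poly_fun_coord) (use j in \<open>auto simp: als_coords_def\<close>)
    \<comment> \<open>The factors \<open>\<mu>\<close> themselves: their overlap with themselves is
      a positive sum of squares.\<close>
    let ?h = "restrict (\<lambda>(j, k). \<mu> j k) ?C"
    have "(\<Sum>k<N j. \<mu> j k * ?h (j, k)) = (\<Sum>k<N j. (\<mu> j k)\<^sup>2)"
      using j by (intro sum.cong) (auto simp: als_coords_def power2_eq_square)
    also have "\<dots> > 0"
      using ranks[OF j] nz[OF j] NN[OF j] by (intro sum_pos) (auto simp: lessThan_empty_iff)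
    finally show "\<exists>h\<in>?C \<rightarrow>\<^sub>E UNIV. (\<Sum>k<N j. \<mu> j k * h (j, k)) \<noteq> 0"
      by (intro bexI[of _ ?h]) auto
  qed simp
  moreover have "(\<exists>u. als_result L N R (als_start N h) u) \<and>
      (\<forall>u. als_result L N R (als_start N h) u \<longrightarrow> recovers L r lam x y u)" if h: "h \<in> H" for h
  proof -
    have a: "als.admissible (als_start N h)"
      using h by (simp add: H_def als.admissible_def als.overlap_def als_start_def)
    have "recovers L r lam x y u" if u: "als_result L N R (als_start N h) u" for u
    proof -
      obtain c where au: "als.admissible u" and c: "(\<Prod>j=1..L. c j) = 1"
        "\<And>j. j \<in> {1..L} \<Longrightarrow> c j \<noteq> 0 \<and> (\<forall>k<N j. u j $ k = c j * \<mu> j k)"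
        using als.als_result_admissible[OF u a] by blast
      have "dim_vec (u j) = r j" if "j \<in> {1..L}" for j
        using au NN[OF that] that by (simp add: als.admissible_def)
      moreover have "c j \<noteq> 0 \<and> \<pi> j permutes {..<r j} \<and> (\<forall>i<r j. \<sigma> j i \<in> {1, - 1} \<and>
           y j ! i = \<sigma> j i \<cdot>\<^sub>v x j (\<pi> j i) \<and> u j $ i = c j * (\<sigma> j i * lam j (\<pi> j i)))"
        if "j \<in> {1..L}" for j
        using ps[OF that] c(2)[OF that] NN[OF that] by (simp add: \<mu>_def)
      ultimately show ?thesis unfolding recovers_def using ps c(1) by blast
    qed
    then show ?thesis using als.als_result_exists[OF a] by blast
  qed
  ultimately show ?thesis by blast
qed

theorem theorem2:
  fixes n L :: nat and r :: "nat \<Rightarrow> nat"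
  assumes "L \<ge> 1"
    and "\<And>j. j \<in> {1..L} \<Longrightarrow> 1 \<le> r j \<and> r j \<le> n"
    and "decreasing_ranks L r"
  shows "\<exists>U. generic_set (train_coords n L r) (train_params n L r) U \<and>
    (\<forall>z\<in>U.
      let lam = train_coef z; x = train_vec n z; T = tensor_train L r lam x in
      (\<exists>G. generic_set {..<n} ({..<n} \<rightarrow>\<^sub>E UNIV) G \<and>
        (\<forall>v w. (\<forall>j. v j \<in> vec n ` G \<and> w j \<in> vec n ` G) \<longrightarrow>
          (\<exists>y. kc_vectors n L T v w y) \<and>
          (\<forall>y. kc_vectors n L T v w y \<longrightarrow>
            (let N = (\<lambda>j. length (y j)); R = kc_coef_tensor n L T y in
             \<exists>H. generic_set (als_coords L N) (als_coords L N \<rightarrow>\<^sub>E UNIV) H \<and>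
               (\<forall>h\<in>H.
                 (\<exists>u. als_result L N R (als_start N h) u) \<and>
                 (\<forall>u. als_result L N R (als_start N h) u \<longrightarrow> recovers L r lam x y u)))))) \<and>
      (\<forall>c. (\<Prod>j=1..L. c j) = 1 \<longrightarrow> tensor_train L r (\<lambda>j i. c j * lam j i) x = T))"
proof -
  let ?I = "train_coords n L r" and ?V = "train_params n L r" and ?C = "train_conditions L r"
  \<comment> \<open>Each condition may have its own \<open>v\<close> here. For such a train every
    condition is a nonzero polynomial in the direction, and this is all that the choice of common
    generic directions needs.\<close>
  let ?U = "{z \<in> ?V. \<forall>c\<in>?C. \<exists>v\<in>carrier_vec n. condition_value L r c (train_coef z) (train_vec n z) v \<noteq> 0}"
  show ?thesis unfolding Let_def
  proof (intro exI[of _ ?U] conjI ballI, goal_cases)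
    case 1
    show ?case
    proof (rule generic_set_nonvanishing[OF finite_train_conditions])
      show "?V \<subseteq> ?I \<rightarrow>\<^sub>E UNIV" by (auto simp: train_params_def)
      show "poly_fun ?I (\<lambda>z. condition_value L r c (train_coef z) (train_vec n z) v)" if "c \<in> ?C" "v \<in> carrier_vec n" for c v
        by (rule poly_fun_train_condition[OF that(1)])
          (intro poly_fun_train_coef poly_fun_train_vec_scalar_prod poly_fun_train_gram that(2); assumption)+
      show "\<exists>z'. reach ?I ?V z z' \<and> (\<exists>v\<in>carrier_vec n. condition_value L r c (train_coef z') (train_vec n z') v \<noteq> 0)"
        if "c \<in> ?C" "z \<in> ?V" for c z
        by (rule reach_train_condition[OF _ that(2,1)]) (use assms(2) in blast)
    qed
  next
    case (2 z)
    note z = this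
    let ?lam = "train_coef z" and ?x = "train_vec n z"
    have c: "\<exists>v\<in>carrier_vec n. condition_value L r c ?lam ?x v \<noteq> 0" if "c \<in> ?C" for c using z that by blast
    have zV: "z \<in> ?V" using z by simp
    have gt: "generic_train n L r ?x"
      by (rule generic_train_of_conditions[OF assms(1,2) zV c])
    interpret generic_train n L r ?lam ?x by (rule gt)
    have lam: "?lam j i \<noteq> 0" if "j \<in> {1..L}" "i < r j" for j i
      using c[of "Coef_cond j i"] that by (auto simp: train_conditions_iff)
    \<comment> \<open>Now all conditions are demanded of the same direction; that each of them can
      be met separately is the membership of \<open>z\<close> in the set above.\<close>
    define G where "G = {f \<in> {..<n} \<rightarrow>\<^sub>E UNIV. \<forall>c\<in>?C. condition_value L r c ?lam ?x (vec n f) \<noteq> 0}"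
    have G: "generic_set {..<n} ({..<n} \<rightarrow>\<^sub>E UNIV) G" unfolding G_def
    proof (rule generic_set_affine_space[OF finite_train_conditions])
      fix c assume cC: "c \<in> ?C"
      have "poly_fun {..<n} (\<lambda>f. ?x j i \<bullet> vec n f)" for j i
      proof -
        have eq: "?x j i \<bullet> vec n f = (\<Sum>k<n. ?x j i $ k * f k)" for f
          by (simp add: scalar_prod_def atLeast0LessThan)
        show ?thesis unfolding eq by (intro poly_fun_sum poly_fun_mult poly_fun_const poly_fun_coord)
      qed
      then show "poly_fun {..<n} (\<lambda>f. condition_value L r c ?lam ?x (vec n f))"
        by (intro poly_fun_train_condition[OF cC] poly_fun_const)
      obtain v where v: "v \<in> carrier_vec n" "condition_value L r c ?lam ?x v \<noteq> 0" using c[OF cC] by blast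
      have "vec n (restrict (($) v) {..<n}) = v" using v(1) by (intro eq_vecI) auto
      then show "\<exists>f\<in>{..<n} \<rightarrow>\<^sub>E UNIV. condition_value L r c ?lam ?x (vec n f) \<noteq> 0"
        using v(2) by (intro bexI[of _ "restrict (($) v) {..<n}"]) auto
    qed
    have dir: "generic_direction n L r ?lam ?x v" if "v \<in> vec n ` G" for v
      using that by (intro generic_direction_of_conditions) (auto simp: G_def)
    show ?case
    proof (intro exI[of _ G] conjI allI impI, goal_cases)
      case 1
      show ?case by (rule G)
    next
      case (2 v w)
      then have "generic_direction n L r ?lam ?x (v j)" "generic_direction n L r ?lam ?x (w j)" for j
        using dir by blast+
      then show ?case by (rule kc_vectors_exists)
    next
      case (3 v w y)
      then have v: "generic_direction n L r ?lam ?x (v j)" and w: "generic_direction n L r ?lam ?x (w j)" for j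
        using dir by blast+
      show ?case by (rule als_recovers[OF gt lam kc_vectors_recovers[OF assms(3) v w 3(2)]])
    qed
  next
    case (3 z)
    show ?case using tensor_train_rescale by blast
  qed
qed

end
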